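(* Let $(W,S)$ be a Coxeter system. The map $(\mathcal D,\lambda)\mapsto\Lambda(\mathcal D,\lambda)$ is a bijection between the set of pairs consisting of a staircase diagram $\mathcal D$ on the Coxeter–Dynkin graph of $(W,S)$ together with a nearly-maximal labelling $\lambda$ of $\mathcal D$, and the set of elements of $W$ that have a complete BP decomposition.
   Context: Coxeter–Dynkin graph on $S$ with $s\sim t$ iff $m_{st}\ge3$. For $J\subseteq S$: $W_J$ parabolic subgroup, $W^J$ minimal length left coset representatives of $W/W_J$, $u_J$ longest element of $W_J$ when finite. $D_L,D_R$ descent sets, $S(w)$ support. A parabolic decomposition $w=vu$ ($v\in W^J$, $u\in W_J$) is a BP decomposition if $S(v)\cap J\subseteq D_L(u)$, Grassmannian if $|J|=|S(w)|-1$. A complete BP decomposition of $w$ is a factorization $w=v_n\cdots v_1$ with $v_i(v_{i-1}\cdots v_1)$ a Grassmannian BP decomposition for every $i=2,\dots,n$. $w$ is maximal if $w=u_{S(w)}$; a non-maximal $w$ is nearly-maximal if it has a Grassmannian BP decomposition $w=vu$ with $S(u)\subset S(v)$. Staircase diagram: poset $(\mathcal D,\preceq)$ of nonempty subsets (blocks) of $S$ with: (1) each block connected, and if $B$ covers $B'$ then $B\cup B'$ connected; (2) $\mathcal D_s=\{B:s\in B\}$ a chain; (3) if $s\sim t$, $\mathcal D_s\cup\mathcal D_t$ a chain in which $\mathcal D_s,\mathcal D_t$ are saturated; (4) each $B$ is the minimum of some $\mathcal D_s$ and maximum of some $\mathcal D_{s'}$. $J_R(B)=\{s\in B: B\ne\min\mathcal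 D_s\}$, $J_L(B)=\{s\in B: B\ne\max\mathcal D_s\}$. Labelling: $\lambda:\mathcal D\to W$ (with these sets spherical) such that $J_R(B)\subseteq D_R(\lambda(B))$, $J_L(B)\subseteq D_L(\lambda(B))$, $S(\lambda(B)u_{J_R(B)})=S(u_{J_L(B)}\lambda(B))=B$; nearly-maximal if each $\lambda(B)$ is maximal or nearly-maximal. $\Lambda(\mathcal D,\lambda)=\overline\lambda(B_n)\cdots\overline\lambda(B_1)$ with $\overline\lambda(B)=\lambda(B)u_{J_R(B)}$ for any linear extension $B_1,\dots,B_n$.
   Formalization: A complete BP decomposition is required to have n = |S(w)| factors (otherwise w = v_1 always qualifies and the claim is false); Grassmannian means J is a subset of S(w) with |J| = |S(w)|-1; staircase diagrams are taken finite. *)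

theory Defs
  imports "HOL-Algebra.Generated_Groups" "HOL-Algebra.Multiplicative_Group"
begin

section \<open>Coxeter systems\<close>

definition word_prod :: "('a, 'b) monoid_scheme \<Rightarrow> 'a list \<Rightarrow> 'a" where
  "word_prod G ws = foldr (\<otimes>\<^bsub>G\<^esub>) ws \<one>\<^bsub>G\<^esub>"

text \<open>One application of a defining relation \<open>(s t)\<^sup>m = 1\<close> inside a word, where \<open>m = m\<^sub>s\<^sub>t\<close> is the
  order of \<open>s t\<close>. The library's order function returns 0 for an element of infinite order, and
  then the relation is the void one; \<open>s = t\<close> gives \<open>s s = 1\<close>, so inverse letters are not needed.\<close>

inductive cox_step :: "('a, 'b) monoid_scheme \<Rightarrow> 'a set \<Rightarrow> 'a list \<Rightarrow> 'a list \<Rightarrow> bool"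
  for G S where
  "\<lbrakk>s \<in> S; t \<in> S; xs \<in> lists S; ys \<in> lists S\<rbrakk> \<Longrightarrow>
     cox_step G S (xs @ concat (replicate (group.ord G (s \<otimes>\<^bsub>G\<^esub> t)) [s, t]) @ ys) (xs @ ys)"

text \<open>The last assumption says that the relations \<open>(s t)\<^sup>m = 1\<close> present the group.
  The set \<open>S\<close> of generators may be infinite.\<close>

locale coxeter_system = group G for G (structure) +
  fixes S :: "'a set"
  assumes gens_closed: "S \<subseteq> carrier G"
    and gens_order_2: "\<And>s. s \<in> S \<Longrightarrow> ord s = 2"
    and gens_generate: "generate G S = carrier G"
    and presentation: "\<And>us vs. \<lbrakk>us \<in> lists S; vs \<in> lists S; word_prod G us = word_prod G vs\<rbrakk>
                         \<Longrightarrow> equivclp (cox_step G S) us vs"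

definition cox_length :: "('a, 'b) monoid_scheme \<Rightarrow> 'a set \<Rightarrow> 'a \<Rightarrow> nat" where
  "cox_length G S w = (LEAST n. \<exists>ws \<in> lists S. length ws = n \<and> word_prod G ws = w)"

definition reduced_word :: "('a, 'b) monoid_scheme \<Rightarrow> 'a set \<Rightarrow> 'a list \<Rightarrow> 'a \<Rightarrow> bool" where
  "reduced_word G S ws w \<longleftrightarrow>
     ws \<in> lists S \<and> word_prod G ws = w \<and> length ws = cox_length G S w"

definition supp :: "('a, 'b) monoid_scheme \<Rightarrow> 'a set \<Rightarrow> 'a \<Rightarrow> 'a set" where
  "supp G S w = {s. \<exists>ws. reduced_word G S ws w \<and> s \<in> set ws}"

definition left_descents :: "('a, 'b) monoid_scheme \<Rightarrow> 'a set \<Rightarrow> 'a \<Rightarrow> 'a set" where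
  "left_descents G S w = {s \<in> S. cox_length G S (s \<otimes>\<^bsub>G\<^esub> w) < cox_length G S w}"

definition right_descents :: "('a, 'b) monoid_scheme \<Rightarrow> 'a set \<Rightarrow> 'a \<Rightarrow> 'a set" where
  "right_descents G S w = {s \<in> S. cox_length G S (w \<otimes>\<^bsub>G\<^esub> s) < cox_length G S w}"

text \<open>\<open>W\<^sub>J\<close> is \<^term>\<open>generate G J\<close>; the following is \<open>W\<^sup>J\<close>.\<close>

definition min_coset_reps :: "('a, 'b) monoid_scheme \<Rightarrow> 'a set \<Rightarrow> 'a set \<Rightarrow> 'a set" where
  "min_coset_reps G S J =
     {v \<in> carrier G. \<forall>x \<in> v <#\<^bsub>G\<^esub> generate G J. cox_length G S v \<le> cox_length G S x}"

definition spherical :: "('a, 'b) monoid_scheme \<Rightarrow> 'a set \<Rightarrow> 'a set \<Rightarrow> bool" where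
  "spherical G S J \<longleftrightarrow> J \<subseteq> S \<and> finite (generate G J)"

definition longest_elt :: "('a, 'b) monoid_scheme \<Rightarrow> 'a set \<Rightarrow> 'a set \<Rightarrow> 'a" where
  "longest_elt G S J =
     (THE u. u \<in> generate G J \<and> (\<forall>x \<in> generate G J. cox_length G S x \<le> cox_length G S u))"


section \<open>Billey-Postnikov decompositions\<close>

definition parabolic_decomp ::
  "('a, 'b) monoid_scheme \<Rightarrow> 'a set \<Rightarrow> 'a set \<Rightarrow> 'a \<Rightarrow> 'a \<Rightarrow> 'a \<Rightarrow> bool" where
  "parabolic_decomp G S J w v u \<longleftrightarrow>
     J \<subseteq> S \<and> v \<in> min_coset_reps G S J \<and> u \<in> generate G J \<and> w = v \<otimes>\<^bsub>G\<^esub> u"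

definition BP_decomp ::
  "('a, 'b) monoid_scheme \<Rightarrow> 'a set \<Rightarrow> 'a set \<Rightarrow> 'a \<Rightarrow> 'a \<Rightarrow> 'a \<Rightarrow> bool" where
  "BP_decomp G S J w v u \<longleftrightarrow>
     parabolic_decomp G S J w v u \<and> supp G S v \<inter> J \<subseteq> left_descents G S u"

text \<open>A Grassmannian decomposition is taken with respect to a subset \<open>J\<close> of the support of \<open>w\<close>.
  Without that restriction, a \<open>J\<close> disjoint from the support would make the trivial factorization
  \<open>w = w 1\<close> Grassmannian.\<close>

definition grassmannian_BP ::
  "('a, 'b) monoid_scheme \<Rightarrow> 'a set \<Rightarrow> 'a \<Rightarrow> 'a \<Rightarrow> 'a \<Rightarrow> bool" where
  "grassmannian_BP G S w v u \<longleftrightarrow>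
     (\<exists>J. J \<subseteq> supp G S w \<and> card J + 1 = card (supp G S w) \<and> BP_decomp G S J w v u)"

text \<open>\<open>desc_prod [x\<^sub>1, \<dots>, x\<^sub>n]\<close> is \<open>x\<^sub>n \<cdots> x\<^sub>1\<close>.\<close>

definition desc_prod :: "('a, 'b) monoid_scheme \<Rightarrow> 'a list \<Rightarrow> 'a" where
  "desc_prod G xs = word_prod G (rev xs)"

text \<open>The list \<open>vs\<close> is \<open>[v\<^sub>1, \<dots>, v\<^sub>n]\<close>. Completeness means that the number \<open>n\<close> of factors is the size
  of the support: a Grassmannian step lowers the support by one generator, so \<open>v\<^sub>1\<close> is then a
  single generator. If \<open>n\<close> were unrestricted, the one-factor list \<open>[w]\<close> would always qualify. The
  identity has the empty decomposition.\<close>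

definition complete_BP_decomp ::
  "('a, 'b) monoid_scheme \<Rightarrow> 'a set \<Rightarrow> 'a \<Rightarrow> 'a list \<Rightarrow> bool" where
  "complete_BP_decomp G S w vs \<longleftrightarrow>
     set vs \<subseteq> carrier G \<and> w = desc_prod G vs \<and> length vs = card (supp G S w) \<and>
     (\<forall>i \<in> {1..<length vs}.
        grassmannian_BP G S (desc_prod G (take (Suc i) vs)) (vs ! i) (desc_prod G (take i vs)))"

definition maximal_elt :: "('a, 'b) monoid_scheme \<Rightarrow> 'a set \<Rightarrow> 'a \<Rightarrow> bool" where
  "maximal_elt G S w \<longleftrightarrow>
     w \<in> carrier G \<and> spherical G S (supp G S w) \<and> w = longest_elt G S (supp G S w)"

definition nearly_maximal_elt :: "('a, 'b) monoid_scheme \<Rightarrow> 'a set \<Rightarrow> 'a \<Rightarrow> bool" where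
  "nearly_maximal_elt G S w \<longleftrightarrow>
     w \<in> carrier G \<and> \<not> maximal_elt G S w \<and>
     (\<exists>v u. grassmannian_BP G S w v u \<and> supp G S u \<subset> supp G S v)"


section \<open>Staircase diagrams\<close>

text \<open>Adjacency in the Coxeter-Dynkin graph; order 0 encodes \<open>m\<^sub>s\<^sub>t = \<infinity>\<close>.\<close>

definition dynkin_adj :: "('a, 'b) monoid_scheme \<Rightarrow> 'a set \<Rightarrow> 'a \<Rightarrow> 'a \<Rightarrow> bool" where
  "dynkin_adj G S s t \<longleftrightarrow> s \<in> S \<and> t \<in> S \<and>
     (group.ord G (s \<otimes>\<^bsub>G\<^esub> t) \<ge> 3 \<or> group.ord G (s \<otimes>\<^bsub>G\<^esub> t) = 0)"

definition dynkin_connected :: "('a, 'b) monoid_scheme \<Rightarrow> 'a set \<Rightarrow> 'a set \<Rightarrow> bool" where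
  "dynkin_connected G S B \<longleftrightarrow>
     (\<forall>s \<in> B. \<forall>t \<in> B. (\<lambda>x y. x \<in> B \<and> y \<in> B \<and> dynkin_adj G S x y)\<^sup>*\<^sup>* s t)"

text \<open>A partial order on a set \<open>D\<close> of blocks is a relation \<open>r \<subseteq> D \<times> D\<close>;
  \<open>(B', B) \<in> r\<close> reads \<open>B' \<preceq> B\<close>.\<close>

definition covers :: "'b set \<Rightarrow> 'b rel \<Rightarrow> 'b \<Rightarrow> 'b \<Rightarrow> bool" where
  "covers D r B B' \<longleftrightarrow> B \<in> D \<and> B' \<in> D \<and> (B', B) \<in> r \<and> B' \<noteq> B \<and>
     \<not> (\<exists>C \<in> D. C \<noteq> B' \<and> C \<noteq> B \<and> (B', C) \<in> r \<and> (C, B) \<in> r)"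

definition saturated_in :: "'b rel \<Rightarrow> 'b set \<Rightarrow> 'b set \<Rightarrow> bool" where
  "saturated_in r P C \<longleftrightarrow> C \<subseteq> P \<and>
     \<not> (\<exists>x \<in> C. \<exists>y \<in> C. \<exists>z \<in> P - C. (x, z) \<in> r \<and> (z, y) \<in> r)"

definition blocks_at :: "'a set set \<Rightarrow> 'a \<Rightarrow> 'a set set" where
  "blocks_at D s = {B \<in> D. s \<in> B}"

definition is_minimum :: "'b rel \<Rightarrow> 'b set \<Rightarrow> 'b \<Rightarrow> bool" where
  "is_minimum r C B \<longleftrightarrow> B \<in> C \<and> (\<forall>B' \<in> C. (B, B') \<in> r)"

definition is_maximum :: "'b rel \<Rightarrow> 'b set \<Rightarrow> 'b \<Rightarrow> bool" where
  "is_maximum r C B \<longleftrightarrow> B \<in> C \<and> (\<forall>B' \<in> C. (B', B) \<in> r)"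

text \<open>Diagrams are finite, as needed for a linear extension \<open>B\<^sub>1, \<dots>, B\<^sub>n\<close> to exist. If \<open>S\<close> is finite
  this is automatic.\<close>

definition staircase_diagram ::
  "('a, 'b) monoid_scheme \<Rightarrow> 'a set \<Rightarrow> 'a set set \<Rightarrow> 'a set rel \<Rightarrow> bool" where
  "staircase_diagram G S D r \<longleftrightarrow>
     finite D \<and> partial_order_on D r \<and> (\<forall>B \<in> D. B \<noteq> {} \<and> B \<subseteq> S) \<and>
     (\<forall>B \<in> D. dynkin_connected G S B) \<and>
     (\<forall>B B'. covers D r B B' \<longrightarrow> dynkin_connected G S (B \<union> B')) \<and>
     (\<forall>s \<in> S. blocks_at D s \<in> Chains r) \<and>
     (\<forall>s t. dynkin_adj G S s t \<longrightarrow>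
        blocks_at D s \<union> blocks_at D t \<in> Chains r \<and>
        saturated_in r (blocks_at D s \<union> blocks_at D t) (blocks_at D s) \<and>
        saturated_in r (blocks_at D s \<union> blocks_at D t) (blocks_at D t)) \<and>
     (\<forall>B \<in> D. (\<exists>s \<in> S. is_minimum r (blocks_at D s) B) \<and>
              (\<exists>s' \<in> S. is_maximum r (blocks_at D s') B))"

definition J_R :: "'a set set \<Rightarrow> 'a set rel \<Rightarrow> 'a set \<Rightarrow> 'a set" where
  "J_R D r B = {s \<in> B. \<not> is_minimum r (blocks_at D s) B}"

definition J_L :: "'a set set \<Rightarrow> 'a set rel \<Rightarrow> 'a set \<Rightarrow> 'a set" where
  "J_L D r B = {s \<in> B. \<not> is_maximum r (blocks_at D s) B}"

definition bar_label ::
  "('a, 'b) monoid_scheme \<Rightarrow> 'a set \<Rightarrow> 'a set set \<Rightarrow> 'a set rel \<Rightarrow> ('a set \<Rightarrow> 'a) \<Rightarrow> 'a set \<Rightarrow> 'a" where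
  "bar_label G S D r lam B = lam B \<otimes>\<^bsub>G\<^esub> longest_elt G S (J_R D r B)"

text \<open>The extensional function space makes a labelling a function on \<open>D\<close> proper, with no spurious
  values outside \<open>D\<close>.\<close>

definition labelling ::
  "('a, 'b) monoid_scheme \<Rightarrow> 'a set \<Rightarrow> 'a set set \<Rightarrow> 'a set rel \<Rightarrow> ('a set \<Rightarrow> 'a) \<Rightarrow> bool" where
  "labelling G S D r lam \<longleftrightarrow>
     lam \<in> D \<rightarrow>\<^sub>E carrier G \<and>
     (\<forall>B \<in> D.
        spherical G S (J_R D r B) \<and> spherical G S (J_L D r B) \<and>
        J_R D r B \<subseteq> right_descents G S (lam B) \<and>
        J_L D r B \<subseteq> left_descents G S (lam B) \<and>
        supp G S (lam B \<otimes>\<^bsub>G\<^esub> longest_elt G S (J_R D r B)) = B \<and>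
        supp G S (longest_elt G S (J_L D r B) \<otimes>\<^bsub>G\<^esub> lam B) = B)"

definition nearly_maximal_labelling ::
  "('a, 'b) monoid_scheme \<Rightarrow> 'a set \<Rightarrow> 'a set set \<Rightarrow> 'a set rel \<Rightarrow> ('a set \<Rightarrow> 'a) \<Rightarrow> bool" where
  "nearly_maximal_labelling G S D r lam \<longleftrightarrow>
     labelling G S D r lam \<and>
     (\<forall>B \<in> D. maximal_elt G S (lam B) \<or> nearly_maximal_elt G S (lam B))"

definition linear_extension :: "'b set \<Rightarrow> 'b rel \<Rightarrow> 'b list \<Rightarrow> bool" where
  "linear_extension D r Bs \<longleftrightarrow>
     set Bs = D \<and> distinct Bs \<and>
     (\<forall>i < length Bs. \<forall>j < length Bs. (Bs ! i, Bs ! j) \<in> r \<longrightarrow> i \<le> j)"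

text \<open>The product \<open>\<Lambda>(D, lam)\<close>, which must come out the same for every linear extension.\<close>

definition Lambda ::
  "('a, 'b) monoid_scheme \<Rightarrow> 'a set \<Rightarrow> 'a set set \<Rightarrow> 'a set rel \<Rightarrow> ('a set \<Rightarrow> 'a) \<Rightarrow> 'a" where
  "Lambda G S D r lam =
     (THE w. \<forall>Bs. linear_extension D r Bs \<longrightarrow> w = desc_prod G (map (bar_label G S D r lam) Bs))"

end

theory Submission
  imports Defs
begin

text \<open>
  Write \<open>S(w)\<close> for the support and \<open>u\<^sub>J\<close> for the longest element of \<open>W\<^sub>J\<close>. A Grassmannian BP
  decomposition \<open>w = v u\<close> which removes \<open>s\<close> amounts, with \<open>B = S(v)\<close> and \<open>K = B - {s}\<close>, to a length
  additive factorization \<open>w = b y\<close> in which \<open>b = v u\<^sub>K\<close> is maximal or nearly maximal with support \<open>B\<close>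
  and right descents \<open>K\<close> at least, \<open>y\<close> has no left descent in \<open>B\<close>, and \<open>s \<notin> S(y)\<close>.
  The key rigidity is that for such a \<open>b\<close>, any factorization \<open>b = a x\<close> with \<open>a \<in> W\<^sub>J\<close>,
  \<open>J \<subset> B\<close>, and \<open>x\<close> without left descents in \<open>J\<close> has \<open>S(x) = B\<close>.

  A maximal block \<open>B\<close> of a diagram splits off \<open>\<lambda>(B) u\<^sub>N\<close> with \<open>N = J\<^sub>R(B)\<close> on the left of
  \<open>\<Lambda>\<close>. By induction on the number of blocks one reads off the left descents of \<open>\<Lambda>\<close>; they contain
  \<open>N\<close>, so that \<open>\<Lambda> = \<lambda>(B) y\<close> is of the form above. Conversely, by rigidity every factorization \<open>w = b y\<close>
  as above of \<open>w = \<Lambda>(D, \<lambda>)\<close> comes from a maximal block \<open>B\<close> with \<open>\<lambda>(B) = b\<close>, and \<open>S(y)\<close> is the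
  union of the other blocks. So a maximal block can be recognised in \<open>w\<close> and peeled off, which gives
  injectivity. For surjectivity, the descent formula shows that one obtains a diagram for \<open>b y\<close> from one for
  \<open>u\<^sub>K y\<close> by deleting the blocks contained in \<open>B\<close> and adding \<open>B\<close> on top.
\<close>

subsection \<open>Linear extensions\<close>

text \<open>The group is known only through generators and relations, so the exchange condition has
  to be derived first: the parity with which a reflection occurs in a word is invariant under the
  relations. Supports, coset representatives and longest elements then rest on exchange, for
  possibly infinite \<open>S\<close>.

  The obstacle is that a factorization \<open>w = b y\<close> could a priori cut across blocks.
  Rigidity excludes this, for the following reason. A right descent of \<open>a x\<close> outside
  the support of \<open>x\<close> commutes with that whole support. If the support missed part of
  \<open>B\<close>, connectedness would give a missing generator adjacent to it, and this
  non-descent could only be \<open>s\<close>. Then \<open>x\<close> lies in \<open>W K\<close>, so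
  \<open>a\<close> and \<open>b\<close> have the same minimal representative modulo
  \<open>W K\<close>; its support is \<open>B\<close>, yet \<open>a\<close> lies in
  \<open>W J\<close>.

  Deleting the blocks inside \<open>B\<close> is harmless because they consist of left descents of
  the product: such a block \<open>C\<close> is topmost with label \<open>wo C\<close>, so its
  factor is absorbed by the longest element that is cancelled anyway.\<close>

lemma linear_extension_sorted:
  "linear_extension D r Bs \<longleftrightarrow> set Bs = D \<and> distinct Bs \<and> sorted_wrt (\<lambda>x y. (y, x) \<notin> r) Bs"
  unfolding linear_extension_def sorted_wrt_iff_nth_less
  by (metis leD leI order.strict_trans order.strict_iff_order)

definition topmost where
  "topmost D r B \<longleftrightarrow> B \<in> D \<and> (\<forall>X\<in>D. (B, X) \<in> r \<longrightarrow> X = B)"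

lemma linear_extension_snoc:
  assumes "linear_extension (D - {B}) r Bs" "topmost D r B"
  shows "linear_extension D r (Bs @ [B])"
  using assms unfolding linear_extension_sorted topmost_def by (auto simp: sorted_wrt_append)

text \<open>Among the elements of \<open>C\<close> above \<open>x\<close>, one whose down-set in
  \<open>D\<close> is largest must be maximal, because a strict step upwards enlarges the down-set.
  Applied to the converse order, this also yields minimal elements.\<close>

lemma finite_maximal_above:
  assumes fin: "finite D" and po: "partial_order_on D r" and C: "C \<subseteq> D" "x \<in> C"
  obtains y where "y \<in> C" "(x, y) \<in> r" "\<And>z. z \<in> C \<Longrightarrow> (y, z) \<in> r \<Longrightarrow> z = y"
proof -
  have r: "r \<subseteq> D \<times> D" "refl_on D r" "trans r" "antisym r"
    using po by (auto simp: partial_order_on_def preorder_on_def)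
  let ?f = "\<lambda>y. card {z \<in> D. (z, y) \<in> r}"
  have "\<exists>y. (y \<in> C \<and> (x, y) \<in> r) \<and> (\<forall>z. z \<in> C \<and> (x, z) \<in> r \<longrightarrow> ?f z \<le> ?f y)"
  proof (rule ex_has_greatest_nat)
    show "x \<in> C \<and> (x, x) \<in> r" using C r by (auto simp: refl_on_def)
    show "\<forall>z. z \<in> C \<and> (x, z) \<in> r \<longrightarrow> ?f z < Suc (card D)"
      using fin by (auto simp: less_Suc_eq_le intro!: card_mono)
  qed
  then obtain y where y: "y \<in> C" "(x, y) \<in> r" "\<And>z. z \<in> C \<Longrightarrow> (x, z) \<in> r \<Longrightarrow> ?f z \<le> ?f y" by blast
  show thesis
  proof (rule that[OF y(1,2)], rule ccontr)
    fix z assume z: "z \<in> C" "(y, z) \<in> r" "z \<noteq> y"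
    have "{u \<in> D. (u, y) \<in> r} \<subset> {u \<in> D. (u, z) \<in> r}"
    proof
      show "{u \<in> D. (u, y) \<in> r} \<subseteq> {u \<in> D. (u, z) \<in> r}" using z r by (auto dest: transD)
      have "z \<in> D" "(z, z) \<in> r" "(z, y) \<notin> r" using z C r by (auto simp: refl_on_def dest: antisymD)
      then show "{u \<in> D. (u, y) \<in> r} \<noteq> {u \<in> D. (u, z) \<in> r}" by blast
    qed
    then have "?f y < ?f z" using fin by (intro psubset_card_mono) auto
    moreover have "?f z \<le> ?f y" using y z r by (meson transD)
    ultimately show False by simp
  qed
qed

lemma partial_order_restrict:
  "partial_order_on D r \<Longrightarrow> E \<subseteq> D \<Longrightarrow> partial_order_on E (r \<inter> E \<times> E)"
  by (auto simp: partial_order_on_def preorder_on_def refl_on_def trans_def antisym_def)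

lemma linear_extension_exists:
  "finite D \<Longrightarrow> partial_order_on D r \<Longrightarrow> \<exists>Bs. linear_extension D r Bs"
proof (induction "card D" arbitrary: D r)
  case 0
  then show ?case by (intro exI[of _ "[]"]) (auto simp: linear_extension_def)
next
  case (Suc n)
  then obtain x where x: "x \<in> D" by fastforce
  obtain B where B: "B \<in> D" "\<And>z. z \<in> D \<Longrightarrow> (B, z) \<in> r \<Longrightarrow> z = B"
    using finite_maximal_above[OF Suc(3,4) order.refl x] by blast
  let ?E = "D - {B}"
  obtain Bs where "linear_extension ?E (r \<inter> ?E \<times> ?E) Bs"
  proof -
    have "n = card ?E" "finite ?E" using Suc(2,3) B(1) by auto
    from Suc(1)[OF this partial_order_restrict[OF Suc(4), of ?E]] that show thesis by blast
  qed
  then have "linear_extension ?E r Bs"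
    unfolding linear_extension_def by (metis IntI SigmaI nth_mem)
  then show ?case using linear_extension_snoc[of D B r Bs] B by (auto simp: topmost_def)
qed

context coxeter_system
begin

subsection \<open>Words and the exchange condition\<close>

abbreviation W where "W J \<equiv> generate G J"
abbreviation wp where "wp ws \<equiv> word_prod G ws"
abbreviation len where "len w \<equiv> cox_length G S w"
abbreviation sp where "sp w \<equiv> supp G S w"
abbreviation DL where "DL w \<equiv> left_descents G S w"
abbreviation DR where "DR w \<equiv> right_descents G S w"

lemma gen_carrier [simp]: "s \<in> S \<Longrightarrow> s \<in> carrier G"
  using gens_closed by auto

lemma gen_sq: "s \<in> S \<Longrightarrow> s \<otimes> s = \<one>"
  using pow_ord_eq_1[of s] gens_order_2[of s] by (simp add: numeral_2_eq_2)

lemma gen_inv [simp]: "s \<in> S \<Longrightarrow> inv s = s"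
  by (simp add: gen_sq inv_equality)

lemma gen_cancel: "s \<in> S \<Longrightarrow> x \<in> carrier G \<Longrightarrow> s \<otimes> (s \<otimes> x) = x"
  by (metis gen_carrier gen_sq l_one m_assoc)

lemma gen_cancel_right: "s \<in> S \<Longrightarrow> x \<in> carrier G \<Longrightarrow> x \<otimes> s \<otimes> s = x"
  by (simp add: gen_sq m_assoc)

lemma inv_cancel: "x \<in> carrier G \<Longrightarrow> y \<in> carrier G \<Longrightarrow> inv x \<otimes> (x \<otimes> y) = y"
  "x \<in> carrier G \<Longrightarrow> y \<in> carrier G \<Longrightarrow> x \<otimes> (inv x \<otimes> y) = y"
  by (simp_all flip: m_assoc)

lemma gen_not_one: "s \<in> S \<Longrightarrow> s \<noteq> \<one>"
  using gens_order_2[of s] ord_eq_1[of s] by auto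

lemma wp_Nil [simp]: "wp [] = \<one>"
  by (simp add: word_prod_def)

lemma wp_Cons [simp]: "wp (x # xs) = x \<otimes> wp xs"
  by (simp add: word_prod_def)

lemma wp_carrier [simp]: "set xs \<subseteq> carrier G \<Longrightarrow> wp xs \<in> carrier G"
  by (induction xs) auto

lemma wp_word [simp]: "set ws \<subseteq> S \<Longrightarrow> wp ws \<in> carrier G"
  by (rule wp_carrier) auto

lemma wp_append: "set xs \<subseteq> carrier G \<Longrightarrow> set ys \<subseteq> carrier G \<Longrightarrow> wp (xs @ ys) = wp xs \<otimes> wp ys"
  by (induction xs) (auto simp: m_assoc)

lemma wp_rev: "set ws \<subseteq> S \<Longrightarrow> wp (rev ws) = inv (wp ws)"
proof (induction ws)
  case (Cons s ws)
  have "wp (rev (s # ws)) = wp (rev ws) \<otimes> wp [s]"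
    using Cons.prems by (subst wp_append[symmetric]) auto
  then show ?case using Cons by (simp add: inv_mult_group)
qed simp

lemma W_carrier: "J \<subseteq> S \<Longrightarrow> W J \<subseteq> carrier G"
  using gens_closed generate_in_carrier by blast

lemma W_closed [simp]: "x \<in> W J \<Longrightarrow> J \<subseteq> S \<Longrightarrow> x \<in> carrier G"
  using W_carrier by blast

lemma W_mult: "x \<in> W J \<Longrightarrow> y \<in> W J \<Longrightarrow> x \<otimes> y \<in> W J"
  by (rule generate.eng)

lemma W_one: "\<one> \<in> W J" by (rule generate.one)

lemma W_gen: "s \<in> J \<Longrightarrow> s \<in> W J" by (rule generate.incl)

lemma W_inv: "J \<subseteq> S \<Longrightarrow> x \<in> W J \<Longrightarrow> inv x \<in> W J"
  using generate_m_inv_closed gens_closed by (meson subset_trans)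

lemma W_mono: "I \<subseteq> J \<Longrightarrow> x \<in> W I \<Longrightarrow> x \<in> W J"
  using mono_generate by blast

lemma W_word: "set ws \<subseteq> J \<Longrightarrow> wp ws \<in> W J"
  by (induction ws) (auto intro: W_mult W_one W_gen)

lemma W_obtain_word:
  assumes "J \<subseteq> S" "w \<in> W J"
  obtains ws where "set ws \<subseteq> J" "wp ws = w"
proof -
  have "\<exists>ws. set ws \<subseteq> J \<and> wp ws = w"
    using assms(2)
  proof (induction rule: generate.induct)
    case one
    show ?case by (rule exI[of _ "[]"]) simp
  next
    case (incl h)
    then show ?case using assms(1) by (intro exI[of _ "[h]"]) auto
  next
    case (inv h)
    then show ?case using assms(1) by (intro exI[of _ "[h]"]) auto
  next
    case (eng x y)
    then obtain xs ys where "set xs \<subseteq> J" "wp xs = x" "set ys \<subseteq> J" "wp ys = y" by blast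
    moreover from this assms(1) gens_closed have "set xs \<subseteq> carrier G" "set ys \<subseteq> carrier G" by blast+
    ultimately show ?case by (intro exI[of _ "xs @ ys"]) (auto simp: wp_append)
  qed
  then show thesis using that by blast
qed

lemma W_full: "W S = carrier G"
  by (rule gens_generate)

lemma obtain_word:
  assumes "w \<in> carrier G"
  obtains ws where "set ws \<subseteq> S" "wp ws = w"
  using W_obtain_word[of S w] assms W_full by auto

lemma len_le: "set ws \<subseteq> S \<Longrightarrow> len (wp ws) \<le> length ws"
  unfolding cox_length_def by (rule Least_le) auto

lemma obtain_reduced:
  assumes "w \<in> carrier G"
  obtains ws where "set ws \<subseteq> S" "wp ws = w" "length ws = len w"
proof -
  obtain vs where "set vs \<subseteq> S" "wp vs = w" using obtain_word assms by blast
  then have "\<exists>n. \<exists>ws \<in> lists S. length ws = n \<and> wp ws = w" by auto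
  from LeastI_ex[OF this] show thesis using that unfolding cox_length_def by auto
qed

lemma len_mult: "x \<in> carrier G \<Longrightarrow> y \<in> carrier G \<Longrightarrow> len (x \<otimes> y) \<le> len x + len y"
proof -
  assume x: "x \<in> carrier G" and y: "y \<in> carrier G"
  obtain xs where xs: "set xs \<subseteq> S" "wp xs = x" "length xs = len x" using obtain_reduced[OF x] .
  obtain ys where ys: "set ys \<subseteq> S" "wp ys = y" "length ys = len y" using obtain_reduced[OF y] .
  have "wp (xs @ ys) = x \<otimes> y" using xs ys gens_closed by (subst wp_append) auto
  then show ?thesis using len_le[of "xs @ ys"] xs ys by simp
qed

lemma len_inv [simp]: "x \<in> carrier G \<Longrightarrow> len (inv x) = len x"
proof -
  have "len (inv x) \<le> len x" if "x \<in> carrier G" for x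
    using that by (metis obtain_reduced wp_rev len_le length_rev set_rev)
  then show "x \<in> carrier G \<Longrightarrow> len (inv x) = len x" by (metis inv_closed inv_inv le_antisym)
qed

lemma len_one [simp]: "len \<one> = 0"
  using len_le[of "[]"] by simp

lemma len_zero: "x \<in> carrier G \<Longrightarrow> len x = 0 \<Longrightarrow> x = \<one>"
  by (metis obtain_reduced length_0_conv wp_Nil)

lemma len_gen [simp]: "s \<in> S \<Longrightarrow> len s = 1"
  using len_le[of "[s]"] len_zero[of s] gen_not_one[of s] by (cases "len s") auto

lemma len_one_gen: "x \<in> carrier G \<Longrightarrow> len x = 1 \<Longrightarrow> x \<in> S"
proof -
  assume "x \<in> carrier G" "len x = 1"
  then obtain ws where "set ws \<subseteq> S" "wp ws = x" "length ws = 1" using obtain_reduced by metis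
  then show "x \<in> S" by (cases ws) auto
qed

text \<open>Relators have even length, so the parity of a word depends only on its product; this is
  what keeps \<open>len (s \<otimes> x)\<close> from equalling \<open>len x\<close>.\<close>

lemma cox_step_parity: "cox_step G S us vs \<Longrightarrow> even (length us) = even (length vs)"
  by (induction rule: cox_step.induct) (auto simp: length_concat sum_list_replicate)

lemma equivclp_invariant:
  assumes "equivclp R us vs" "\<And>us vs. R us vs \<Longrightarrow> f us = f vs"
  shows "f us = f vs"
  using assms(1) by (induction rule: equivclp_induct) (auto dest: assms(2))

lemma word_parity: "set us \<subseteq> S \<Longrightarrow> set vs \<subseteq> S \<Longrightarrow> wp us = wp vs \<Longrightarrow>
   even (length us) = even (length vs)"
  using equivclp_invariant[OF presentation, of us vs "\<lambda>ws. even (length ws)"] cox_step_parity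
  by (auto simp: lists_eq_set)

lemma len_parity: "x \<in> carrier G \<Longrightarrow> y \<in> carrier G \<Longrightarrow> even (len (x \<otimes> y)) = even (len x + len y)"
proof -
  assume x: "x \<in> carrier G" and y: "y \<in> carrier G"
  obtain xs where xs: "set xs \<subseteq> S" "wp xs = x" "length xs = len x" using obtain_reduced[OF x] .
  obtain ys where ys: "set ys \<subseteq> S" "wp ys = y" "length ys = len y" using obtain_reduced[OF y] .
  obtain zs where zs: "set zs \<subseteq> S" "wp zs = x \<otimes> y" "length zs = len (x \<otimes> y)"
    using obtain_reduced[of "x \<otimes> y"] x y by auto
  have "wp (xs @ ys) = wp zs" using xs ys zs gens_closed by (subst wp_append) auto
  then have "even (length (xs @ ys)) = even (length zs)" using xs ys zs by (intro word_parity) auto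
  then show ?thesis using xs ys zs by simp
qed

lemma len_left_cases: "s \<in> S \<Longrightarrow> x \<in> carrier G \<Longrightarrow>
   len (s \<otimes> x) = len x + 1 \<or> len x = len (s \<otimes> x) + 1"
proof -
  assume s: "s \<in> S" and x: "x \<in> carrier G"
  have "len x \<le> 1 + len (s \<otimes> x)" using len_mult[of s "s \<otimes> x"] s x gen_cancel[OF s x] by simp
  moreover have "len (s \<otimes> x) \<le> 1 + len x" using len_mult[of s x] s x by simp
  moreover have "len (s \<otimes> x) \<noteq> len x" using len_parity[of s x] s x by auto
  ultimately show ?thesis by linarith
qed

lemma len_right_cases: "s \<in> S \<Longrightarrow> x \<in> carrier G \<Longrightarrow>
   len (x \<otimes> s) = len x + 1 \<or> len x = len (x \<otimes> s) + 1"
  using len_left_cases[of s "inv x"] len_inv[of "x \<otimes> s"] by (simp add: inv_mult_group)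

text \<open>\<open>rc ws t\<close> counts the positions of the word \<open>ws\<close> whose associated reflection
  \<open>s\<^sub>1\<cdots>s\<^sub>i\<^sub>-\<^sub>1 s\<^sub>i s\<^sub>i\<^sub>-\<^sub>1\<cdots>s\<^sub>1\<close> is \<open>t\<close>. Its parity depends only on the product of the word.\<close>

primrec rc :: "'a list \<Rightarrow> 'a \<Rightarrow> nat" where
  "rc [] t = 0"
| "rc (s # ws) t = of_bool (t = s) + rc ws (s \<otimes> t \<otimes> s)"

lemma rc_append: "set xs \<subseteq> S \<Longrightarrow> set ys \<subseteq> S \<Longrightarrow> t \<in> carrier G \<Longrightarrow>
   rc (xs @ ys) t = rc xs t + rc ys (inv (wp xs) \<otimes> t \<otimes> wp xs)"
  by (induction xs arbitrary: t) (auto simp: m_assoc inv_mult_group)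

text \<open>The reflections met along the word \<open>a b a b ...\<close> are the elements
  \<open>c^j a\<close> with \<open>c = a b\<close>. Dropping the first two letters conjugates
  \<open>t\<close> by \<open>c\<close>, and since conjugation by \<open>a\<close> inverts
  \<open>c\<close>, the index \<open>j\<close> moves by two.\<close>

lemma rc_dihedral:
  assumes a: "a \<in> S" and b: "b \<in> S" and t: "t \<in> carrier G"
  shows "rc (concat (replicate k [a, b])) t = (\<Sum>j<2*k. of_bool (t = (a \<otimes> b) [^] j \<otimes> a))"
  using t
proof (induction k arbitrary: t)
  case (Suc k)
  define c where "c = a \<otimes> b"
  have c: "c \<in> carrier G" using a b by (simp add: c_def)
  have ic: "inv c = b \<otimes> a" 
    unfolding c_def by (rule inv_equality) (use a b in \<open>auto simp: m_assoc gen_sq gen_cancel\<close>)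
  have aca: "a \<otimes> inv c = c \<otimes> a" using a b unfolding ic by (simp add: c_def m_assoc)
  have t: "t \<in> carrier G" by fact
  have ab: "a \<in> carrier G" "b \<in> carrier G" using a b by auto
  have move: "inv c \<otimes> t \<otimes> c = x \<longleftrightarrow> t = c \<otimes> x \<otimes> inv c" if x: "x \<in> carrier G" for x
  proof -
    have "c \<otimes> (inv c \<otimes> t \<otimes> c) \<otimes> inv c = t" using c t by (simp add: m_assoc inv_cancel)
    moreover have "inv c \<otimes> (c \<otimes> x \<otimes> inv c) \<otimes> c = x" using c x by (simp add: m_assoc inv_cancel)
    ultimately show ?thesis by metis
  qed
  have shift: "inv c \<otimes> t \<otimes> c = c [^] j \<otimes> a \<longleftrightarrow> t = c [^] (Suc (Suc j)) \<otimes> a" for j :: nat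
  proof -
    have "c \<otimes> (c [^] j \<otimes> a) \<otimes> inv c = c \<otimes> c [^] j \<otimes> (a \<otimes> inv c)" using c ab by (simp add: m_assoc)
    also have "\<dots> = c \<otimes> c [^] j \<otimes> c \<otimes> a" using c ab aca by (simp add: m_assoc)
    also have "\<dots> = c [^] (Suc (Suc j)) \<otimes> a"
      using c by (metis nat_pow_Suc nat_pow_Suc2)
    finally show ?thesis using move[of "c [^] j \<otimes> a"] c ab by simp
  qed
  have one: "a \<otimes> t \<otimes> a = b \<longleftrightarrow> t = c \<otimes> a"
  proof -
    have "a \<otimes> (a \<otimes> t \<otimes> a) \<otimes> a = t" using a t by (simp add: m_assoc gen_sq gen_cancel)
    moreover have "a \<otimes> (c \<otimes> a) \<otimes> a = b" using a b by (simp add: c_def m_assoc gen_sq gen_cancel)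
    ultimately show ?thesis using ab c_def by (metis m_assoc)
  qed
  have "rc (concat (replicate (Suc k) [a, b])) t
      = of_bool (t = a) + (of_bool (a \<otimes> t \<otimes> a = b) + rc (concat (replicate k [a, b])) (inv c \<otimes> t \<otimes> c))"
    using ab t unfolding ic by (simp add: c_def m_assoc)
  also have "rc (concat (replicate k [a, b])) (inv c \<otimes> t \<otimes> c)
     = (\<Sum>j<2*k. of_bool (inv c \<otimes> t \<otimes> c = c [^] j \<otimes> a))"
    using Suc.IH[of "inv c \<otimes> t \<otimes> c"] c t by (simp add: c_def)
  also have "\<dots> = (\<Sum>j<2*k. of_bool (t = c [^] (Suc (Suc j)) \<otimes> a))" by (simp only: shift)
  also have "of_bool (t = a) + (of_bool (a \<otimes> t \<otimes> a = b) + \<dots>)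
      = (\<Sum>j<2 * Suc k. of_bool (t = c [^] j \<otimes> a))"
    using ab c by (simp add: sum.lessThan_Suc_shift one del: nat_pow_Suc sum.lessThan_Suc)
  finally show ?case by (simp add: c_def)
qed simp

text \<open>With \<open>m = ord (a \<otimes> b)\<close>, the \<open>2 m\<close> reflections of the
  relator run twice through the same list of length \<open>m\<close>. For infinite order
  \<open>m\<close> is 0 and the relator is empty.\<close>

lemma rc_relator_even:
  assumes a: "a \<in> S" and b: "b \<in> S" and t: "t \<in> carrier G"
  shows "even (rc (concat (replicate (ord (a \<otimes> b)) [a, b])) t)"
proof -
  define m where "m = ord (a \<otimes> b)"
  define f :: "nat \<Rightarrow> nat" where "f = (\<lambda>j. of_bool (t = (a \<otimes> b) [^] j \<otimes> a))"
  have ab: "a \<otimes> b \<in> carrier G" using a b by simp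
  have per: "f (j + m) = f j" for j
    using pow_ord_eq_1[OF ab] ab by (simp add: f_def m_def flip: nat_pow_mult)
  have "(\<Sum>j<2*m. f j) = (\<Sum>j<m. f j) + (\<Sum>j\<in>{m..<2*m}. f j)"
    by (metis atLeast0LessThan le_add2 mult_2 sum.atLeastLessThan_concat zero_le)
  also have "(\<Sum>j\<in>{m..<2*m}. f j) = (\<Sum>j<m. f (j + m))"
    using sum.shift_bounds_nat_ivl[of f 0 m m] by (simp add: atLeast0LessThan mult_2)
  finally have "even (\<Sum>j<2*m. f j)" by (simp add: per)
  then show ?thesis using rc_dihedral[OF a b t] by (simp add: f_def m_def)
qed

lemma wp_relator:
  assumes a: "a \<in> S" and b: "b \<in> S"
  shows "wp (concat (replicate (ord (a \<otimes> b)) [a, b])) = \<one>"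
proof -
  have "wp (concat (replicate k [a, b])) = (a \<otimes> b) [^] k" for k :: nat
  proof (induction k)
    case (Suc k)
    then show ?case using a b nat_pow_Suc2[of "a \<otimes> b" k] by (simp add: m_assoc)
  qed simp
  then show ?thesis using a b by (simp add: pow_ord_eq_1)
qed

lemma cox_step_rc:
  assumes "cox_step G S us vs" "t \<in> carrier G"
  shows "even (rc us t) = even (rc vs t)"
  using assms(1)
proof cases
  case (1 a b xs ys)
  let ?r = "concat (replicate (ord (a \<otimes> b)) [a, b])"
  have r: "set ?r \<subseteq> S" using 1 by auto
  have xy: "set xs \<subseteq> S" "set ys \<subseteq> S" using 1 by auto
  have t': "inv (wp xs) \<otimes> t \<otimes> wp xs \<in> carrier G" using xy assms(2) by simp
  have "rc us t = rc xs t + (rc ?r (inv (wp xs) \<otimes> t \<otimes> wp xs) + rc ys (inv (wp xs) \<otimes> t \<otimes> wp xs))"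
    unfolding 1(1)
    using xy r assms(2) t' wp_relator[OF 1(3,4)] rc_append[of xs "?r @ ys"] rc_append[of ?r ys]
    by simp
  moreover have "even (rc ?r (inv (wp xs) \<otimes> t \<otimes> wp xs))" by (rule rc_relator_even) (use 1 t' in auto)
  ultimately show ?thesis unfolding 1(2) using xy assms(2) rc_append[of xs ys] by simp
qed

lemma rc_parity: "set us \<subseteq> S \<Longrightarrow> set vs \<subseteq> S \<Longrightarrow> wp us = wp vs \<Longrightarrow> t \<in> carrier G \<Longrightarrow>
   even (rc us t) = even (rc vs t)"
  using equivclp_invariant[OF presentation, of us vs "\<lambda>ws. even (rc ws t)"] cox_step_rc
  by (auto simp: lists_eq_set)

text \<open>If \<open>t = p r p^-1\<close> for a prefix \<open>p\<close> followed by the letter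
  \<open>r\<close>, left multiplication by \<open>t\<close> deletes that letter.\<close>

lemma rc_pos:
  assumes "rc ws t > 0" "set ws \<subseteq> S" "t \<in> carrier G"
  shows "\<exists>xs r ys. ws = xs @ r # ys \<and> t \<otimes> wp ws = wp (xs @ ys)"
  using assms
proof (induction ws arbitrary: t)
  case (Cons s ws)
  show ?case
  proof (cases "t = s")
    case True
    then show ?thesis using Cons.prems by (intro exI[of _ "[]"] exI) (auto simp: gen_cancel)
  next
    case False
    then have "rc ws (s \<otimes> t \<otimes> s) > 0" "set ws \<subseteq> S" "s \<otimes> t \<otimes> s \<in> carrier G" using Cons.prems by auto
    from Cons.IH[OF this] obtain xs r ys where
      *: "ws = xs @ r # ys" "s \<otimes> t \<otimes> s \<otimes> wp ws = wp (xs @ ys)" by blast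
    have "t \<otimes> wp (s # ws) = s \<otimes> (s \<otimes> t \<otimes> s \<otimes> wp ws)"
      using Cons.prems by (simp add: m_assoc gen_cancel)
    then show ?thesis using * by (intro exI[of _ "s # xs"] exI) auto
  qed
qed simp

text \<open>The reflection \<open>s\<close> cannot occur in a reduced word for \<open>s w\<close>,
  since deleting its letter would make \<open>w\<close> too short. Prepending \<open>s\<close> makes
  the count odd, and parity carries this over to the given word for \<open>w\<close>, which need not
  be reduced.\<close>

lemma exchange_word:
  assumes s: "s \<in> S" and ws: "set ws \<subseteq> S" and d: "len (s \<otimes> wp ws) < len (wp ws)"
  shows "\<exists>xs r ys. ws = xs @ r # ys \<and> s \<otimes> wp ws = wp (xs @ ys)"
proof -
  obtain vs where vs: "set vs \<subseteq> S" "wp vs = s \<otimes> wp ws" "length vs = len (s \<otimes> wp ws)"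
    using obtain_reduced[of "s \<otimes> wp ws"] s ws by auto
  have e: "wp (s # vs) = wp ws" using vs s ws by (simp add: gen_cancel)
  have "rc vs s = 0"
  proof (rule ccontr)
    assume "rc vs s \<noteq> 0"
    then obtain xs r ys where *: "vs = xs @ r # ys" "s \<otimes> wp vs = wp (xs @ ys)"
      using rc_pos[of vs s] vs s by auto
    then have "len (wp ws) \<le> length (xs @ ys)" using e len_le[of "xs @ ys"] vs by auto
    then show False using * vs d by simp
  qed
  then have "odd (rc (s # vs) s)" using s by (simp add: gen_sq)
  then have "odd (rc ws s)" using rc_parity[of "s # vs" ws s] e s vs ws by simp
  then show ?thesis using rc_pos[of ws s] ws s by (simp add: odd_pos)
qed

subsection \<open>Supports and descents\<close>

text \<open>Letters are only deleted, never replaced: whenever prepending a letter shortens,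
  exchange removes one letter of the part already reduced.\<close>

lemma reduce_word:
  "set vs \<subseteq> S \<Longrightarrow> \<exists>us. set us \<subseteq> set vs \<and> wp us = wp vs \<and> length us = len (wp vs)"
proof (induction vs)
  case (Cons s vs)
  then obtain us where us: "set us \<subseteq> set vs" "wp us = wp vs" "length us = len (wp vs)" by auto
  have s: "s \<in> S" and c: "wp vs \<in> carrier G" "set us \<subseteq> S" using Cons.prems us by auto
  show ?case
  proof (cases "len (s \<otimes> wp vs) < len (wp vs)")
    case False
    then have "len (s \<otimes> wp vs) = len (wp vs) + 1" using len_left_cases[OF s c(1)] by linarith
    then show ?thesis using us by (intro exI[of _ "s # us"]) auto
  next
    case True
    then obtain xs r ys where *: "us = xs @ r # ys" "s \<otimes> wp us = wp (xs @ ys)"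
      using exchange_word[of s us] s c us by auto
    have "length (xs @ ys) = len (s \<otimes> wp vs)"
      using * us True len_left_cases[OF s c(1)] by simp
    then show ?thesis using * us by (intro exI[of _ "xs @ ys"]) auto
  qed
qed simp

lemma reduced_suffix:
  assumes "set (xs @ ys) \<subseteq> S" "length (xs @ ys) = len (wp (xs @ ys))"
  shows "length ys = len (wp ys)" "length xs = len (wp xs)"
proof -
  have c: "set xs \<subseteq> carrier G" "set ys \<subseteq> carrier G" using assms(1) gens_closed by auto
  have "len (wp (xs @ ys)) \<le> len (wp xs) + len (wp ys)" using c by (simp add: wp_append len_mult)
  moreover have "len (wp xs) \<le> length xs" "len (wp ys) \<le> length ys" using assms(1) len_le by auto
  ultimately show "length ys = len (wp ys)" "length xs = len (wp xs)" using assms(2) by simp_all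
qed

lemma gen_in_W: "s \<in> S \<Longrightarrow> J \<subseteq> S \<Longrightarrow> s \<in> W J \<Longrightarrow> s \<in> J"
proof -
  assume s: "s \<in> S" and J: "J \<subseteq> S" and "s \<in> W J"
  then obtain vs where "set vs \<subseteq> J" "wp vs = s" using W_obtain_word by blast
  with reduce_word[of vs] J obtain us where us: "set us \<subseteq> J" "wp us = s" "length us = len s" by force
  then show "s \<in> J" using s J by (cases us) auto
qed

text \<open>Take some word in \<open>J\<close> for the same element. Exchange cancels the first
  letter \<open>s\<close> by deleting a letter of that word, so the remainder is again in
  \<open>W J\<close>; hence so is \<open>s\<close>, which puts \<open>s\<close> into
  \<open>J\<close>.\<close>

lemma reduced_word_in_W:
  "J \<subseteq> S \<Longrightarrow> set ws \<subseteq> S \<Longrightarrow> length ws = len (wp ws) \<Longrightarrow> wp ws \<in> W J \<Longrightarrow> set ws \<subseteq> J"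
proof (induction ws)
  case (Cons s ws)
  have s: "s \<in> S" and c: "wp ws \<in> carrier G" using Cons.prems by auto
  have r: "length ws = len (wp ws)" using reduced_suffix[of "[s]" ws] Cons.prems by simp
  obtain vs where "set vs \<subseteq> J" "wp vs = wp (s # ws)" using W_obtain_word Cons.prems by blast
  with reduce_word[of vs] Cons.prems(1) obtain us where
    us: "set us \<subseteq> J" "wp us = wp (s # ws)" by force
  have sw: "s \<otimes> wp us = wp ws" using us s c by (simp add: gen_cancel)
  then have "len (s \<otimes> wp us) < len (wp us)" using r us Cons.prems by simp
  then obtain xs q ys where *: "us = xs @ q # ys" "s \<otimes> wp us = wp (xs @ ys)"
    using exchange_word[OF s, of us] us Cons.prems(1) by (meson subset_trans)
  then have wJ: "wp ws \<in> W J" using sw us W_word[of "xs @ ys" J] by auto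
  have "s = wp us \<otimes> inv (wp ws)" using us s c by (simp add: m_assoc)
  moreover have "wp us \<in> W J" using us W_word by blast
  ultimately have "s \<in> W J" using W_inv[OF Cons.prems(1) wJ] W_mult by simp
  then have "s \<in> J" using gen_in_W s Cons.prems(1) by blast
  then show ?case using Cons.IH r wJ Cons.prems by simp
qed simp

text \<open>The support is defined from all reduced words but can be read from one, because every
  other reduced word must stay within the letters of the given one.\<close>

lemma sp_word: "set ws \<subseteq> S \<Longrightarrow> length ws = len (wp ws) \<Longrightarrow> sp (wp ws) = set ws"
proof -
  assume ws: "set ws \<subseteq> S" and l: "length ws = len (wp ws)"
  have "set vs \<subseteq> set ws" if "set vs \<subseteq> S" "wp vs = wp ws" "length vs = len (wp ws)" for vs
    using that ws W_word[of ws "set ws"] reduced_word_in_W[of "set ws" vs] by simp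
  then show "sp (wp ws) = set ws" using ws l unfolding supp_def reduced_word_def by (auto simp: lists_eq_set)
qed

lemma obtain_reduced':
  assumes "w \<in> carrier G"
  obtains ws where "set ws = sp w" "wp ws = w" "length ws = len w" "sp w \<subseteq> S"
proof -
  obtain ws where "set ws \<subseteq> S" "wp ws = w" "length ws = len w" using obtain_reduced[OF assms] .
  then show thesis using sp_word[of ws] that[of ws] by simp
qed

lemma sp_subset: "w \<in> carrier G \<Longrightarrow> sp w \<subseteq> S"
  by (rule obtain_reduced')

lemma sp_finite: "w \<in> carrier G \<Longrightarrow> finite (sp w)"
  using obtain_reduced'[of w] finite_set by metis

lemma W_iff: "J \<subseteq> S \<Longrightarrow> w \<in> carrier G \<Longrightarrow> w \<in> W J \<longleftrightarrow> sp w \<subseteq> J"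
proof -
  assume J: "J \<subseteq> S" and w: "w \<in> carrier G"
  obtain ws where ws: "set ws = sp w" "wp ws = w" "length ws = len w" "sp w \<subseteq> S"
    using obtain_reduced'[OF w] .
  show ?thesis using W_word[of ws J] reduced_word_in_W[OF J, of ws] ws by auto
qed

lemma W_sp: "w \<in> carrier G \<Longrightarrow> w \<in> W (sp w)"
  by (simp add: W_iff sp_subset)

lemma W_spD: "J \<subseteq> S \<Longrightarrow> w \<in> W J \<Longrightarrow> sp w \<subseteq> J"
  using W_iff W_closed by blast

lemma sp_one [simp]: "sp \<one> = {}"
  using sp_word[of "[]"] by simp

lemma sp_gen [simp]: "s \<in> S \<Longrightarrow> sp s = {s}"
  using sp_word[of "[s]"] by simp

lemma sp_mult: "x \<in> carrier G \<Longrightarrow> y \<in> carrier G \<Longrightarrow> sp (x \<otimes> y) \<subseteq> sp x \<union> sp y"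
  using W_iff[of "sp x \<union> sp y"] W_mult[of x "sp x \<union> sp y" y] sp_subset by simp

lemma sp_mult_eq: "x \<in> carrier G \<Longrightarrow> y \<in> carrier G \<Longrightarrow> len (x \<otimes> y) = len x + len y \<Longrightarrow>
   sp (x \<otimes> y) = sp x \<union> sp y"
proof -
  assume x: "x \<in> carrier G" and y: "y \<in> carrier G" and l: "len (x \<otimes> y) = len x + len y"
  obtain xs where xs: "set xs = sp x" "wp xs = x" "length xs = len x" "sp x \<subseteq> S" using obtain_reduced'[OF x] .
  obtain ys where ys: "set ys = sp y" "wp ys = y" "length ys = len y" "sp y \<subseteq> S" using obtain_reduced'[OF y] .
  have "wp (xs @ ys) = x \<otimes> y" using xs ys gens_closed by (subst wp_append) auto
  then show ?thesis using sp_word[of "xs @ ys"] xs ys l by simp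
qed

lemma sp_inv [simp]: "x \<in> carrier G \<Longrightarrow> sp (inv x) = sp x"
proof -
  have "sp (inv x) \<subseteq> sp x" if "x \<in> carrier G" for x
    using that W_iff[of "sp x" "inv x"] W_inv[of "sp x" x] W_sp sp_subset by simp
  then show "x \<in> carrier G \<Longrightarrow> sp (inv x) = sp x" by (metis inv_closed inv_inv subset_antisym)
qed

section \<open>Descents, and exchange for products\<close>

lemma DL_iff: "s \<in> DL w \<longleftrightarrow> s \<in> S \<and> len (s \<otimes> w) < len w"
  by (simp add: left_descents_def)

lemma DR_iff: "s \<in> DR w \<longleftrightarrow> s \<in> S \<and> len (w \<otimes> s) < len w"
  by (simp add: right_descents_def)

lemma DL_inv: "w \<in> carrier G \<Longrightarrow> DL (inv w) = DR w"
proof -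
  assume w: "w \<in> carrier G"
  have "len (s \<otimes> inv w) = len (w \<otimes> s)" if "s \<in> S" for s
    using that w len_inv[of "w \<otimes> s"] by (simp add: inv_mult_group)
  then show ?thesis using w by (auto simp: left_descents_def right_descents_def)
qed

lemma DR_inv: "w \<in> carrier G \<Longrightarrow> DR (inv w) = DL w"
  by (metis DL_inv inv_closed inv_inv)

lemma DL_len: "s \<in> S \<Longrightarrow> w \<in> carrier G \<Longrightarrow> s \<notin> DL w \<Longrightarrow> len (s \<otimes> w) = len w + 1"
  using len_left_cases DL_iff by fastforce

lemma DR_len: "s \<in> S \<Longrightarrow> w \<in> carrier G \<Longrightarrow> s \<notin> DR w \<Longrightarrow> len (w \<otimes> s) = len w + 1"
  using len_right_cases DR_iff by fastforce

lemma DL_len': "w \<in> carrier G \<Longrightarrow> s \<in> DL w \<Longrightarrow> len w = len (s \<otimes> w) + 1"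
  using len_left_cases DL_iff by fastforce

lemma DR_len': "w \<in> carrier G \<Longrightarrow> s \<in> DR w \<Longrightarrow> len w = len (w \<otimes> s) + 1"
  using len_right_cases DR_iff by fastforce

lemma DL_sp: "w \<in> carrier G \<Longrightarrow> DL w \<subseteq> sp w"
proof
  fix s assume w: "w \<in> carrier G" and s: "s \<in> DL w"
  have sS: "s \<in> S" using s DL_iff by blast
  have "w = s \<otimes> (s \<otimes> w)" using w sS by (simp add: gen_cancel)
  moreover have "sp (s \<otimes> (s \<otimes> w)) = sp s \<union> sp (s \<otimes> w)"
    by (rule sp_mult_eq) (use w sS DL_len'[OF w s] in \<open>auto simp: gen_cancel\<close>)
  ultimately show "s \<in> sp w" using sS by auto
qed

lemma DR_sp: "w \<in> carrier G \<Longrightarrow> DR w \<subseteq> sp w"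
  using DL_sp[of "inv w"] DL_inv[of w] by simp

text \<open>The letter deleted by exchange must lie in \<open>y\<close>: a deletion inside the word
  for \<open>x\<close> would, after cancelling \<open>y\<close>, shorten
  \<open>s \<otimes> x\<close>.\<close>

lemma exchange_left:
  assumes s: "s \<in> S" and x: "x \<in> carrier G" and y: "y \<in> carrier G" and d: "s \<in> DL (x \<otimes> y)"
    and sx: "s \<notin> DL x"
  obtains y' where "y' \<in> W (sp y)" "s \<otimes> (x \<otimes> y) = x \<otimes> y'" "len y' < len y"
proof -
  obtain xs where xs: "set xs = sp x" "wp xs = x" "length xs = len x" "sp x \<subseteq> S" using obtain_reduced'[OF x] .
  obtain ys where ys: "set ys = sp y" "wp ys = y" "length ys = len y" "sp y \<subseteq> S" using obtain_reduced'[OF y] .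
  have xy: "wp (xs @ ys) = x \<otimes> y" using xs ys gens_closed by (subst wp_append) auto
  obtain as r bs where *: "xs @ ys = as @ r # bs" "s \<otimes> (x \<otimes> y) = wp (as @ bs)"
    using exchange_word[of s "xs @ ys"] s d xs ys xy by (auto simp: DL_iff)
  have "\<exists>cs. as = xs @ cs"
  proof (rule ccontr)
    assume n: "\<nexists>cs. as = xs @ cs"
    from *(1) obtain cs where "xs = as @ cs \<and> cs @ ys = r # bs \<or> xs @ cs = as \<and> ys = cs @ r # bs"
      unfolding append_eq_append_conv2 by blast
    with n have cs: "xs = as @ cs" "cs @ ys = r # bs" by blast+
    with n obtain ds where ds: "cs = r # ds" "bs = ds @ ys" by (cases cs) auto
    have c: "set as \<subseteq> S" "set ds \<subseteq> S" using cs ds xs by auto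
    have cc: "set (as @ ds) \<subseteq> carrier G" "set ys \<subseteq> carrier G"
      using c ys(1,4) gens_closed by auto
    have "wp (as @ bs) = wp (as @ ds) \<otimes> y"
      using ds ys wp_append[OF cc] by simp
    then have "s \<otimes> x \<otimes> y = wp (as @ ds) \<otimes> y" using * s x y by (simp add: m_assoc)
    then have "s \<otimes> x = wp (as @ ds)" using s x y c right_cancel[of y "s \<otimes> x" "wp (as @ ds)"] by simp
    then have "len (s \<otimes> x) \<le> length (as @ ds)" using len_le[of "as @ ds"] c by simp
    then show False using sx xs cs ds s by (simp add: DL_iff)
  qed
  then obtain cs where cs: "as = xs @ cs" by blast
  then have yy: "ys = cs @ r # bs" using * by simp
  show thesis
  proof (rule that)
    have "set (cs @ bs) \<subseteq> S" using yy ys(1,4) by auto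
    then show "len (wp (cs @ bs)) < len y" using len_le[of "cs @ bs"] yy ys(3) by simp
    show "wp (cs @ bs) \<in> W (sp y)" using yy ys by (intro W_word) auto
    show "s \<otimes> (x \<otimes> y) = x \<otimes> wp (cs @ bs)"
    proof -
      have "set xs \<subseteq> carrier G" "set (cs @ bs) \<subseteq> carrier G" using yy xs(1,4) ys(1,4) gens_closed by auto
      then show ?thesis using wp_append[of xs "cs @ bs"] * cs xs by simp
    qed
  qed
qed

lemma exchange_right:
  assumes s: "s \<in> S" and x: "x \<in> carrier G" and y: "y \<in> carrier G" and d: "s \<in> DR (x \<otimes> y)"
    and sy: "s \<notin> DR y"
  obtains x' where "x' \<in> W (sp x)" "x \<otimes> y \<otimes> s = x' \<otimes> y" "len x' < len x"
proof -
  have "s \<in> DL (inv y \<otimes> inv x)" "s \<notin> DL (inv y)"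
    using d sy x y DL_inv[of "x \<otimes> y"] DL_inv[of y] by (simp_all add: inv_mult_group)
  then obtain z where z: "z \<in> W (sp (inv x))" "s \<otimes> (inv y \<otimes> inv x) = inv y \<otimes> z" "len z < len (inv x)"
    using exchange_left[of s "inv y" "inv x"] s x y by auto
  have zc: "z \<in> carrier G" using z x sp_subset by auto
  have "x \<otimes> y \<otimes> s = inv (s \<otimes> (inv y \<otimes> inv x))" using s x y by (simp add: inv_mult_group)
  also have "\<dots> = inv z \<otimes> y" using z zc y by (simp add: inv_mult_group)
  finally show thesis using that[of "inv z"] z zc x W_inv[of "sp x" z] sp_subset by simp
qed

lemma DL_prefix:
  assumes "x \<in> carrier G" "y \<in> carrier G" "len (x \<otimes> y) = len x + len y" "t \<in> DL x"
  shows "t \<in> DL (x \<otimes> y)"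
proof -
  have t: "t \<in> S" "len (t \<otimes> x) < len x" using assms(4) by (auto simp: DL_iff)
  have "len (t \<otimes> (x \<otimes> y)) \<le> len (t \<otimes> x) + len y"
    using len_mult[of "t \<otimes> x" y] assms(1,2) t by (simp add: m_assoc)
  then show ?thesis using t assms(3) by (simp add: DL_iff)
qed

lemma DR_suffix:
  assumes "x \<in> carrier G" "y \<in> carrier G" "len (x \<otimes> y) = len x + len y" "t \<in> DR y"
  shows "t \<in> DR (x \<otimes> y)"
proof -
  have t: "t \<in> S" "len (y \<otimes> t) < len y" using assms(4) by (auto simp: DR_iff)
  have "len (x \<otimes> y \<otimes> t) \<le> len x + len (y \<otimes> t)"
    using len_mult[of x "y \<otimes> t"] assms(1,2) t by (simp add: m_assoc)
  then show ?thesis using t assms(3) by (simp add: DR_iff)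
qed

subsection \<open>Minimal coset representatives\<close>

abbreviation MR where "MR J \<equiv> min_coset_reps G S J"

text \<open>Minimal representatives of the cosets \<open>W J y\<close>, encoded through inverses so
  that every fact about \<open>MR\<close> transfers to the other side.\<close>

definition LM where "LM J = {y \<in> carrier G. inv y \<in> MR J}"

lemma MR_carrier [simp]: "v \<in> MR J \<Longrightarrow> v \<in> carrier G"
  unfolding min_coset_reps_def by blast

lemma LM_carrier [simp]: "v \<in> LM J \<Longrightarrow> v \<in> carrier G"
  unfolding LM_def by blast

lemma inv_MR [simp]: "y \<in> carrier G \<Longrightarrow> inv y \<in> MR J \<longleftrightarrow> y \<in> LM J"
  using LM_carrier unfolding LM_def by blast

lemma inv_LM [simp]: "y \<in> carrier G \<Longrightarrow> inv y \<in> LM J \<longleftrightarrow> y \<in> MR J"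
  using inv_MR[of "inv y" J] by simp

lemma MR_min: "v \<in> MR J \<Longrightarrow> u \<in> W J \<Longrightarrow> len v \<le> len (v \<otimes> u)"
  unfolding min_coset_reps_def l_coset_def by blast

text \<open>Suppose that appending the next letter \<open>s\<close> of a reduced word for
  \<open>u\<close> loses length. Exchange then replaces \<open>v\<close> by a shorter
  \<open>x\<close>, and \<open>x = v h\<close> for a conjugate \<open>h\<close> of \<open>s\<close>
  in \<open>W J\<close>, against the minimality of \<open>v\<close>.\<close>

lemma MR_len:
  assumes J: "J \<subseteq> S" and v: "v \<in> MR J" and u: "u \<in> W J"
  shows "len (v \<otimes> u) = len v + len u"
proof -
  have vc: "v \<in> carrier G" using v by simp
  have "set us \<subseteq> J \<Longrightarrow> length us = len (wp us) \<Longrightarrow> len (v \<otimes> wp us) = len v + length us" for us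
  proof (induction us rule: rev_induct)
    case (snoc s us)
    have s: "s \<in> S" "s \<in> J" and us: "set us \<subseteq> S" using snoc.prems J by auto
    have r: "length us = len (wp us)"
      by (rule reduced_suffix(2)[of us "[s]"]) (use snoc.prems s us in \<open>simp_all\<close>)
    have IH: "len (v \<otimes> wp us) = len v + length us" using snoc r by auto
    have e: "wp (us @ [s]) = wp us \<otimes> s" using s us gens_closed by (subst wp_append) auto
    have nd: "s \<notin> DR (wp us)" using snoc.prems r e by (simp add: DR_iff)
    have "s \<notin> DR (v \<otimes> wp us)"
    proof
      assume "s \<in> DR (v \<otimes> wp us)"
      from exchange_right[OF s(1) vc _ this nd] us
      obtain x where x: "x \<in> W (sp v)" "v \<otimes> wp us \<otimes> s = x \<otimes> wp us" "len x < len v" by auto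
      have xc: "x \<in> carrier G" using x vc sp_subset by auto
      define h where "h = wp us \<otimes> s \<otimes> inv (wp us)"
      have hW: "h \<in> W J" unfolding h_def using snoc.prems s J
        by (auto intro!: W_mult W_inv W_word intro: W_gen)
      have "x = x \<otimes> wp us \<otimes> inv (wp us)" using xc us by (simp add: m_assoc)
      also have "\<dots> = v \<otimes> h" using x(2) vc s us by (simp flip: x(2) add: h_def m_assoc)
      finally have "len v \<le> len x" using MR_min[OF v hW] by simp
      then show False using x by simp
    qed
    then show ?case using DR_len[OF s(1), of "v \<otimes> wp us"] IH vc us s by (simp add: e m_assoc)
  qed (use vc in simp)
  moreover obtain us where "set us = sp u" "wp us = u" "length us = len u" "sp u \<subseteq> S"
    using obtain_reduced'[OF W_closed[OF u J]] .
  moreover have "sp u \<subseteq> J" using u J W_spD by blast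
  ultimately show ?thesis by metis
qed

lemma MR_decomp:
  assumes J: "J \<subseteq> S" and w: "w \<in> carrier G"
  obtains v u where "v \<in> MR J" "u \<in> W J" "w = v \<otimes> u"
proof -
  obtain h where h: "h \<in> W J" "\<And>k. k \<in> W J \<Longrightarrow> len (w \<otimes> h) \<le> len (w \<otimes> k)"
    using ex_has_least_nat[of "\<lambda>h. h \<in> W J" "\<one>" "\<lambda>h. len (w \<otimes> h)"] W_one by blast
  have hc: "h \<in> carrier G" using h J by simp
  have "w \<otimes> h \<in> MR J"
    unfolding min_coset_reps_def l_coset_def using h(2)[OF W_mult[OF h(1)]] w hc J
    by (auto simp: m_assoc)
  moreover have "w = w \<otimes> h \<otimes> inv h" using w hc by (simp add: m_assoc)
  ultimately show thesis using that W_inv[OF J h(1)] by blast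
qed

text \<open>Each of \<open>v\<close> and \<open>v'\<close> is the other times an element of
  \<open>W J\<close>; additivity of length in both directions forces that element to be the
  identity.\<close>

lemma MR_unique:
  assumes J: "J \<subseteq> S" and v: "v \<in> MR J" "v' \<in> MR J" and u: "u \<in> W J" "u' \<in> W J"
    and e: "v \<otimes> u = v' \<otimes> u'"
  shows "v = v'" "u = u'"
proof -
  have c: "v \<in> carrier G" "v' \<in> carrier G" "u \<in> carrier G" "u' \<in> carrier G" using v u J by auto
  define x where "x = u' \<otimes> inv u"
  have xW: "x \<in> W J" "inv x \<in> W J" unfolding x_def using u J by (auto intro!: W_mult W_inv)
  have xc: "x \<in> carrier G" using c by (simp add: x_def)
  have vx: "v = v' \<otimes> x"
  proof -
    have "v = v \<otimes> u \<otimes> inv u" using c by (simp add: m_assoc)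
    then show ?thesis using c unfolding e by (simp add: x_def m_assoc)
  qed
  then have "v' = v \<otimes> inv x" using c xc by (simp add: m_assoc)
  then have "len v' = len v + len x" using MR_len[OF J v(1) xW(2)] xc by simp
  moreover have "len v = len v' + len x" using vx MR_len[OF J v(2) xW(1)] by simp
  ultimately have "x = \<one>" using len_zero xc by simp
  then show "v = v'" using vx c by simp
  then show "u = u'" using e c by simp
qed

lemma MR_iff: "J \<subseteq> S \<Longrightarrow> v \<in> MR J \<longleftrightarrow> v \<in> carrier G \<and> DR v \<inter> J = {}"
proof
  assume J: "J \<subseteq> S" and v: "v \<in> MR J"
  have "s \<notin> DR v" if "s \<in> J" for s
    using MR_min[OF v W_gen[OF that]] by (simp add: DR_iff)
  then show "v \<in> carrier G \<and> DR v \<inter> J = {}" using v by auto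
next
  assume J: "J \<subseteq> S" and "v \<in> carrier G \<and> DR v \<inter> J = {}"
  then have v: "v \<in> carrier G" "DR v \<inter> J = {}" by auto
  obtain x u where xu: "x \<in> MR J" "u \<in> W J" "v = x \<otimes> u" using MR_decomp[OF J v(1)] .
  have uc: "u \<in> carrier G" using xu J by simp
  have "u = \<one>"
  proof (rule ccontr)
    assume "u \<noteq> \<one>"
    then obtain us s where us: "set (us @ [s]) = sp u" "wp (us @ [s]) = u" "length (us @ [s]) = len u"
      using obtain_reduced'[OF uc] by (metis rev_exhaust wp_Nil)
    have sJ: "sp u \<subseteq> J" using W_spD[OF J xu(2)] .
    then have s: "s \<in> J" "s \<in> S" "set us \<subseteq> S" using us J by auto
    have "u = wp us \<otimes> s" using us s gens_closed wp_append[of us "[s]"] by auto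
    then have us': "u \<otimes> s = wp us" using s by (simp add: gen_cancel_right)
    then have "len (u \<otimes> s) < len u" using len_le[of us] us s by auto
    moreover have "len (v \<otimes> s) = len x + len (u \<otimes> s)"
      using xu s uc MR_len[OF J xu(1), of "u \<otimes> s"] W_mult[OF xu(2) W_gen[OF s(1)]]
      by (simp add: m_assoc)
    ultimately have "s \<in> DR v" using s xu MR_len[OF J xu(1,2)] by (simp add: DR_iff)
    then show False using v s by blast
  qed
  then show "v \<in> MR J" using xu v by simp
qed

lemma obtain_DR:
  assumes "w \<in> carrier G" "w \<noteq> \<one>"
  obtains s where "s \<in> DR w"
proof -
  have "w \<notin> MR S" if "DR w = {}"
  proof
    assume "w \<in> MR S"
    then have "len w \<le> len (w \<otimes> inv w)" using MR_min[of w S "inv w"] assms W_full by simp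
    then show False using assms len_zero[of w] by simp
  qed
  then show thesis using that MR_iff[of S w] assms by blast
qed

lemma obtain_last:
  assumes w: "w \<in> carrier G" and l: "Suc n = len w"
  obtains v q where "v \<in> carrier G" "q \<in> S" "w = v \<otimes> q" "len v = n" "sp w = sp v \<union> {q}"
proof -
  have "w \<noteq> \<one>" using l by auto
  then obtain q where q: "q \<in> DR w" using obtain_DR[OF w] by blast
  then have qS: "q \<in> S" by (simp add: DR_iff)
  have n: "len (w \<otimes> q) = n" using DR_len'[OF w q] l by simp
  have e: "w = w \<otimes> q \<otimes> q" using gen_cancel_right[OF qS w] by simp
  have "sp (w \<otimes> q \<otimes> q) = sp (w \<otimes> q) \<union> sp q" by (rule sp_mult_eq) (use w qS n l e in simp_all)
  then show thesis using that[of "w \<otimes> q" q] w qS n e by simp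
qed

lemma LM_iff: "J \<subseteq> S \<Longrightarrow> y \<in> LM J \<longleftrightarrow> y \<in> carrier G \<and> DL y \<inter> J = {}"
proof -
  assume J: "J \<subseteq> S"
  have "y \<in> LM J \<longleftrightarrow> inv y \<in> MR J" if "y \<in> carrier G" using that by simp
  then show ?thesis using MR_iff[OF J, of "inv y"] DR_inv[of y] LM_carrier[of y J] by auto
qed

lemma LM_len: "J \<subseteq> S \<Longrightarrow> y \<in> LM J \<Longrightarrow> u \<in> W J \<Longrightarrow> len (u \<otimes> y) = len u + len y"
  using MR_len[of J "inv y" "inv u"] W_inv[of J u] len_inv[of "u \<otimes> y"]
  by (simp add: inv_mult_group)

lemma LM_decomp:
  assumes J: "J \<subseteq> S" and w: "w \<in> carrier G"
  obtains u y where "u \<in> W J" "y \<in> LM J" "w = u \<otimes> y"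
proof -
  obtain v u where *: "v \<in> MR J" "u \<in> W J" "inv w = v \<otimes> u" using MR_decomp[OF J, of "inv w"] w by auto
  then have c: "v \<in> carrier G" "u \<in> carrier G" using J by auto
  have "w = inv (inv w)" using w by simp
  also have "\<dots> = inv u \<otimes> inv v" unfolding *(3) using c by (simp add: inv_mult_group)
  finally show thesis using that[of "inv u" "inv v"] * c J W_inv by auto
qed

lemma LM_unique:
  assumes J: "J \<subseteq> S" and y: "y \<in> LM J" "y' \<in> LM J" and u: "u \<in> W J" "u' \<in> W J"
    and e: "u \<otimes> y = u' \<otimes> y'"
  shows "u = u'" "y = y'"
proof -
  have c: "y \<in> carrier G" "y' \<in> carrier G" "u \<in> carrier G" "u' \<in> carrier G" using y u J by auto
  have "inv y \<otimes> inv u = inv y' \<otimes> inv u'" using e c by (simp flip: inv_mult_group)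
  from MR_unique[OF J _ _ W_inv[OF J u(1)] W_inv[OF J u(2)] this] y c
  have "inv y = inv y'" "inv u = inv u'" by auto
  then show "u = u'" "y = y'" using c by (metis inv_inv)+
qed

lemma LM_sp: "J \<subseteq> S \<Longrightarrow> y \<in> LM J \<Longrightarrow> u \<in> W J \<Longrightarrow> sp (u \<otimes> y) = sp u \<union> sp y"
  by (rule sp_mult_eq) (auto simp: LM_len)

lemma MR_sp: "J \<subseteq> S \<Longrightarrow> v \<in> MR J \<Longrightarrow> u \<in> W J \<Longrightarrow> sp (v \<otimes> u) = sp v \<union> sp u"
  by (rule sp_mult_eq) (auto simp: MR_len)

lemma LM_mono: "I \<subseteq> J \<Longrightarrow> J \<subseteq> S \<Longrightarrow> y \<in> LM J \<Longrightarrow> y \<in> LM I"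
  using LM_iff[of J y] LM_iff[of I y] by blast

lemma MR_mono: "I \<subseteq> J \<Longrightarrow> J \<subseteq> S \<Longrightarrow> y \<in> MR J \<Longrightarrow> y \<in> MR I"
  using MR_iff[of J y] MR_iff[of I y] by blast

text \<open>Right descents lie in the support, so only the part of \<open>J\<close> inside the
  support of \<open>v\<close> matters. This is how minimality is extended from an overlap of two
  sets to a whole set.\<close>

lemma MR_sp_iff: "J \<subseteq> S \<Longrightarrow> v \<in> carrier G \<Longrightarrow> sp v \<inter> J \<subseteq> I \<Longrightarrow> I \<subseteq> S \<Longrightarrow> v \<in> MR I \<Longrightarrow> v \<in> MR J"
  using MR_iff[of J v] MR_iff[of I v] DR_sp[of v] by blast

lemma LM_sp_iff: "J \<subseteq> S \<Longrightarrow> v \<in> carrier G \<Longrightarrow> sp v \<inter> J \<subseteq> I \<Longrightarrow> I \<subseteq> S \<Longrightarrow> v \<in> LM I \<Longrightarrow> v \<in> LM J"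
  using LM_iff[of J v] LM_iff[of I v] DL_sp[of v] by blast

subsection \<open>Longest elements\<close>

abbreviation wo where "wo J \<equiv> longest_elt G S J"
abbreviation sph where "sph J \<equiv> spherical G S J"

text \<open>A reduced word in \<open>J\<close> is built up from the right as a prefix of
  \<open>w\<close>: its next letter \<open>s\<close> is a left descent of \<open>w\<close> but not
  of the word so far, so exchange makes room for it by deleting a letter from the remaining factor
  \<open>y\<close>.\<close>

lemma DL_factor:
  assumes w: "w \<in> carrier G" and J: "J \<subseteq> DL w" and x: "x \<in> W J"
  obtains y where "y \<in> carrier G" "w = x \<otimes> y" "len w = len x + len y"
proof -
  have JS: "J \<subseteq> S" using J by (auto simp: DL_iff)
  have "set xs \<subseteq> J \<Longrightarrow> length xs = len (wp xs) \<Longrightarrow>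
     \<exists>y\<in>carrier G. w = wp xs \<otimes> y \<and> len w = length xs + len y" for xs
  proof (induction xs)
    case Nil
    then show ?case using w by auto
  next
    case (Cons s xs)
    have s: "s \<in> S" "s \<in> J" and xs: "set xs \<subseteq> S" using Cons.prems JS by auto
    have r: "length xs = len (wp xs)" using reduced_suffix[of "[s]" xs] Cons.prems s xs by simp
    obtain y where y: "y \<in> carrier G" "w = wp xs \<otimes> y" "len w = length xs + len y" using Cons r by auto
    have "s \<in> DL (wp xs \<otimes> y)" using J s y by auto
    moreover have "s \<notin> DL (wp xs)" using Cons.prems r by (simp add: DL_iff)
    ultimately obtain y' where y': "y' \<in> W (sp y)" "s \<otimes> (wp xs \<otimes> y) = wp xs \<otimes> y'" "len y' < len y"
      using exchange_left[of s "wp xs" y] s xs y by auto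
    have yc: "y' \<in> carrier G" using y' y(1) sp_subset by auto
    have e: "w = wp (s # xs) \<otimes> y'"
      using y y'(2) s xs yc gen_cancel[of s w] w by (simp add: m_assoc)
    then have "len w \<le> length (s # xs) + len y'"
      using len_mult[of "wp (s # xs)" y'] Cons.prems yc s xs by simp
    moreover have "length (s # xs) + len y' \<le> len w" using y y' by simp
    ultimately show ?case using e yc by auto
  qed
  moreover obtain xs where "set xs = sp x" "wp xs = x" "length xs = len x" "sp x \<subseteq> S"
    using obtain_reduced'[OF W_closed[OF x JS]] .
  moreover have "sp x \<subseteq> J" using x JS W_spD by blast
  ultimately show thesis using that by metis
qed

text \<open>Every element of \<open>W J\<close> is a prefix of \<open>w\<close>, which bounds its
  length, and \<open>J\<close> is finite as part of the support. Sphericity thus comes for free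
  wherever descents are known.\<close>

lemma DL_spherical:
  assumes w: "w \<in> carrier G" and J: "J \<subseteq> DL w"
  shows "sph J"
proof -
  have JS: "J \<subseteq> S" using J by (auto simp: DL_iff)
  have fJ: "finite J" using J DL_sp[OF w] sp_finite[OF w] by (meson finite_subset subset_trans)
  have "W J \<subseteq> wp ` {ws. set ws \<subseteq> J \<and> length ws \<le> len w}"
  proof
    fix x assume x: "x \<in> W J"
    obtain xs where "set xs = sp x" "wp xs = x" "length xs = len x" "sp x \<subseteq> S"
      using obtain_reduced'[OF W_closed[OF x JS]] .
    moreover have "sp x \<subseteq> J" using x JS W_spD by blast
    moreover obtain y where "len w = len x + len y" using DL_factor[OF w J x] by metis
    ultimately show "x \<in> wp ` {ws. set ws \<subseteq> J \<and> length ws \<le> len w}" by force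
  qed
  then show ?thesis unfolding spherical_def using JS finite_lists_length_le[OF fJ]
    by (meson finite_imageI finite_subset)
qed

lemma wo_props:
  assumes "sph J"
  shows wo_W: "wo J \<in> W J" and wo_max: "x \<in> W J \<Longrightarrow> len x \<le> len (wo J)"
    and wo_DL_sub: "J \<subseteq> DL (wo J)"
proof -
  have J: "J \<subseteq> S" and fin: "finite (W J)" using assms by (auto simp: spherical_def)
  have DLJ: "J \<subseteq> DL u" if u: "u \<in> W J" "\<forall>x\<in>W J. len x \<le> len u" for u
  proof
    fix s assume s: "s \<in> J"
    have "len (s \<otimes> u) \<le> len u" using u s W_mult[OF W_gen[OF s] u(1)] by simp
    then show "s \<in> DL u" using s J u len_left_cases[of s u] by (auto simp: DL_iff)
  qed
  obtain u where u: "u \<in> W J" "\<forall>x\<in>W J. len x \<le> len u"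
    using ex_has_greatest_nat[of "\<lambda>x. x \<in> W J" \<one> len "Suc (Max (len ` W J))"] W_one fin
    by (metis Max_ge finite_imageI imageI less_Suc_eq_le)
  have uniq: "u' = u" if u': "u' \<in> W J" "\<forall>x\<in>W J. len x \<le> len u'" for u'
  proof -
    obtain y where y: "y \<in> carrier G" "u = u' \<otimes> y" "len u = len u' + len y"
      using DL_factor[of u J u'] DLJ[OF u] u u' J by auto
    moreover have "len u \<le> len u'" using u u' by blast
    ultimately show "u' = u" using len_zero[of y] u' J by auto
  qed
  have "wo J \<in> W J \<and> (\<forall>x\<in>W J. len x \<le> len (wo J))"
    unfolding longest_elt_def by (rule theI[of _ u]) (use u uniq in blast)+
  then show "wo J \<in> W J" "x \<in> W J \<Longrightarrow> len x \<le> len (wo J)" "J \<subseteq> DL (wo J)" using DLJ by blast+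
qed

lemma sphD: "sph J \<Longrightarrow> J \<subseteq> S" by (simp add: spherical_def)

lemma sph_subset: "sph J \<Longrightarrow> I \<subseteq> J \<Longrightarrow> sph I"
  unfolding spherical_def by (meson finite_subset mono_generate subset_trans)

lemma wo_carrier [simp]: "sph J \<Longrightarrow> wo J \<in> carrier G"
  using wo_W sphD W_closed by blast

lemma wo_unique: "x \<in> W J \<Longrightarrow> J \<subseteq> DL x \<Longrightarrow> x = wo J"
proof -
  assume x: "x \<in> W J" and d: "J \<subseteq> DL x"
  have J: "J \<subseteq> S" using d by (auto simp: DL_iff)
  have s: "sph J" using DL_spherical[of x J] x d J by simp
  obtain y where y: "y \<in> carrier G" "x = wo J \<otimes> y" "len x = len (wo J) + len y"
    using DL_factor[of x J "wo J"] d x J wo_W[OF s] by auto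
  then show ?thesis using wo_max[OF s x] len_zero[of y] wo_carrier[OF s] by auto
qed

lemma wo_inv: "sph J \<Longrightarrow> inv (wo J) = wo J"
proof -
  assume s: "sph J"
  have J: "J \<subseteq> S" using sphD[OF s] .
  have i: "inv (wo J) \<in> W J" using W_inv[OF J wo_W[OF s]] .
  have "J \<subseteq> DL (inv (wo J))"
  proof
    fix t assume t: "t \<in> J"
    have "len (t \<otimes> inv (wo J)) \<le> len (inv (wo J))"
      using wo_max[OF s, of "t \<otimes> inv (wo J)"] W_mult[OF W_gen[OF t] i] s by simp
    then show "t \<in> DL (inv (wo J))" using len_left_cases[of t "inv (wo J)"] t J s by (auto simp: DL_iff)
  qed
  then show ?thesis using wo_unique i by blast
qed

lemma wo_sq: "sph J \<Longrightarrow> wo J \<otimes> wo J = \<one>"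
  by (metis wo_inv wo_carrier r_inv)

lemma wo_cancel: "sph J \<Longrightarrow> x \<in> carrier G \<Longrightarrow> wo J \<otimes> (wo J \<otimes> x) = x"
  by (simp add: wo_sq flip: m_assoc)

lemma wo_cancel_right: "sph J \<Longrightarrow> x \<in> carrier G \<Longrightarrow> x \<otimes> wo J \<otimes> wo J = x"
  by (simp add: wo_sq m_assoc)

lemma wo_DL: "sph J \<Longrightarrow> DL (wo J) = J"
  using wo_DL_sub[of J] DL_sp[of "wo J"] W_spD[of J "wo J"] wo_W[of J] sphD[of J] by auto

lemma wo_DR: "sph J \<Longrightarrow> DR (wo J) = J"
  by (metis DL_inv wo_DL wo_carrier wo_inv)

lemma wo_sp: "sph J \<Longrightarrow> sp (wo J) = J"
  using wo_DL[of J] DL_sp[of "wo J"] W_spD[of J "wo J"] wo_W[of J] sphD[of J] by auto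

lemma wo_empty [simp]: "wo {} = \<one>"
  using wo_unique[of \<one> "{}"] W_one by simp

text \<open>Since lengths add, the \<open>W J\<close> component of \<open>w\<close> inherits all of
  \<open>J\<close> as left descents, and the only such element of \<open>W J\<close> is
  \<open>wo J\<close>.\<close>

lemma DL_decomp:
  assumes w: "w \<in> carrier G" and J: "J \<subseteq> DL w"
  shows "wo J \<otimes> w \<in> LM J" "len w = len (wo J) + len (wo J \<otimes> w)"
proof -
  have JS: "J \<subseteq> S" using J by (auto simp: DL_iff)
  have s: "sph J" using DL_spherical[OF w J] .
  obtain u y where uy: "u \<in> W J" "y \<in> LM J" "w = u \<otimes> y" using LM_decomp[OF JS w] .
  have c: "u \<in> carrier G" "y \<in> carrier G" using uy JS by auto
  have "J \<subseteq> DL u"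
  proof
    fix t assume t: "t \<in> J"
    have "len (t \<otimes> (u \<otimes> y)) = len (t \<otimes> u) + len y"
      using LM_len[OF JS uy(2) W_mult[OF W_gen[OF t] uy(1)]] t JS c by (auto simp: m_assoc)
    moreover have "len (t \<otimes> (u \<otimes> y)) < len u + len y"
      using J t uy LM_len[OF JS uy(2,1)] by (auto simp: DL_iff)
    ultimately show "t \<in> DL u" using t JS by (auto simp: DL_iff)
  qed
  then have u: "u = wo J" using wo_unique uy by blast
  then have "wo J \<otimes> w = y" using uy c s by (simp add: wo_cancel)
  then show "wo J \<otimes> w \<in> LM J" "len w = len (wo J) + len (wo J \<otimes> w)"
    using uy u LM_len[OF JS uy(2,1)] by simp_all
qed

lemma DR_spherical: "w \<in> carrier G \<Longrightarrow> J \<subseteq> DR w \<Longrightarrow> sph J"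
  by (metis DL_inv DL_spherical inv_closed)

lemma DR_decomp:
  assumes w: "w \<in> carrier G" and J: "J \<subseteq> DR w"
  shows "w \<otimes> wo J \<in> MR J" "len w = len (w \<otimes> wo J) + len (wo J)"
proof -
  have s: "sph J" using DR_spherical[OF w J] .
  have i: "wo J \<otimes> inv w = inv (w \<otimes> wo J)" using w s by (simp add: inv_mult_group wo_inv)
  have d: "J \<subseteq> DL (inv w)" using J DL_inv w by simp
  show "w \<otimes> wo J \<in> MR J" using DL_decomp(1)[OF _ d] w s by (simp add: i)
  show "len w = len (w \<otimes> wo J) + len (wo J)" using DL_decomp(2)[OF _ d] w s by (simp add: i)
qed

lemma wo_unique_right: "x \<in> W J \<Longrightarrow> J \<subseteq> S \<Longrightarrow> J \<subseteq> DR x \<Longrightarrow> x = wo J"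
proof -
  assume x: "x \<in> W J" and J: "J \<subseteq> S" and d: "J \<subseteq> DR x"
  have s: "sph J" using DR_spherical[of x J] x d J by simp
  have "inv x = wo J" using wo_unique[of "inv x" J] W_inv[OF J x] x J d DL_inv[of x] by simp
  then show ?thesis using wo_inv[OF s] x J by (metis W_closed inv_inv)
qed

subsection \<open>Commutation and the Coxeter-Dynkin graph\<close>

abbreviation adj where "adj s t \<equiv> dynkin_adj G S s t"
abbreviation conn where "conn B \<equiv> dynkin_connected G S B"

text \<open>Generators commute exactly when the order of \<open>s \<otimes> t\<close> divides 2.
  Order 1 is the case \<open>s = t\<close>, and order 0 does not divide 2, in agreement with its
  reading as infinity.\<close>

lemma adj_iff: "adj s t \<longleftrightarrow> s \<in> S \<and> t \<in> S \<and> s \<otimes> t \<noteq> t \<otimes> s"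
proof (cases "s \<in> S \<and> t \<in> S")
  case True
  then have st: "s \<in> S" "t \<in> S" by auto
  let ?n = "ord (s \<otimes> t)"
  have c: "s \<otimes> t \<in> carrier G" using st by simp
  have "s \<otimes> t = t \<otimes> s \<longleftrightarrow> (s \<otimes> t) [^] (2::nat) = \<one>"
  proof
    assume e: "s \<otimes> t = t \<otimes> s"
    have "(s \<otimes> t) [^] (2::nat) = s \<otimes> t \<otimes> (t \<otimes> s)" using c e by (simp add: numeral_2_eq_2)
    then show "(s \<otimes> t) [^] (2::nat) = \<one>" using st by (simp add: m_assoc gen_cancel gen_sq)
  next
    assume "(s \<otimes> t) [^] (2::nat) = \<one>"
    then have "s \<otimes> t \<otimes> (s \<otimes> t) = \<one>" using c by (simp add: numeral_2_eq_2)
    then have "inv (s \<otimes> t) = s \<otimes> t" using c inv_equality by blast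
    then show "s \<otimes> t = t \<otimes> s" using st inv_mult_group[of s t] by simp
  qed
  also have "\<dots> \<longleftrightarrow> ?n dvd 2" using pow_eq_id[OF c] by simp
  also have "\<dots> \<longleftrightarrow> ?n = 1 \<or> ?n = 2" using dvd_imp_le[of ?n 2]
    by (metis One_nat_def dvd_refl le_SucE le_zero_eq numeral_2_eq_2 one_dvd dvd_0_left_iff zero_neq_numeral zero_less_numeral)
  finally show ?thesis using True unfolding dynkin_adj_def by auto
qed (auto simp: dynkin_adj_def)

lemma adj_sym: "adj s t \<Longrightarrow> adj t s"
  by (auto simp: adj_iff)

text \<open>Follow a path from \<open>x\<close> to \<open>y\<close> until it leaves
  \<open>X\<close>. Connectedness is mostly used in this form, as an edge across a cut.\<close>

lemma conn_step:
  assumes c: "conn B" and X: "x \<in> B" "x \<in> X" and y: "y \<in> B" "y \<notin> X"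
  obtains p q where "p \<in> B" "p \<in> X" "q \<in> B" "q \<notin> X" "adj p q"
proof -
  have "(\<lambda>x y. x \<in> B \<and> y \<in> B \<and> adj x y)\<^sup>*\<^sup>* x y" using c X y by (simp add: dynkin_connected_def)
  then have "y \<in> X \<or> (\<exists>p q. p \<in> B \<and> p \<in> X \<and> q \<in> B \<and> q \<notin> X \<and> adj p q)"
    by (induction rule: rtranclp_induct) (use X in blast)+
  then show thesis using that y by blast
qed

lemma connI:
  assumes "\<And>X x y. x \<in> B \<Longrightarrow> x \<in> X \<Longrightarrow> X \<subseteq> B \<Longrightarrow> y \<in> B \<Longrightarrow> y \<notin> X \<Longrightarrow>
     \<exists>p\<in>X. \<exists>q\<in>B - X. adj p q"
  shows "conn B"
  unfolding dynkin_connected_def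
proof (intro ballI, rule ccontr)
  fix s t assume s: "s \<in> B" and t: "t \<in> B"
  let ?R = "\<lambda>x y. x \<in> B \<and> y \<in> B \<and> adj x y"
  let ?X = "{x \<in> B. ?R\<^sup>*\<^sup>* s x}"
  assume "\<not> ?R\<^sup>*\<^sup>* s t"
  then obtain p q where "p \<in> ?X" "q \<in> B - ?X" "adj p q" using assms[of s ?X t] s t by blast
  then have sp: "?R\<^sup>*\<^sup>* s p" and pq: "?R p q" by blast+
  have "?R\<^sup>*\<^sup>* s q" using rtranclp.rtrancl_into_rtrancl[OF sp pq] .
  then show False using \<open>q \<in> B - ?X\<close> by simp
qed

lemma comm_W: "s \<in> S \<Longrightarrow> J \<subseteq> S \<Longrightarrow> u \<in> W J \<Longrightarrow> (\<And>t. t \<in> J \<Longrightarrow> \<not> adj s t) \<Longrightarrow> s \<otimes> u = u \<otimes> s"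
proof -
  assume s: "s \<in> S" and J: "J \<subseteq> S" and u: "u \<in> W J" and n: "\<And>t. t \<in> J \<Longrightarrow> \<not> adj s t"
  show ?thesis using u
  proof (induction rule: generate.induct)
    case (incl h)
    then show ?case using n s J by (auto simp: adj_iff)
  next
    case (inv h)
    then have "h \<in> S" using J by auto
    then show ?case using n[OF inv] s J by (auto simp: adj_iff)
  next
    case (eng x y)
    then have c: "x \<in> carrier G" "y \<in> carrier G" using J by auto
    have "s \<otimes> (x \<otimes> y) = x \<otimes> s \<otimes> y" using eng c s by (simp flip: m_assoc)
    also have "\<dots> = x \<otimes> y \<otimes> s" using eng c s by (simp add: m_assoc)
    finally show ?case .
  qed (use s in simp)
qed

lemma comm_WW: "I \<subseteq> S \<Longrightarrow> J \<subseteq> S \<Longrightarrow> x \<in> W I \<Longrightarrow> u \<in> W J \<Longrightarrow>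
   (\<And>s t. s \<in> I \<Longrightarrow> t \<in> J \<Longrightarrow> \<not> adj s t) \<Longrightarrow> x \<otimes> u = u \<otimes> x"
proof -
  assume I: "I \<subseteq> S" and J: "J \<subseteq> S" and x: "x \<in> W I" and u: "u \<in> W J"
    and n: "\<And>s t. s \<in> I \<Longrightarrow> t \<in> J \<Longrightarrow> \<not> adj s t"
  have uc: "u \<in> carrier G" using u J by simp
  have gen: "s \<otimes> u = u \<otimes> s" if "s \<in> I" for s using comm_W[of s J u] that I J u n by auto
  show ?thesis using x
  proof (induction rule: generate.induct)
    case (inv h)
    then have "h \<in> S" using I by auto
    then show ?case using gen[OF inv] by simp
  next
    case (eng x y)
    then have c: "x \<in> carrier G" "y \<in> carrier G" using I by auto
    have xu: "x \<otimes> u = u \<otimes> x" and yu: "y \<otimes> u = u \<otimes> y" using eng by auto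
    have "x \<otimes> y \<otimes> u = x \<otimes> u \<otimes> y" using yu c uc by (simp add: m_assoc)
    also have "\<dots> = u \<otimes> (x \<otimes> y)" unfolding xu using c uc by (simp add: m_assoc)
    finally show ?case .
  qed (use uc gen in simp_all)
qed

lemma W_singleton: "t \<in> S \<Longrightarrow> x \<in> W {t} \<Longrightarrow> x = \<one> \<or> x = t"
proof -
  assume t: "t \<in> S" and "x \<in> W {t}"
  from this(2) show ?thesis
    by (induction rule: generate.induct) (use t in \<open>auto simp: gen_sq\<close>)
qed

lemma commuting_support:
  "v \<in> carrier G \<Longrightarrow> s \<in> S \<Longrightarrow> s \<notin> sp v \<Longrightarrow> s \<otimes> v = v \<otimes> s \<Longrightarrow> t \<in> sp v \<Longrightarrow> \<not> adj s t"
proof (induction "len v" arbitrary: v)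
  case 0
  then show ?case using len_zero[of v] by simp
next
  case (Suc n)
  have v: "v \<in> carrier G" and s: "s \<in> S" "s \<notin> sp v" by fact+
  obtain v' q where v': "v' \<in> carrier G" and qS: "q \<in> S" and vq: "v = v' \<otimes> q" and lv': "len v' = n"
    and spv: "sp v = sp v' \<union> {q}"
    using obtain_last[OF v Suc(2)] .
  then have q: "q \<in> S" "q \<in> sp v" "q \<noteq> s" using s by auto
  define x where "x = s \<otimes> v"
  have xc: "x \<in> carrier G" using s v by (simp add: x_def)
  have lx: "len x = len v + 1" using DL_len[of s v] DL_sp[OF v] s v by (auto simp: x_def)
  have xs: "x = v \<otimes> s" using Suc by (simp add: x_def)
  have "s \<in> DR x" using s v lx by (simp add: DR_iff xs gen_cancel_right)
  moreover have "q \<in> DR x"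
  proof -
    have "x \<otimes> q = s \<otimes> v'" using q v' s by (simp add: x_def vq m_assoc gen_sq)
    then have "len (x \<otimes> q) \<le> 1 + len v'" using len_mult[of s v'] s v' by simp
    then show ?thesis using lv' Suc(2) lx q by (simp add: DR_iff)
  qed
  ultimately have J: "{s, q} \<subseteq> DR x" by blast
  let ?J = "{s, q}"
  have sph: "sph ?J" using DR_spherical[OF xc J] .
  define a where "a = x \<otimes> wo ?J"
  define b where "b = wo ?J \<otimes> s"
  have a: "a \<in> MR ?J" "a \<in> carrier G" using DR_decomp(1)[OF xc J] by (auto simp: a_def)
  have bW: "b \<in> W ?J" unfolding b_def using wo_W[OF sph] by (auto intro: W_mult W_gen)
  have bc: "b \<in> carrier G" using bW s q by simp
  have v_ab: "v = a \<otimes> b"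
    using xs v s sph xc by (simp add: a_def b_def m_assoc wo_cancel gen_sq)
  have "sp v = sp a \<union> sp b" unfolding v_ab by (rule MR_sp) (use s q a bW in auto)
  then have "s \<notin> sp b" using s by blast
  moreover have "sp b \<subseteq> ?J" using W_spD[OF _ bW] s q by simp
  ultimately have "sp b \<subseteq> {q}" by blast
  then have "b \<in> W {q}" using W_iff[of "{q}" b] q bc by simp
  then have b_cases: "b = \<one> \<or> b = q" using W_singleton q by blast
  have wos: "wo ?J = b \<otimes> s" using sph s by (simp add: b_def gen_cancel_right)
  have qd: "q \<in> DR (wo ?J)" using wo_DR[OF sph] by simp
  have "s \<otimes> q = q \<otimes> s"
  proof (cases "b = \<one>")
    case True
    then have "q \<in> sp s" using qd wos DR_sp[of s] s by auto
    then show ?thesis using s by simp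
  next
    case False
    then have w: "wo ?J = q \<otimes> s" using b_cases wos by simp
    let ?y = "q \<otimes> s \<otimes> q"
    have yc: "?y \<in> carrier G" using q s by simp
    have "len (q \<otimes> s) = 2" using DR_len[of s q] DR_sp[of q] s q by (auto simp: numeral_2_eq_2)
    then have "len ?y = 1" using DR_len'[OF _ qd] w sph q s by simp
    then have yS: "?y \<in> S" using len_one_gen[OF yc] by simp
    have qW: "q \<in> W ?J" by (rule W_gen) simp
    have sW: "s \<in> W ?J" by (rule W_gen) simp
    have "?y \<in> W ?J" by (rule W_mult[OF W_mult[OF qW sW] qW])
    then have "?y \<in> ?J" using gen_in_W[OF yS, of ?J] s(1) q(1) by simp
    moreover have "?y \<noteq> q"
    proof
      assume "?y = q"
      then have "inv s = q" using q s inv_equality[of q s] by simp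
      then show False using q s by simp
    qed
    ultimately have "?y = s" by simp
    then show ?thesis using q s gen_cancel_right[of q "q \<otimes> s"] by simp
  qed
  then have nsq: "\<not> adj s q" by (simp add: adj_iff)
  have "s \<otimes> v' \<otimes> q = v' \<otimes> s \<otimes> q"
    using Suc(6) \<open>s \<otimes> q = q \<otimes> s\<close> v' s q by (simp add: vq m_assoc)
  then have "s \<otimes> v' = v' \<otimes> s" using v' s q by simp
  moreover have "s \<notin> sp v'" using spv s by blast
  ultimately have "t \<in> sp v' \<Longrightarrow> \<not> adj s t" using Suc(1)[of v'] lv' v' s by simp
  then show ?case using nsq spv Suc(7) by blast
qed

text \<open>Lengths add on both sides of \<open>s x = x p\<close>, so comparing supports identifies
  \<open>p\<close>; the rest is \<open>commuting_support\<close>.\<close>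

lemma swap_support:
  assumes x: "x \<in> carrier G" and s: "s \<in> S" "s \<notin> sp x" and p: "p \<in> S" and e: "s \<otimes> x = x \<otimes> p"
  shows "p = s" "t \<in> sp x \<Longrightarrow> \<not> adj s t"
proof -
  have sx: "len (s \<otimes> x) = len x + 1" using DL_len[of s x] DL_sp[OF x] s x by auto
  then have "sp (s \<otimes> x) = {s} \<union> sp x" using sp_mult_eq[of s x] s x by simp
  moreover have "sp (x \<otimes> p) = sp x \<union> {p}" using sp_mult_eq[of x p] p x sx e by simp
  ultimately have "s \<in> sp x \<union> {p}" using e by auto
  then show "p = s" using s by auto
  then show "t \<in> sp x \<Longrightarrow> \<not> adj s t" using commuting_support[of x s t] e x s by simp
qed

text \<open>A form of Deodhar's lemma. Exchange acts on \<open>z\<close>, so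
  \<open>s x = x q\<close> with \<open>q\<close> in \<open>W M\<close>, and additivity of length
  shows that \<open>q\<close> has length one.\<close>

lemma descent_shift_left:
  assumes M: "M \<subseteq> S" and x: "x \<in> MR M" and z: "z \<in> W M" and d: "s \<in> DL (x \<otimes> z)" and n: "s \<notin> DL x"
  obtains p where "p \<in> M" "s \<otimes> x = x \<otimes> p" "p \<in> DL z"
proof -
  have c: "x \<in> carrier G" "z \<in> carrier G" and s: "s \<in> S" using x z M d by (auto simp: DL_iff)
  obtain z' where z': "z' \<in> W (sp z)" "s \<otimes> (x \<otimes> z) = x \<otimes> z'" "len z' < len z"
    using exchange_left[OF s c d n] .
  have z'M: "z' \<in> W M" using z' W_spD[OF M z] W_mono by blast
  then have zc: "z' \<in> carrier G" using M by simp
  define q where "q = z' \<otimes> inv z"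
  have qM: "q \<in> W M" unfolding q_def using z'M W_inv[OF M z] W_mult by blast
  have qc: "q \<in> carrier G" using qM M by simp
  have sx: "s \<otimes> x = x \<otimes> q"
  proof -
    have "s \<otimes> x = s \<otimes> (x \<otimes> z) \<otimes> inv z" using c s by (simp add: m_assoc)
    also have "\<dots> = x \<otimes> q" unfolding z'(2) using c zc by (simp add: q_def m_assoc)
    finally show ?thesis .
  qed
  have "len (s \<otimes> x) = len x + 1" using DL_len[OF s c(1) n] .
  then have "len q = 1" using MR_len[OF M x qM] sx by simp
  then have qS: "q \<in> S" using len_one_gen[OF qc] by simp
  have "q \<otimes> z = z'" using zc c by (simp add: q_def m_assoc)
  then show thesis using that[OF gen_in_W[OF qS M qM] sx] z' qS by (simp add: DL_iff)
qed

lemma descent_below: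
  assumes M: "M \<subseteq> S" and x: "x \<in> MR M" and z: "z \<in> W M" and d: "s \<in> DL (x \<otimes> z)" and n: "s \<notin> sp x"
  shows "s \<in> DL z" "t \<in> sp x \<Longrightarrow> \<not> adj s t"
proof -
  have xc: "x \<in> carrier G" and sS: "s \<in> S" using x d by (simp_all add: DL_iff)
  have "s \<notin> DL x" using DL_sp[OF xc] n by blast
  then obtain p where p: "p \<in> M" "s \<otimes> x = x \<otimes> p" "p \<in> DL z"
    using descent_shift_left[OF M x z d] by blast
  have pS: "p \<in> S" using p(1) M by blast
  show "s \<in> DL z" "t \<in> sp x \<Longrightarrow> \<not> adj s t" using swap_support[OF xc sS n pS p(2)] p(3) by simp_all
qed

lemma descent_shift_right:
  assumes M: "M \<subseteq> S" and x: "x \<in> LM M" and z: "z \<in> W M" and d: "s \<in> DR (z \<otimes> x)" and n: "s \<notin> DR x"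
  obtains p where "p \<in> M" "x \<otimes> s = p \<otimes> x" "p \<in> DR z"
proof -
  have c: "x \<in> carrier G" "z \<in> carrier G" and s: "s \<in> S" using x z M d by (auto simp: DR_iff)
  have "inv x \<in> MR M" "inv z \<in> W M" "s \<in> DL (inv x \<otimes> inv z)" "s \<notin> DL (inv x)"
    using x c W_inv[OF M z] d n DL_inv[of "z \<otimes> x"] DL_inv[of x] by (auto simp: inv_mult_group)
  from descent_shift_left[OF M this]
  obtain p where p: "p \<in> M" "s \<otimes> inv x = inv x \<otimes> p" "p \<in> DL (inv z)" .
  then have pS: "p \<in> S" using M by auto
  have "x \<otimes> s = inv (s \<otimes> inv x)" using c s by (simp add: inv_mult_group)
  also have "\<dots> = p \<otimes> x" unfolding p(2) using pS c by (simp add: inv_mult_group)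
  finally show thesis using that p c DL_inv by simp
qed

lemma W_sp_sub: "x \<in> carrier G \<Longrightarrow> sp x \<subseteq> J \<Longrightarrow> x \<in> W J"
  using W_sp W_mono by blast

lemma wo_union:
  assumes s: "sph (K1 \<union> K2)" and d: "K1 \<inter> K2 = {}" and n: "\<And>s t. s \<in> K1 \<Longrightarrow> t \<in> K2 \<Longrightarrow> \<not> adj s t"
  shows "wo (K1 \<union> K2) = wo K1 \<otimes> wo K2"
proof -
  have S: "K1 \<subseteq> S" "K2 \<subseteq> S" using sphD[OF s] by auto
  have s1: "sph K1" and s2: "sph K2" using sph_subset[OF s] by auto
  let ?x = "wo K1 \<otimes> wo K2"
  have sub: "K1 \<subseteq> DL (wo K1 \<otimes> wo K2)" if S: "K1 \<subseteq> S" "K2 \<subseteq> S" and s1: "sph K1" and s2: "sph K2" and d: "K1 \<inter> K2 = {}" for K1 K2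
  proof
    fix t assume t: "t \<in> K1"
    have l: "wo K2 \<in> LM K1" using LM_iff[OF S(1)] wo_DL[OF s2] s2 d by auto
    have "len (t \<otimes> (wo K1 \<otimes> wo K2)) = len (t \<otimes> wo K1) + len (wo K2)"
      using LM_len[OF S(1) l, of "t \<otimes> wo K1"] W_mult[OF W_gen[OF t] wo_W[OF s1]] t S s1 s2
      by (auto simp: m_assoc)
    also have "\<dots> < len (wo K1 \<otimes> wo K2)"
      using LM_len[OF S(1) l wo_W[OF s1]] wo_DL_sub[OF s1] t by (auto simp: DL_iff)
    finally show "t \<in> DL (wo K1 \<otimes> wo K2)" using t S by (auto simp: DL_iff)
  qed
  have e: "?x = wo K2 \<otimes> wo K1" by (rule comm_WW[OF S wo_W[OF s1] wo_W[OF s2] n])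
  have "K1 \<union> K2 \<subseteq> DL ?x" using sub[OF S s1 s2 d] sub[OF S(2,1) s2 s1] d e by auto
  moreover have "?x \<in> W (K1 \<union> K2)"
    using wo_W[OF s1] wo_W[OF s2] by (intro W_mult) (auto intro: W_mono[rotated])
  ultimately show ?thesis using wo_unique by simp
qed

subsection \<open>Elements with at most one non-descent\<close>

text \<open>The nearly-maximal and the maximal elements with connected support \<open>B\<close>
  are exactly those satisfying this condition for some \<open>s \<in> B\<close>.\<close>

definition good where
  "good B s b \<longleftrightarrow> conn B \<and> b \<in> carrier G \<and> s \<in> B \<and> sp b = B \<and> B - {s} \<subseteq> DR b \<and>
     sp (b \<otimes> wo (B - {s})) = B"

text \<open>A descent outside the support of \<open>y\<close> has to pass through \<open>y\<close>,
  giving \<open>y p = q y\<close> with \<open>q\<close> in \<open>J\<close>; comparing supports,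
  \<open>p\<close> commutes with every letter of \<open>y\<close>.\<close>

lemma left_factor_noncommuting:
  assumes J: "J \<subseteq> S" and a: "a \<in> W J" and y: "y \<in> LM J" and p: "p \<in> DR (a \<otimes> y)" "p \<notin> sp y" "t \<in> sp y"
  shows "\<not> adj p t"
proof -
  have yc: "y \<in> carrier G" using y by simp
  have pS: "p \<in> S" using p by (simp add: DR_iff)
  have "p \<notin> DR y" using DR_sp[OF yc] p by blast
  then obtain q where q: "q \<in> J" "y \<otimes> p = q \<otimes> y" using descent_shift_right[OF J y a p(1)] by blast
  then have "p \<otimes> inv y = inv y \<otimes> q"
    using pS J yc inv_mult_group[of y p] inv_mult_group[of q y] by auto
  from swap_support(2)[OF _ pS _ _ this, of t] show ?thesis using q J p yc by auto
qed

lemma left_factor_gap: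
  assumes c: "conn B" and B: "sp (a \<otimes> y) = B" and J: "J \<subset> B" "J \<subseteq> S" and a: "a \<in> W J" and y: "y \<in> LM J"
    and ne: "sp y \<noteq> B"
  obtains q where "q \<in> B" "q \<notin> sp y" "q \<notin> DR (a \<otimes> y)"
proof -
  have spb: "B = sp a \<union> sp y" and aJ: "sp a \<subseteq> J" using LM_sp[OF J(2) y a] B W_spD[OF J(2) a] by simp_all
  obtain t where t: "t \<in> sp y" "t \<in> B" using spb aJ J by blast
  obtain r where r: "r \<in> B" "r \<notin> sp y" using ne spb by blast
  obtain p q where pq: "p \<in> B" "p \<in> sp y" "q \<in> B" "q \<notin> sp y" "adj p q"
    using conn_step[OF c t(2,1) r] .
  have "q \<notin> DR (a \<otimes> y)"
    using left_factor_noncommuting[OF J(2) a y _ pq(4,2)] adj_sym[OF pq(5)] by blast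
  then show thesis using that pq by blast
qed

lemma good_left_factor_full:
  assumes g: "good B s b" and J: "J \<subset> B" and a: "a \<in> W J" and y: "y \<in> LM J" and e: "b = a \<otimes> y"
  shows "sp y = B"
proof (rule ccontr)
  assume ne: "sp y \<noteq> B"
  have bc: "b \<in> carrier G" and B: "sp b = B" "conn B" "s \<in> B" "B - {s} \<subseteq> DR b" using g by (auto simp: good_def)
  have BS: "B \<subseteq> S" using B sp_subset bc by blast
  have JS: "J \<subseteq> S" using BS J by auto
  have c: "a \<in> carrier G" "y \<in> carrier G" using a y JS by auto
  have spb: "B = sp a \<union> sp y" using LM_sp[OF JS y a] e B by simp
  have aJ: "sp a \<subseteq> J" using W_spD[OF JS a] .
  obtain q where q: "q \<in> B" "q \<notin> sp y" "q \<notin> DR b"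
    using left_factor_gap[OF B(2) _ J JS a y ne] B(1) e by metis
  \<comment> \<open>Only \<open>s\<close> can fail to be a right descent of \<open>b\<close>; so
    \<open>y\<close> avoids \<open>s\<close> and lies in the parabolic subgroup of
    \<open>B - {s}\<close>.\<close>
  then have "q = s" using B by blast
  then have yW: "y \<in> W (B - {s})" using q c spb by (intro W_sp_sub) auto
  let ?K = "B - {s}"
  have KS: "?K \<subseteq> S" using BS by auto
  obtain v u where vu: "v \<in> MR ?K" "u \<in> W ?K" "a = v \<otimes> u" using MR_decomp[OF KS c(1)] .
  have uc: "v \<in> carrier G" "u \<in> carrier G" using vu KS by auto
  have sphK: "sph ?K" using DR_spherical[OF bc B(4)] .
  have b1: "b = (b \<otimes> wo ?K) \<otimes> wo ?K" using bc sphK by (simp add: wo_cancel_right)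
  have b2: "b = v \<otimes> (u \<otimes> y)" using e vu uc c by (simp add: m_assoc)
  \<comment> \<open>Now \<open>a\<close> and \<open>b\<close> span the same coset of
    \<open>W ?K\<close>, so \<open>v\<close> is the minimal representative for both. Its support is
    \<open>B\<close> by goodness, although \<open>v\<close> is a prefix of \<open>a\<close>.\<close>
  have "b \<otimes> wo ?K = v"
    by (rule MR_unique(1)[OF KS DR_decomp(1)[OF bc B(4)] vu(1) wo_W[OF sphK] W_mult[OF vu(2) yW]])
      (use b1 b2 in simp)
  then have "sp v = B" using g by (simp add: good_def)
  moreover have "sp v \<subseteq> sp a" using MR_sp[OF KS vu(1,2)] vu(3) by auto
  ultimately show False using aJ J by auto
qed

text \<open>Every generator in \<open>B\<close> is a right descent of \<open>wo B\<close>, so the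
  non-descent produced by the cut argument is an immediate contradiction.\<close>

lemma wo_left_factor_full:
  assumes c: "conn B" and sB: "sph B" and J: "J \<subset> B"
  shows "sp (wo J \<otimes> wo B) = B"
proof (rule ccontr)
  assume ne: "sp (wo J \<otimes> wo B) \<noteq> B"
  have JS: "J \<subseteq> S" and sJ: "sph J" using sphD[OF sB] sph_subset[OF sB] J by auto
  have y: "wo J \<otimes> wo B \<in> LM J" using DL_decomp(1)[of "wo B" J] wo_DL[OF sB] J sB by auto
  have e: "wo J \<otimes> (wo J \<otimes> wo B) = wo B" using sJ sB by (simp add: wo_cancel)
  show False using left_factor_gap[OF c _ J JS wo_W[OF sJ] y ne] wo_sp[OF sB] wo_DR[OF sB] unfolding e by blast
qed

lemma good_maximal:
  assumes c: "conn B" and sB: "sph B" and s: "s \<in> B"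
  shows "good B s (wo B)"
proof -
  have sK: "sph (B - {s})" using sph_subset[OF sB] by auto
  have "sp (inv (wo (B - {s}) \<otimes> wo B)) = B"
    using wo_left_factor_full[OF c sB, of "B - {s}"] s sB sK by auto
  then have "sp (wo B \<otimes> wo (B - {s})) = B" using sB sK by (simp add: inv_mult_group wo_inv)
  then show ?thesis unfolding good_def using c sB s wo_sp[OF sB] wo_DR[OF sB] by auto
qed

lemma goodD:
  assumes "good B s b"
  shows "conn B" "b \<in> carrier G" "s \<in> B" "sp b = B" "B - {s} \<subseteq> DR b"
    "sp (b \<otimes> wo (B - {s})) = B" "B \<subseteq> S" "finite B" "sph (B - {s})" "b \<otimes> wo (B - {s}) \<in> MR (B - {s})"
  using assms sp_subset[of b] sp_finite[of b] DR_spherical[of b "B - {s}"] DR_decomp(1)[of b "B - {s}"]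
  by (auto simp: good_def)

text \<open>Strip the letters of \<open>y\<close> from the right. Each is a right descent of the
  current product \<open>a b\<close>: it is either absorbed by \<open>b\<close> or, by exchange,
  shortens \<open>a\<close> within its support. So the set of products is never left.\<close>

lemma W_prod_prefix:
  assumes I: "I \<subseteq> S" and J: "J \<subseteq> S" and xc: "x \<in> carrier G" and yc: "y \<in> carrier G"
    and l: "len (x \<otimes> y) = len x + len y" and e: "x \<otimes> y = a \<otimes> b" and a: "a \<in> W I" and b: "b \<in> W J"
  shows "\<exists>a\<in>W I. \<exists>b\<in>W J. x = a \<otimes> b"
  using yc l e a b
proof (induction "len y" arbitrary: y a b)
  case 0
  then have "y = \<one>" using len_zero by simp
  then show ?case using 0 xc by auto
next
  case (Suc n)
  note yc = Suc(3)
  obtain y' q where y': "y' \<in> carrier G" and q: "q \<in> S" and yq: "y = y' \<otimes> q" and ly': "len y' = n"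
    using obtain_last[OF yc Suc(2)] .
  have xyq: "x \<otimes> y \<otimes> q = x \<otimes> y'" using xc y' q by (simp add: yq m_assoc gen_sq)
  have "len (x \<otimes> y') \<le> len x + len y'" using len_mult xc y' by simp
  then have d: "q \<in> DR (x \<otimes> y)" using q Suc(4) xyq ly' Suc(2) by (simp add: DR_iff)
  have l': "len (x \<otimes> y') = len x + len y'"
    using DR_len'[OF _ d] xyq Suc(2,4) ly' xc yc by simp
  have ac: "a \<in> carrier G" "b \<in> carrier G" using Suc(6,7) I J by auto
  have "\<exists>a'\<in>W I. \<exists>b'\<in>W J. x \<otimes> y' = a' \<otimes> b'"
  proof (cases "q \<in> DR b")
    case True
    then have "q \<in> J" using DR_sp[OF ac(2)] W_spD[OF J Suc(7)] by blast
    moreover have "x \<otimes> y' = a \<otimes> (b \<otimes> q)" using xyq Suc(5) ac q by (simp add: m_assoc)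
    ultimately show ?thesis using Suc(6,7) W_mult W_gen by blast
  next
    case False
    obtain a' where "a' \<in> W (sp a)" "a \<otimes> b \<otimes> q = a' \<otimes> b"
      using exchange_right[OF q ac _ False] d Suc(5) by auto
    then show ?thesis using xyq Suc(5,6,7) W_mono[OF W_spD[OF I]] by metis
  qed
  then obtain a' b' where ab': "a' \<in> W I" "b' \<in> W J" "x \<otimes> y' = a' \<otimes> b'" by blast
  show ?case using Suc(1)[OF _ y' l' ab'(3,1,2)] ly' by simp
qed

text \<open>If \<open>B\<close> is not inside \<open>A\<close>, cutting off the part of
  \<open>b\<close> in \<open>A\<close> leaves \<open>y1\<close> with support \<open>B\<close> by
  rigidity. As \<open>y1\<close> is minimal for \<open>W A\<close> on the left, its support survives
  in the second factor of any factorization of \<open>b\<close> in \<open>W A\<close> times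
  \<open>W N\<close>. A block is therefore never split between two factors.\<close>

lemma good_prefix:
  assumes g: "good B s b" and A: "A \<subseteq> S" and N: "N \<subseteq> S" and yc: "y \<in> carrier G"
    and l: "len (b \<otimes> y) = len b + len y" and e: "b \<otimes> y = \<alpha> \<otimes> \<zeta>" and \<alpha>: "\<alpha> \<in> W A" and \<zeta>: "\<zeta> \<in> W N"
  shows "B \<subseteq> A \<or> B \<subseteq> N"
proof (cases "B \<subseteq> A")
  case False
  have bc: "b \<in> carrier G" and BS: "B \<subseteq> S" using goodD[OF g] by auto
  let ?J = "A \<inter> B"
  have JS: "?J \<subseteq> S" using BS by auto
  obtain c y1 where cy: "c \<in> W ?J" "y1 \<in> LM ?J" "b = c \<otimes> y1" using LM_decomp[OF JS bc] .
  have full: "sp y1 = B" using good_left_factor_full[OF g _ cy] False by auto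
  have y1c: "y1 \<in> carrier G" using cy by simp
  have y1A: "y1 \<in> LM A" by (rule LM_sp_iff[OF A y1c _ JS cy(2)]) (use full in auto)
  obtain a' z' where az: "a' \<in> W A" "z' \<in> W N" "b = a' \<otimes> z'"
    using W_prod_prefix[OF A N bc yc l e \<alpha> \<zeta>] by blast
  have cA: "c \<in> W A" using cy(1) W_mono[of ?J A] by auto
  have c': "c \<in> carrier G" "a' \<in> carrier G" "z' \<in> carrier G" using cA az A N by auto
  have "z' = (inv a' \<otimes> c) \<otimes> y1"
    using az(3) cy(3) c' y1c by (simp add: m_assoc inv_solve_left)
  then have "sp y1 \<subseteq> sp z'" using LM_sp[OF A y1A, of "inv a' \<otimes> c"] W_mult[OF W_inv[OF A az(1)] cA] by auto
  then show ?thesis using full W_spD[OF N az(2)] by auto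
qed simp

subsection \<open>Grassmannian BP decompositions\<close>

lemma W_union:
  assumes A: "A \<subseteq> S" and C: "C \<subseteq> S" and n: "\<And>s t. s \<in> A \<Longrightarrow> t \<in> C \<Longrightarrow> \<not> adj s t" and v: "v \<in> W (A \<union> C)"
  shows "\<exists>a\<in>W A. \<exists>c\<in>W C. v = a \<otimes> c"
proof -
  have base: "\<exists>a\<in>W A. \<exists>c\<in>W C. h = a \<otimes> c" if "h \<in> A \<union> C" for h
    using that
  proof
    assume h: "h \<in> A"
    then have "h = h \<otimes> \<one>" using A by auto
    then show ?thesis using W_gen[OF h] W_one by blast
  next
    assume h: "h \<in> C"
    then have "h = \<one> \<otimes> h" using C by auto
    then show ?thesis using W_gen[OF h] W_one by blast
  qed
  show ?thesis using v
  proof (induction rule: generate.induct)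
    case one
    show ?case using W_one by force
  next
    case (incl h)
    then show ?case by (rule base)
  next
    case (inv h)
    then have "inv h = h" using A C by auto
    then show ?case using base[OF inv] by simp
  next
    case (eng x y)
    then obtain a c a' c' where ac: "a \<in> W A" "c \<in> W C" "x = a \<otimes> c" "a' \<in> W A" "c' \<in> W C" "y = a' \<otimes> c'"
      by blast
    then have cc: "a \<in> carrier G" "c \<in> carrier G" "a' \<in> carrier G" "c' \<in> carrier G" using A C by auto
    have e: "c \<otimes> a' = a' \<otimes> c" using comm_WW[OF A C ac(4,2) n] by simp
    have "x \<otimes> y = a \<otimes> (c \<otimes> a') \<otimes> c'" using ac cc by (simp add: m_assoc)
    also have "\<dots> = (a \<otimes> a') \<otimes> (c \<otimes> c')" unfolding e using cc by (simp add: m_assoc)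
    finally show ?case using ac W_mult by blast
  qed
qed

lemma DL_mult: "K \<subseteq> S \<Longrightarrow> y \<in> LM K \<Longrightarrow> u \<in> W K \<Longrightarrow> t \<in> DL u \<Longrightarrow> t \<in> DL (u \<otimes> y)"
  by (rule DL_prefix) (simp_all add: LM_len)

lemma DR_mult: "K \<subseteq> S \<Longrightarrow> v \<in> MR K \<Longrightarrow> u \<in> W K \<Longrightarrow> t \<in> DR u \<Longrightarrow> t \<in> DR (v \<otimes> u)"
  by (rule DR_suffix) (simp_all add: MR_len)

text \<open>If the support fell apart into two commuting pieces, the piece without \<open>s\<close>
  would contribute a right descent other than \<open>s\<close>.\<close>

lemma grassmannian_connected:
  assumes v: "v \<in> carrier G" and s: "s \<in> sp v" and d: "DR v \<subseteq> {s}"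
  shows "conn (sp v)"
proof (rule connI, rule ccontr)
  fix X x y
  assume X: "x \<in> sp v" "x \<in> X" "X \<subseteq> sp v" "y \<in> sp v" "y \<notin> X"
    and n: "\<not> (\<exists>p\<in>X. \<exists>q\<in>sp v - X. adj p q)"
  have *: False if AC: "A \<union> C = sp v" "A \<inter> C = {}" "C \<noteq> {}" "s \<notin> C"
    and n: "\<And>p q. p \<in> A \<Longrightarrow> q \<in> C \<Longrightarrow> \<not> adj p q" for A C
  proof -
    have S: "A \<subseteq> S" "C \<subseteq> S" using AC sp_subset[OF v] by auto
    obtain a c where ac: "a \<in> W A" "c \<in> W C" "v = a \<otimes> c"
      using W_union[OF S n] W_sp[OF v] AC by metis
    have cc: "a \<in> carrier G" "c \<in> carrier G" using ac S by auto
    have aC: "a \<in> MR C" using MR_iff[OF S(2), of a] cc DR_sp[of a] W_spD[OF S(1) ac(1)] AC by blast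
    have "c = \<one>"
    proof (rule ccontr)
      assume "c \<noteq> \<one>"
      then obtain t where t: "t \<in> DR c" using obtain_DR cc by blast
      have tC: "t \<in> C" using t DR_sp[OF cc(2)] W_spD[OF S(2) ac(2)] by blast
      have "t \<in> DR v" using DR_mult[OF S(2) aC ac(2) t] ac(3) by simp
      then show False using d tC AC by blast
    qed
    then have "v = a" using ac cc by simp
    then show False using AC W_spD[OF S(1) ac(1)] by auto
  qed
  show False
  proof (cases "s \<in> X")
    case True
    then show ?thesis using *[of X "sp v - X"] X n by blast
  next
    case False
    then show ?thesis using *[of "sp v - X" X] X n adj_sym by blast
  qed
qed

abbreviation gBP where "gBP w v u \<equiv> grassmannian_BP G S w v u"

text \<open>The BP condition puts \<open>sp v \<inter> J\<close> into the left descents and so into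
  the support of \<open>u\<close>. Since the support of \<open>w\<close> is the union of both
  supports, that of \<open>u\<close> must be all of \<open>J\<close>.\<close>

lemma grassmannian_elim:
  assumes g: "gBP w v u"
  obtains s where "s \<in> sp w" "v \<in> MR (sp w - {s})" "u \<in> W (sp w - {s})" "w = v \<otimes> u"
    "sp u = sp w - {s}" "sp v \<inter> (sp w - {s}) \<subseteq> DL u" "w \<in> carrier G" "s \<in> sp v"
proof -
  obtain J where J: "J \<subseteq> sp w" "card J + 1 = card (sp w)" and JS: "J \<subseteq> S" and v: "v \<in> MR J" and u: "u \<in> W J"
    and w: "w = v \<otimes> u" and d: "sp v \<inter> J \<subseteq> DL u"
    using g unfolding grassmannian_BP_def BP_decomp_def parabolic_decomp_def by blast
  have c: "v \<in> carrier G" "u \<in> carrier G" using v u JS by auto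
  then have wc: "w \<in> carrier G" using w by simp
  have fin: "finite (sp w)" using sp_finite[OF wc] .
  have "card (sp w - J) = 1" using J fin by (simp add: card_Diff_subset finite_subset)
  then obtain s where s: "sp w - J = {s}" by (auto simp: card_1_singleton_iff)
  then have Js: "J = sp w - {s}" "s \<in> sp w" using J by auto
  have "sp w = sp v \<union> sp u" unfolding w by (rule MR_sp[OF JS v u])
  moreover have "sp u \<subseteq> J" using W_spD[OF JS u] .
  ultimately have "sp u = J" "s \<in> sp v" using d DL_sp[OF c(2)] J Js by auto
  then show thesis using that[of s] Js v u w d wc by simp
qed

text \<open>The BP condition makes \<open>K = sp v - {s}\<close> a set of left descents of
  \<open>u\<close>, so \<open>wo K\<close> can be moved from \<open>u\<close> to \<open>v\<close>.
  What remains of \<open>u\<close> has no left descent in \<open>K\<close>, and none at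
  \<open>s\<close> since \<open>s\<close> is not in its support.\<close>

lemma grassmannian_good:
  assumes g: "gBP w v u"
  obtains s where "good (sp v) s (v \<otimes> wo (sp v - {s}))" "wo (sp v - {s}) \<otimes> u \<in> LM (sp v)"
    "s \<notin> sp (wo (sp v - {s}) \<otimes> u)" "w = (v \<otimes> wo (sp v - {s})) \<otimes> (wo (sp v - {s}) \<otimes> u)"
    "sph (sp v - {s})" "sp u = sp w - {s}" "s \<in> sp w" "sp v - {s} \<subseteq> DL u"
    "w \<in> carrier G" "v \<in> carrier G" "u \<in> carrier G"
proof -
  obtain s where s: "s \<in> sp w" "v \<in> MR (sp w - {s})" "u \<in> W (sp w - {s})" "w = v \<otimes> u"
    "sp u = sp w - {s}" "sp v \<inter> (sp w - {s}) \<subseteq> DL u" "w \<in> carrier G" "s \<in> sp v"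
    using grassmannian_elim[OF g] .
  let ?J = "sp w - {s}" and ?B = "sp v" and ?K = "sp v - {s}"
  have JS: "?J \<subseteq> S" using sp_subset s by blast
  have c: "v \<in> carrier G" "u \<in> carrier G" using s JS by auto
  have "sp w = sp v \<union> sp u" unfolding s(4) by (rule MR_sp[OF JS s(2,3)])
  then have KJ: "?K \<subseteq> ?J" and Kd: "?K \<subseteq> DL u" using s by auto
  have KS: "?K \<subseteq> S" and BS: "?B \<subseteq> S" using sp_subset c by auto
  have sK: "sph ?K" using DL_spherical[OF c(2) Kd] .
  have vK: "v \<in> MR ?K" using MR_mono[OF KJ JS s(2)] .
  have dv: "DR v \<subseteq> {s}" using vK MR_iff[OF KS, of v] DR_sp[OF c(1)] by blast
  have spb: "sp (v \<otimes> wo ?K) = ?B" using MR_sp[OF KS vK wo_W[OF sK]] wo_sp[OF sK] by auto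
  have "?K \<subseteq> DR (v \<otimes> wo ?K)"
    using DR_mult[OF KS vK wo_W[OF sK]] wo_DR[OF sK] by blast
  then have gd: "good ?B s (v \<otimes> wo ?K)"
    unfolding good_def using grassmannian_connected[OF c(1) s(8) dv] spb c sK s(8)
    by (auto simp: wo_cancel_right)
  have y: "wo ?K \<otimes> u \<in> LM ?K" using DL_decomp(1)[OF c(2) Kd] .
  have "wo ?K \<otimes> u \<in> W ?J" using W_mult[OF W_mono[OF KJ wo_W[OF sK]] s(3)] .
  then have spy: "sp (wo ?K \<otimes> u) \<subseteq> ?J" using W_spD[OF JS] by blast
  have yB: "wo ?K \<otimes> u \<in> LM ?B"
    by (rule LM_sp_iff[OF BS _ _ KS y]) (use spy c sK in auto)
  have "w = (v \<otimes> wo ?K) \<otimes> (wo ?K \<otimes> u)" using s(4) c sK by (simp add: m_assoc wo_cancel)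
  then show thesis using that gd yB spy s c sK Kd by blast
qed

text \<open>Connectedness of \<open>B\<close> is left out, in contrast to \<open>good\<close>,
  because single generators are also added to longest elements of disconnected sets.\<close>

lemma grassmannianI:
  assumes b: "b \<in> carrier G" "sp b = B" and sB: "s \<in> B" and d: "B - {s} \<subseteq> DR b"
    and y: "y \<in> LM B" and n: "s \<notin> sp y"
  shows "gBP (b \<otimes> y) (b \<otimes> wo (B - {s})) (wo (B - {s}) \<otimes> y)"
proof -
  let ?K = "B - {s}" and ?w = "b \<otimes> y"
  let ?v = "b \<otimes> wo ?K" and ?u = "wo ?K \<otimes> y"
  let ?J = "sp ?w - {s}"
  have yc: "y \<in> carrier G" using y by simp
  have bW: "b \<in> W B" using W_sp[OF b(1)] b(2) by simp
  have BS: "B \<subseteq> S" and sK: "sph ?K" and vK: "?v \<in> MR ?K"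
    using sp_subset[OF b(1)] b(2) DR_spherical[OF b(1) d] DR_decomp(1)[OF b(1) d] by simp_all
  have spw: "sp ?w = B \<union> sp y" using LM_sp[OF BS y bW] b(2) by simp
  have KS: "?K \<subseteq> S" using BS by auto
  have JS: "?J \<subseteq> S" using spw BS sp_subset[OF yc] by auto
  have "?v \<in> W B" by (intro W_mult bW W_mono[OF _ wo_W[OF sK]]) auto
  then have spv: "sp ?v \<subseteq> B" using W_spD[OF BS] by blast
  have vJ: "?v \<in> MR ?J" by (rule MR_sp_iff[OF JS _ _ KS vK]) (use spv b sK in auto)
  have uJ: "?u \<in> W ?J"
    by (intro W_mult W_mono[OF _ wo_W[OF sK]] W_sp_sub) (use yc spw n in auto)
  have "?w = ?v \<otimes> ?u" using b sK yc by (simp add: m_assoc wo_cancel)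
  moreover have "?K \<subseteq> DL ?u"
    using DL_mult[OF KS LM_mono[OF _ BS y] wo_W[OF sK]] wo_DL[OF sK] by blast
  moreover have "card ?J + 1 = card (sp ?w)"
  proof -
    have "finite (sp ?w)" "s \<in> sp ?w" using sp_finite[of ?w] b sB yc spw by auto
    then show ?thesis by (metis Suc_eq_plus1 card_Suc_Diff1)
  qed
  ultimately show ?thesis
    unfolding grassmannian_BP_def BP_decomp_def parabolic_decomp_def
    using vJ uJ JS spv by (intro exI[of _ ?J]) auto
qed

lemma good_grassmannian:
  "good B s b \<Longrightarrow> y \<in> LM B \<Longrightarrow> s \<notin> sp y \<Longrightarrow>
   gBP (b \<otimes> y) (b \<otimes> wo (B - {s})) (wo (B - {s}) \<otimes> y)"
  by (rule grassmannianI) (simp_all add: good_def)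

text \<open>The strict inclusion of supports makes the support of \<open>v\<close> equal to that of
  \<open>b\<close>, and then the BP condition leaves only \<open>u = wo (sp b - {s})\<close>. Were
  \<open>s\<close> a right descent too, \<open>b\<close> would be maximal.\<close>

lemma nearly_maximal_good:
  assumes b: "nearly_maximal_elt G S b"
  obtains s where "good (sp b) s b" "s \<notin> DR b"
proof -
  obtain v u where g: "gBP b v u" and sub: "sp u \<subset> sp v"
    using b unfolding nearly_maximal_elt_def by blast
  have nm: "\<not> maximal_elt G S b" using b unfolding nearly_maximal_elt_def by blast
  obtain s where s: "s \<in> sp b" "v \<in> MR (sp b - {s})" "u \<in> W (sp b - {s})" "b = v \<otimes> u"
    "sp u = sp b - {s}" "sp v \<inter> (sp b - {s}) \<subseteq> DL u" "b \<in> carrier G" "s \<in> sp v"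
    using grassmannian_elim[OF g] .
  have JS: "sp b - {s} \<subseteq> S" using sp_subset s by blast
  have "sp b = sp v \<union> sp u" unfolding s(4) by (rule MR_sp[OF JS s(2,3)])
  then have spv: "sp v = sp b" using sub by auto
  have u: "u = wo (sp b - {s})" using wo_unique[OF s(3)] s(6) spv by auto
  obtain t where t: "good (sp v) t (v \<otimes> wo (sp v - {t}))" "sp u = sp b - {t}" "t \<in> sp b"
    using grassmannian_good[OF g] by metis
  have "sp b - {s} = sp b - {t}" using t(2) s(5) by simp
  then have "t = s" using s(1) t(3) by blast
  then have gd: "good (sp b) s b" using t(1) s(4) unfolding spv u by metis
  moreover have "s \<notin> DR b"
  proof
    assume "s \<in> DR b"
    then have d: "sp b \<subseteq> DR b" using goodD(5)[OF gd] by auto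
    have "maximal_elt G S b" unfolding maximal_elt_def
      using DR_spherical[OF s(7) d] wo_unique_right[OF W_sp[OF s(7)] sp_subset[OF s(7)] d] s(7) by simp
    then show False using nm by simp
  qed
  ultimately show thesis using that by blast
qed

lemma good_nearly_maximal:
  assumes g: "good B s b"
  shows "maximal_elt G S b \<or> nearly_maximal_elt G S b"
proof (cases "maximal_elt G S b")
  case False
  note gd = goodD[OF g]
  have one: "\<one> \<in> LM B" using LM_iff[OF gd(7)] DL_sp[of \<one>] by auto
  have "gBP b (b \<otimes> wo (B - {s})) (wo (B - {s}))"
    using good_grassmannian[OF g one] gd by simp
  moreover have "sp (wo (B - {s})) \<subset> sp (b \<otimes> wo (B - {s}))" using gd wo_sp[OF gd(9)] by auto
  ultimately show ?thesis unfolding nearly_maximal_elt_def using False gd by blast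
qed simp

subsection \<open>Complete BP decompositions\<close>

text \<open>Complete decompositions without lists or counting. The recursion starts at the identity,
  so the first factor is a Grassmannian step as well, whereas the list version asks for steps only
  from the second factor on and fixes the first one through the length.\<close>

inductive CB where
  CB_one: "CB \<one>"
| CB_step: "gBP w v u \<Longrightarrow> CB u \<Longrightarrow> CB w"

abbreviation dprod where "dprod xs \<equiv> desc_prod G xs"

lemma desc_prod_snoc: "set xs \<subseteq> carrier G \<Longrightarrow> x \<in> carrier G \<Longrightarrow>
   dprod (xs @ [x]) = x \<otimes> dprod xs"
  by (simp add: desc_prod_def)

lemma desc_prod_append: "set xs \<subseteq> carrier G \<Longrightarrow> set ys \<subseteq> carrier G \<Longrightarrow>
   dprod (xs @ ys) = dprod ys \<otimes> dprod xs"
  by (simp add: desc_prod_def wp_append)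

lemma desc_prod_Nil [simp]: "dprod [] = \<one>"
  by (simp add: desc_prod_def)

lemma desc_prod_carrier: "set xs \<subseteq> carrier G \<Longrightarrow> dprod xs \<in> carrier G"
  by (simp add: desc_prod_def)

lemma CB_carrier: "CB w \<Longrightarrow> w \<in> carrier G"
  by (induction rule: CB.induct) (auto elim: grassmannian_elim)

lemma grassmannian_card: "gBP w v u \<Longrightarrow> card (sp w) = Suc (card (sp u))"
  by (elim grassmannian_elim) (metis card_Suc_Diff1 sp_finite)

lemma CB_gen: "s \<in> S \<Longrightarrow> CB s"
proof -
  assume s: "s \<in> S"
  have "s \<in> MR {}" using MR_iff[of "{}" s] s by simp
  then have "gBP s s \<one>"
    unfolding grassmannian_BP_def BP_decomp_def parabolic_decomp_def using s W_one
    by (intro exI[of _ "{}"]) auto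
  then show "CB s" using CB_step CB_one by blast
qed

lemma complete_BP_CB: "complete_BP_decomp G S w vs \<Longrightarrow> CB w"
proof -
  assume c: "complete_BP_decomp G S w vs"
  then have vs: "set vs \<subseteq> carrier G" and w: "w = dprod vs" and l: "length vs = card (sp w)"
    and g: "\<And>i. 1 \<le> i \<Longrightarrow> i < length vs \<Longrightarrow>
       gBP (dprod (take (Suc i) vs)) (vs ! i) (dprod (take i vs))"
    by (auto simp: complete_BP_decomp_def)
  define P where "P i = dprod (take i vs)" for i
  have Pc: "P i \<in> carrier G" for i
    unfolding P_def using vs set_take_subset[of i vs] by (intro desc_prod_carrier) blast
  have Pn: "P (length vs) = w" by (simp add: P_def w)
  show "CB w"
  proof (cases "length vs = 0")
    case True
    then show ?thesis using w CB_one by simp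
  next
    case False
    have "card (sp (P i)) = card (sp (P 1)) + (i - 1)" if "1 \<le> i" "i \<le> length vs" for i
      using that
    proof (induction i rule: dec_induct)
      case (step n)
      then show ?case using grassmannian_card[OF g[of n]] by (auto simp: P_def)
    qed simp
    \<comment> \<open>Each step after the first factor adds one generator, and the final support has
      \<open>length vs\<close> elements; so the first factor is supported on a single
      generator.\<close>
    from this[of "length vs"] have "card (sp (P 1)) = 1" using False Pn l by simp
    then obtain s where s: "sp (P 1) = {s}" by (auto simp: card_1_singleton_iff)
    then have sS: "s \<in> S" using sp_subset[OF Pc[of 1]] by auto
    have "P 1 \<in> W {s}" using W_sp[OF Pc[of 1]] unfolding s .
    moreover have "P 1 \<noteq> \<one>" using s sp_one by (metis insert_not_empty)
    ultimately have "P 1 = s" using W_singleton[OF sS] by blast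
    then have P1: "CB (P 1)" using CB_gen[OF sS] by metis
    have "CB (P i)" if "1 \<le> i" "i \<le> length vs" for i
      using that
    proof (induction i rule: dec_induct)
      case (step n)
      then show ?case using CB_step[OF g[of n]] by (auto simp: P_def)
    qed (use P1 in simp)
    from this[of "length vs"] show ?thesis using False Pn by simp
  qed
qed

lemma CB_complete_BP: "CB w \<Longrightarrow> \<exists>vs. complete_BP_decomp G S w vs"
proof (induction rule: CB.induct)
  case CB_one
  show ?case by (rule exI[of _ "[]"]) (simp add: complete_BP_decomp_def)
next
  case (CB_step w v u)
  then obtain vs where vs: "complete_BP_decomp G S u vs" by blast
  have c: "set vs \<subseteq> carrier G" and u: "u = dprod vs" and l: "length vs = card (sp u)"
    and g: "\<And>i. 1 \<le> i \<Longrightarrow> i < length vs \<Longrightarrow>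
       gBP (dprod (take (Suc i) vs)) (vs ! i) (dprod (take i vs))"
    using vs by (auto simp: complete_BP_decomp_def)
  have v: "v \<in> carrier G" and w: "w = v \<otimes> u" using CB_step(1) by (auto elim: grassmannian_elim)
  have w': "w = dprod (vs @ [v])" using desc_prod_snoc[OF c v] u w by simp
  have "gBP (dprod (take (Suc i) (vs @ [v]))) ((vs @ [v]) ! i)
      (dprod (take i (vs @ [v])))" if i: "1 \<le> i" "i < length (vs @ [v])" for i
  proof (cases "i < length vs")
    case True
    then show ?thesis using g[of i] i by (simp add: nth_append)
  next
    case False
    then have "i = length vs" using i by simp
    then show ?thesis using CB_step(1) w' u by simp
  qed
  then have "complete_BP_decomp G S w (vs @ [v])"
    unfolding complete_BP_decomp_def using c v w' l grassmannian_card[OF CB_step(1)] by auto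
  then show ?case by blast
qed

lemma CB_iff: "CB w \<longleftrightarrow> w \<in> carrier G \<and> (\<exists>vs. complete_BP_decomp G S w vs)"
  using CB_complete_BP complete_BP_CB CB_carrier by blast

text \<open>Generators of \<open>K - P\<close> can be added one at a time, each by a Grassmannian BP step.\<close>

lemma CB_extend:
  assumes K: "sph K" and y: "y \<in> LM K" and yK: "sp y \<inter> K \<subseteq> P" and P: "P \<subseteq> K" and CB: "CB (wo P \<otimes> y)"
  shows "CB (wo K \<otimes> y)"
proof -
  have KS: "K \<subseteq> S" using sphD[OF K] .
  have fin: "finite K" using sp_finite[of "wo K"] wo_sp[OF K] wo_carrier[OF K] by simp
  have "P \<subseteq> L \<Longrightarrow> L \<subseteq> K \<Longrightarrow> CB (wo L \<otimes> y)" for L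
  proof (induction "card (L - P)" arbitrary: L)
    case 0
    then have "L = P" using fin by (metis Diff_eq_empty_iff card_0_eq finite_Diff finite_subset subset_antisym)
    then show ?case using CB by simp
  next
    case (Suc n)
    then have "L - P \<noteq> {}" by auto
    then obtain t where t: "t \<in> L" "t \<notin> P" by blast
    let ?L = "L - {t}"
    have "card (?L - P) = n" using Suc t by (metis Diff_iff Diff_insert Diff_insert2 card_Diff_singleton diff_Suc_1 singleton_iff)
    then have IH: "CB (wo ?L \<otimes> y)" using Suc t by blast
    have LK: "L \<subseteq> K" "?L \<subseteq> K" using Suc by auto
    have sL: "sph L" using sph_subset[OF K] LK by blast
    have "gBP (wo L \<otimes> y) (wo L \<otimes> wo ?L) (wo ?L \<otimes> y)"
      by (rule grassmannianI[OF wo_carrier[OF sL] wo_sp[OF sL] t(1) _ LM_mono[OF LK(1) KS y]])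
        (use wo_DR[OF sL] t yK LK in auto)
    then show ?case using CB_step IH by blast
  qed
  then show ?thesis using P by blast
qed

section \<open>Independence of the product from the linear extension\<close>

lemma desc_prod_commute:
  assumes "x \<in> carrier G" "set ys \<subseteq> carrier G" "\<And>y. y \<in> set ys \<Longrightarrow> x \<otimes> y = y \<otimes> x"
  shows "x \<otimes> dprod ys = dprod ys \<otimes> x"
  using assms(2,3)
proof (induction ys rule: rev_induct)
  case (snoc y ys)
  then have c: "dprod ys \<in> carrier G" "y \<in> carrier G" using desc_prod_carrier by auto
  have IH: "x \<otimes> dprod ys = dprod ys \<otimes> x" and xy: "x \<otimes> y = y \<otimes> x" using snoc by auto
  have "x \<otimes> (y \<otimes> dprod ys) = x \<otimes> y \<otimes> dprod ys" using c assms(1) by (simp add: m_assoc)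
  also have "\<dots> = y \<otimes> (x \<otimes> dprod ys)" unfolding xy using c assms(1) by (simp add: m_assoc)
  also have "\<dots> = y \<otimes> dprod ys \<otimes> x" unfolding IH using c assms(1) by (simp add: m_assoc)
  finally show ?case using snoc desc_prod_snoc[of ys y] by simp
qed (use assms(1) in simp)

text \<open>Let \<open>X\<close> be the last element of one list. Whatever follows \<open>X\<close>
  in the other list is incomparable to \<open>X\<close>, so the factors commute and \<open>X\<close>
  may be moved to the end there too.\<close>

lemma desc_prod_linear_extension:
  assumes "\<And>X. X \<in> D \<Longrightarrow> f X \<in> carrier G"
    and "\<And>X Y. X \<in> D \<Longrightarrow> Y \<in> D \<Longrightarrow> (X, Y) \<notin> r \<Longrightarrow> (Y, X) \<notin> r \<Longrightarrow> f X \<otimes> f Y = f Y \<otimes> f X"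
    and "linear_extension D r Bs" "linear_extension D r Cs"
  shows "dprod (map f Bs) = dprod (map f Cs)"
  using assms
proof (induction Bs arbitrary: D Cs rule: rev_induct)
  case Nil
  then have "Cs = []" by (simp add: linear_extension_def)
  then show ?case by simp
next
  case (snoc X Bs)
  have B: "set (Bs @ [X]) = D" "distinct (Bs @ [X])" "sorted_wrt (\<lambda>x y. (y, x) \<notin> r) (Bs @ [X])"
    and C: "set Cs = D" "distinct Cs" "sorted_wrt (\<lambda>x y. (y, x) \<notin> r) Cs"
    using snoc.prems(3,4) by (auto simp: linear_extension_sorted)
  then obtain C1 C2 where Cs: "Cs = C1 @ X # C2" using split_list[of X Cs] by auto
  have X: "X \<in> D" "set C1 \<subseteq> D" "set C2 \<subseteq> D" using B C Cs by auto
  have c: "f X \<in> carrier G" "set (map f C1) \<subseteq> carrier G" "set (map f C2) \<subseteq> carrier G" "set (map f Bs) \<subseteq> carrier G"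
    using snoc.prems(1) X B(1) by auto
  have comm: "f X \<otimes> f Y = f Y \<otimes> f X" if Y: "Y \<in> set C2" for Y
  proof (rule snoc.prems(2))
    show "(Y, X) \<notin> r" using C Cs Y by (auto simp: sorted_wrt_append)
    have "Y \<in> set Bs" using Y C Cs B by auto
    then show "(X, Y) \<notin> r" using B by (auto simp: sorted_wrt_append)
  qed (use X Y in auto)
  have l1: "linear_extension (D - {X}) r (C1 @ C2)" and l2: "linear_extension (D - {X}) r Bs"
    using B C Cs by (auto simp: linear_extension_sorted sorted_wrt_append)
  have IH: "dprod (map f Bs) = dprod (map f (C1 @ C2))"
    by (rule snoc.IH[OF _ _ l2 l1]) (use snoc.prems(1,2) in auto)
  have d: "dprod (map f C1) \<in> carrier G" "dprod (map f C2) \<in> carrier G"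
    using c desc_prod_carrier by blast+
  have "dprod (map f Cs) = dprod ((map f C1 @ [f X]) @ map f C2)" by (simp add: Cs)
  also have "\<dots> = dprod (map f C2) \<otimes> (f X \<otimes> dprod (map f C1))"
    using c by (subst desc_prod_append) (auto simp: desc_prod_snoc)
  also have "\<dots> = f X \<otimes> dprod (map f C2) \<otimes> dprod (map f C1)"
  proof -
    have "f X \<otimes> dprod (map f C2) = dprod (map f C2) \<otimes> f X"
      by (rule desc_prod_commute) (use comm c in auto)
    then show ?thesis using c d by (metis m_assoc)
  qed
  also have "\<dots> = f X \<otimes> dprod (map f (C1 @ C2))"
    using c d desc_prod_append[of "map f C1" "map f C2"] by (simp add: m_assoc)
  also have "\<dots> = dprod (map f (Bs @ [X]))" using IH c by (simp add: desc_prod_snoc)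
  finally show ?case by simp
qed

subsection \<open>Staircase diagrams\<close>

abbreviation staircase where "staircase D r \<equiv> staircase_diagram G S D r"

text \<open>Collects the two situations, a common generator or an edge, in which the chain
  conditions force two blocks to be comparable. For nonempty connected sets it amounts to
  connectedness of the union.\<close>

definition touch where "touch X Y \<longleftrightarrow> X \<inter> Y \<noteq> {} \<or> (\<exists>s\<in>X. \<exists>t\<in>Y. adj s t)"

lemma touch_sym: "touch X Y \<Longrightarrow> touch Y X"
  unfolding touch_def using adj_sym by blast

lemma conn_union_touch: "conn (X \<union> Y) \<Longrightarrow> X \<noteq> {} \<Longrightarrow> Y \<noteq> {} \<Longrightarrow> touch X Y"
proof -
  assume c: "conn (X \<union> Y)" and "X \<noteq> {}" "Y \<noteq> {}"
  then obtain x y where x: "x \<in> X" and y: "y \<in> Y" by blast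
  show "touch X Y"
  proof (cases "y \<in> X")
    case False
    obtain p q where "p \<in> X" "q \<in> X \<union> Y" "q \<notin> X" "adj p q"
      using conn_step[OF c UnI1[OF x] x UnI2[OF y] False] .
    then show ?thesis unfolding touch_def by blast
  qed (use y in \<open>auto simp: touch_def\<close>)
qed

lemma conn_union: "conn X \<Longrightarrow> conn Y \<Longrightarrow> touch X Y \<Longrightarrow> conn (X \<union> Y)"
proof (rule connI)
  fix Z x y
  assume X: "conn X" and Y: "conn Y" and t: "touch X Y"
    and Z: "x \<in> X \<union> Y" "x \<in> Z" "Z \<subseteq> X \<union> Y" "y \<in> X \<union> Y" "y \<notin> Z"
  show "\<exists>p\<in>Z. \<exists>q\<in>X \<union> Y - Z. adj p q"
  proof (rule ccontr)
    assume n: "\<not> ?thesis"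
    have one: "X \<subseteq> Z \<or> X \<inter> Z = {}" using conn_step[OF X, of _ Z] n by blast
    have two: "Y \<subseteq> Z \<or> Y \<inter> Z = {}" using conn_step[OF Y, of _ Z] n by blast
    show False using one two t n Z adj_sym unfolding touch_def by blast
  qed
qed

lemma staircaseD:
  assumes "staircase D r"
  shows "finite D" "partial_order_on D r" "\<And>B. B \<in> D \<Longrightarrow> B \<noteq> {}" "\<And>B. B \<in> D \<Longrightarrow> B \<subseteq> S"
    "\<And>B. B \<in> D \<Longrightarrow> conn B" "\<And>B B'. covers D r B B' \<Longrightarrow> conn (B \<union> B')"
    "\<And>X Y. X \<in> D \<Longrightarrow> Y \<in> D \<Longrightarrow> touch X Y \<Longrightarrow> (X, Y) \<in> r \<or> (Y, X) \<in> r"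
    "\<And>s t X Y Z. adj s t \<Longrightarrow> X \<in> D \<Longrightarrow> Y \<in> D \<Longrightarrow> Z \<in> D \<Longrightarrow> s \<in> X \<Longrightarrow> s \<in> Y \<Longrightarrow> t \<in> Z \<Longrightarrow>
       (X, Z) \<in> r \<Longrightarrow> (Z, Y) \<in> r \<Longrightarrow> s \<in> Z"
    "\<And>B. B \<in> D \<Longrightarrow> \<exists>s\<in>B. \<forall>X\<in>D. s \<in> X \<longrightarrow> (B, X) \<in> r"
    "\<And>B. B \<in> D \<Longrightarrow> \<exists>s\<in>B. \<forall>X\<in>D. s \<in> X \<longrightarrow> (X, B) \<in> r"
proof -
  have d1: "finite D" and d2: "partial_order_on D r" and d3: "\<forall>B\<in>D. B \<noteq> {} \<and> B \<subseteq> S"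
    and d4: "\<forall>B\<in>D. conn B" and d5: "\<forall>B B'. covers D r B B' \<longrightarrow> conn (B \<union> B')"
    and d6: "\<forall>s\<in>S. blocks_at D s \<in> Chains r"
    and d7: "\<forall>s t. adj s t \<longrightarrow> blocks_at D s \<union> blocks_at D t \<in> Chains r \<and>
        saturated_in r (blocks_at D s \<union> blocks_at D t) (blocks_at D s) \<and>
        saturated_in r (blocks_at D s \<union> blocks_at D t) (blocks_at D t)"
    and d8: "\<forall>B\<in>D. (\<exists>s\<in>S. is_minimum r (blocks_at D s) B) \<and> (\<exists>s\<in>S. is_maximum r (blocks_at D s) B)"
    using assms unfolding staircase_diagram_def by - (elim conjE, assumption)+
  show "finite D" "partial_order_on D r" "\<And>B. B \<in> D \<Longrightarrow> B \<noteq> {}" "\<And>B. B \<in> D \<Longrightarrow> B \<subseteq> S"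
    "\<And>B. B \<in> D \<Longrightarrow> conn B" "\<And>B B'. covers D r B B' \<Longrightarrow> conn (B \<union> B')"
    using d1 d2 d3 d4 d5 by simp_all
  show "\<exists>s\<in>B. \<forall>X\<in>D. s \<in> X \<longrightarrow> (B, X) \<in> r" if "B \<in> D" for B
    using bspec[OF d8 that] unfolding is_minimum_def blocks_at_def by blast
  show "\<exists>s\<in>B. \<forall>X\<in>D. s \<in> X \<longrightarrow> (X, B) \<in> r" if "B \<in> D" for B
    using bspec[OF d8 that] unfolding is_maximum_def blocks_at_def by blast
  have ch: "(X, Y) \<in> r \<or> (Y, X) \<in> r" if "adj s t \<or> s = t" "X \<in> D" "Y \<in> D" "s \<in> X" "t \<in> Y" "s \<in> S" for s t X Y
  proof -
    have "blocks_at D s \<union> blocks_at D t \<in> Chains r" using d6 d7 that(1,6) by auto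
    then show ?thesis using that unfolding Chains_def blocks_at_def by blast
  qed
  show "(X, Y) \<in> r \<or> (Y, X) \<in> r" if "X \<in> D" "Y \<in> D" "touch X Y" for X Y
  proof -
    from that(3) obtain s t where "s \<in> X" "t \<in> Y" "adj s t \<or> s = t" unfolding touch_def by blast
    moreover from this d3 that(1) have "s \<in> S" by blast
    ultimately show ?thesis using ch[of s t X Y] that(1,2) by blast
  qed
  show "s \<in> Z" if "adj s t" "X \<in> D" "Y \<in> D" "Z \<in> D" "s \<in> X" "s \<in> Y" "t \<in> Z" "(X, Z) \<in> r" "(Z, Y) \<in> r"
    for s t X Y Z
  proof -
    have "saturated_in r (blocks_at D s \<union> blocks_at D t) (blocks_at D s)" using d7 that(1) by simp
    then show ?thesis using that unfolding saturated_in_def blocks_at_def by blast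
  qed
qed

lemma staircaseI:
  assumes "finite D" "partial_order_on D r" "\<And>B. B \<in> D \<Longrightarrow> B \<noteq> {}" "\<And>B. B \<in> D \<Longrightarrow> B \<subseteq> S"
    "\<And>B. B \<in> D \<Longrightarrow> conn B" "\<And>B B'. covers D r B B' \<Longrightarrow> conn (B \<union> B')"
    and ch: "\<And>X Y. X \<in> D \<Longrightarrow> Y \<in> D \<Longrightarrow> touch X Y \<Longrightarrow> (X, Y) \<in> r \<or> (Y, X) \<in> r"
    and sat: "\<And>s t X Y Z. adj s t \<Longrightarrow> X \<in> D \<Longrightarrow> Y \<in> D \<Longrightarrow> Z \<in> D \<Longrightarrow> s \<in> X \<Longrightarrow> s \<in> Y \<Longrightarrow> t \<in> Z \<Longrightarrow>
       (X, Z) \<in> r \<Longrightarrow> (Z, Y) \<in> r \<Longrightarrow> s \<in> Z"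
    and mi: "\<And>B. B \<in> D \<Longrightarrow> \<exists>s\<in>B. \<forall>X\<in>D. s \<in> X \<longrightarrow> (B, X) \<in> r"
    and ma: "\<And>B. B \<in> D \<Longrightarrow> \<exists>s\<in>B. \<forall>X\<in>D. s \<in> X \<longrightarrow> (X, B) \<in> r"
  shows "staircase D r"
proof -
  have c1: "blocks_at D s \<in> Chains r" for s
    using ch unfolding Chains_def blocks_at_def touch_def by blast
  have c2: "blocks_at D s \<union> blocks_at D t \<in> Chains r" if "adj s t" for s t
    using ch that adj_sym[OF that] unfolding Chains_def blocks_at_def touch_def by blast
  have s1: "saturated_in r (blocks_at D s \<union> blocks_at D t) (blocks_at D s)" if "adj s t" for s t
    unfolding saturated_in_def blocks_at_def using sat[OF that] by blast
  have s2: "saturated_in r (blocks_at D s \<union> blocks_at D t) (blocks_at D t)" if "adj s t" for s t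
    using s1[OF adj_sym[OF that]] by (simp add: Un_commute)
  have m1: "\<exists>s\<in>S. is_minimum r (blocks_at D s) B" if "B \<in> D" for B
    using mi[OF that] assms(4)[OF that] that unfolding is_minimum_def blocks_at_def by blast
  have m2: "\<exists>s\<in>S. is_maximum r (blocks_at D s) B" if "B \<in> D" for B
    using ma[OF that] assms(4)[OF that] that unfolding is_maximum_def blocks_at_def by blast
  show ?thesis unfolding staircase_diagram_def
  proof (intro conjI ballI allI impI)
    show "finite D" "partial_order_on D r" by fact+
  qed (use assms(3-6) c1 c2 s1 s2 m1 m2 in simp_all)
qed

lemma orderD:
  assumes "staircase D r"
  shows "\<And>X. X \<in> D \<Longrightarrow> (X, X) \<in> r" "\<And>X Y Z. (X, Y) \<in> r \<Longrightarrow> (Y, Z) \<in> r \<Longrightarrow> (X, Z) \<in> r"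
    "\<And>X Y. (X, Y) \<in> r \<Longrightarrow> (Y, X) \<in> r \<Longrightarrow> X = Y" "\<And>X Y. (X, Y) \<in> r \<Longrightarrow> X \<in> D \<and> Y \<in> D"
  using staircaseD(2)[OF assms]
  by (auto simp: partial_order_on_def preorder_on_def refl_on_def dest: transD antisymD)

lemma JR_iff: "staircase D r \<Longrightarrow> B \<in> D \<Longrightarrow> t \<in> J_R D r B \<longleftrightarrow> t \<in> B \<and> (\<exists>X\<in>D. t \<in> X \<and> (B, X) \<notin> r)"
  unfolding J_R_def is_minimum_def blocks_at_def by blast

lemma JL_iff: "staircase D r \<Longrightarrow> B \<in> D \<Longrightarrow> t \<in> J_L D r B \<longleftrightarrow> t \<in> B \<and> (\<exists>X\<in>D. t \<in> X \<and> (X, B) \<notin> r)"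
  unfolding J_L_def is_maximum_def blocks_at_def by blast

lemma obtain_top:
  assumes "staircase D r" "D \<noteq> {}"
  obtains B where "topmost D r B"
proof -
  from assms(2) obtain x where "x \<in> D" by blast
  from finite_maximal_above[OF staircaseD(1,2)[OF assms(1)] order.refl this] that show thesis
    unfolding topmost_def by metis
qed

lemma obtain_max_at:
  assumes st: "staircase D r" and t: "t \<in> \<Union>D"
  obtains Y where "Y \<in> D" "t \<in> Y" "\<And>X. X \<in> D \<Longrightarrow> t \<in> X \<Longrightarrow> (X, Y) \<in> r"
proof -
  let ?C = "{X \<in> D. t \<in> X}"
  from t obtain x where "x \<in> ?C" by blast
  from finite_maximal_above[OF staircaseD(1,2)[OF st] _ this]
  obtain y where y: "y \<in> ?C" "\<And>z. z \<in> ?C \<Longrightarrow> (y, z) \<in> r \<Longrightarrow> z = y" by blast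
  have "(X, y) \<in> r" if "X \<in> D" "t \<in> X" for X
  proof -
    have "touch X y" using that y unfolding touch_def by blast
    then show ?thesis using staircaseD(7)[OF st, of X y] y that orderD(1)[OF st] by blast
  qed
  then show thesis using that y by blast
qed

abbreviation rest where "rest r D \<equiv> r \<inter> D \<times> D"

lemma staircase_remove:
  assumes st: "staircase D r" and B: "topmost D r B"
  shows "staircase (D - {B}) (rest r (D - {B}))"
proof (rule staircaseI)
  let ?E = "D - {B}"
  note d = staircaseD[OF st]
  show "finite ?E" "partial_order_on ?E (rest r ?E)" using d(1) partial_order_restrict[OF d(2), of ?E] by auto
  \<comment> \<open>A cover in the smaller diagram stays a cover, because the topmost
    \<open>B\<close> cannot come between two other blocks.\<close>
  show "conn (X \<union> Y)" if "covers ?E (rest r ?E) X Y" for X Y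
  proof (rule d(6))
    show "covers D r X Y" using that B unfolding covers_def topmost_def by blast
  qed
  show "\<exists>s\<in>X. \<forall>Y\<in>?E. s \<in> Y \<longrightarrow> (X, Y) \<in> rest r ?E" if "X \<in> ?E" for X
    using d(9)[of X] that by blast
  show "\<exists>s\<in>X. \<forall>Y\<in>?E. s \<in> Y \<longrightarrow> (Y, X) \<in> rest r ?E" if "X \<in> ?E" for X
    using d(10)[of X] that by blast
  show "(X, Y) \<in> rest r ?E \<or> (Y, X) \<in> rest r ?E" if "X \<in> ?E" "Y \<in> ?E" "touch X Y" for X Y
    using d(7)[of X Y] that by blast
  show "s \<in> Z" if "adj s t" "X \<in> ?E" "Y \<in> ?E" "Z \<in> ?E" "s \<in> X" "s \<in> Y" "t \<in> Z"
     "(X, Z) \<in> rest r ?E" "(Z, Y) \<in> rest r ?E" for s t X Y Z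
    using d(8)[of s t X Y Z] that by blast
qed (use staircaseD[OF st] in auto)

lemma below_topmost:
  assumes st: "staircase D r" and B: "topmost D r B" and X: "X \<in> D" and t: "touch X B"
  shows "(X, B) \<in> r"
proof -
  have BD: "B \<in> D" using B by (simp add: topmost_def)
  show ?thesis
  proof (cases "(X, B) \<in> r")
    case False
    then have "(B, X) \<in> r" using staircaseD(7)[OF st X BD t] by simp
    then have "X = B" using B X by (simp add: topmost_def)
    then show ?thesis using orderD(1)[OF st BD] by simp
  qed
qed

text \<open>A block on top never affects which block is the minimum at a generator of
  \<open>X\<close>. Hence the factors \<open>bar\<close> of the remaining blocks are unchanged,
  while \<open>J_L\<close> may shrink.\<close>

lemma JR_remove:
  assumes st: "staircase D r" and B: "topmost D r B" and X: "X \<in> D - {B}"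
  shows "J_R (D - {B}) (rest r (D - {B})) X = J_R D r X"
proof (rule Set.set_eqI)

  fix t
  have XD: "X \<in> D" using X by simp
  have "(X, B) \<in> r" if "t \<in> X" "t \<in> B"
    by (rule below_topmost[OF st B XD]) (use that in \<open>auto simp: touch_def\<close>)
  then show "t \<in> J_R (D - {B}) (rest r (D - {B})) X \<longleftrightarrow> t \<in> J_R D r X"
    unfolding JR_iff[OF st XD] JR_iff[OF staircase_remove[OF st B] X] using X by auto
qed

lemma JL_remove_sub:
  assumes st: "staircase D r" and B: "topmost D r B" and X: "X \<in> D - {B}"
  shows "J_L (D - {B}) (rest r (D - {B})) X \<subseteq> J_L D r X" "X \<inter> B \<subseteq> J_L D r X"
proof -
  show "J_L (D - {B}) (rest r (D - {B})) X \<subseteq> J_L D r X" 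
    using JL_iff[OF st, of X] JL_iff[OF staircase_remove[OF st B] X] X by auto
  have "(B, X) \<notin> r" using B X unfolding topmost_def by blast
  then show "X \<inter> B \<subseteq> J_L D r X" using JL_iff[OF st, of X] X B unfolding topmost_def by blast
qed

lemma JR_top: "staircase D r \<Longrightarrow> topmost D r B \<Longrightarrow> J_R D r B = B \<inter> \<Union>(D - {B})"
proof (rule Set.set_eqI)
  fix t
  assume st: "staircase D r" and B: "topmost D r B"
  have BD: "B \<in> D" using B by (simp add: topmost_def)
  have "(B, X) \<in> r \<longleftrightarrow> X = B" if "X \<in> D" for X
    using B that orderD(1)[OF st BD] by (auto simp: topmost_def)
  then show "t \<in> J_R D r B \<longleftrightarrow> t \<in> B \<inter> \<Union>(D - {B})" unfolding JR_iff[OF st BD] by auto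
qed

lemma JL_top: "staircase D r \<Longrightarrow> topmost D r B \<Longrightarrow> J_L D r B = {}"
proof -
  assume st: "staircase D r" and B: "topmost D r B"
  have BD: "B \<in> D" using B by (simp add: topmost_def)
  have "(X, B) \<in> r" if "X \<in> D" "t \<in> X" "t \<in> B" for X t
    by (rule below_topmost[OF st B that(1)]) (use that in \<open>auto simp: touch_def\<close>)
  then show ?thesis using JL_iff[OF st BD] by auto
qed

text \<open>A maximal block among those above \<open>X\<close> and strictly below \<open>B\<close>
  is covered by \<open>B\<close>, and covers have connected union.\<close>

lemma below_top:
  assumes st: "staircase D r" and X: "(X, B) \<in> r" "X \<noteq> B"
  obtains Y where "Y \<in> D" "Y \<noteq> B" "(X, Y) \<in> r" "(Y, B) \<in> r" "touch Y B"
proof -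
  note o = orderD[OF st]
  let ?C = "{Y \<in> D. Y \<noteq> B \<and> (Y, B) \<in> r}"
  have XC: "X \<in> ?C" using X o by blast
  obtain Y where Y: "Y \<in> ?C" "(X, Y) \<in> r" "\<And>Z. Z \<in> ?C \<Longrightarrow> (Y, Z) \<in> r \<Longrightarrow> Z = Y"
    using finite_maximal_above[OF staircaseD(1,2)[OF st] _ XC] by blast
  have "B \<in> D" using X o by blast
  then have "covers D r B Y" using Y unfolding covers_def by blast
  then have "conn (Y \<union> B)" using staircaseD(6)[OF st] by (metis Un_commute)
  then have "touch Y B" using conn_union_touch staircaseD(3)[OF st] Y \<open>B \<in> D\<close> by blast
  then show thesis using that Y by blast
qed

text \<open>Every relation below \<open>B\<close> passes through a block touching \<open>B\<close>,
  and such a block must lie below \<open>B\<close> in \<open>q\<close> as well as in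
  \<open>r\<close>. A topmost block thus leaves no choice of order.\<close>

lemma top_order_determined:
  assumes r: "staircase D r" "topmost D r B" and q: "staircase D q" "topmost D q B"
    and e: "rest r (D - {B}) = rest q (D - {B})"
  shows "r \<subseteq> q"
proof (rule subrelI)
  fix X Y assume XY: "(X, Y) \<in> r"
  then have D: "X \<in> D" "Y \<in> D" using orderD(4)[OF r(1)] by blast+
  consider "X = Y" | "X = B" "Y \<noteq> B" | "X \<noteq> B" "Y \<noteq> B" | "X \<noteq> B" "Y = B" by blast
  then show "(X, Y) \<in> q"
  proof cases
    case 1
    then show ?thesis using orderD(1)[OF q(1)] D by blast
  next
    case 2
    then show ?thesis using r(2) D XY unfolding topmost_def by blast
  next
    case 3
    then show ?thesis using e XY D by blast
  next
    case 4
    then obtain Z where Z: "Z \<in> D" "Z \<noteq> B" "(X, Z) \<in> r" "touch Z B"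
      using below_top[OF r(1)] XY by metis
    then have "(X, Z) \<in> q" using e 4 D by blast
    moreover have "(Z, B) \<in> q"
      using staircaseD(7)[OF q(1) Z(1) _ Z(4)] q(2) Z unfolding topmost_def by blast
    ultimately show ?thesis using orderD(2)[OF q(1)] 4 by blast
  qed
qed

subsection \<open>Nearly-maximal labellings\<close>

text \<open>Working form of a diagram with a nearly-maximal labelling, from which sphericity and
  both support conditions follow. Taking \<open>s\<close> outside \<open>J_R\<close> lets
  \<open>wo (J_R D r B)\<close> be absorbed by the longest element for
  \<open>B - {s}\<close>.\<close>

definition stair where
  "stair D r lam \<longleftrightarrow> staircase D r \<and> lam \<in> extensional D \<and>
     (\<forall>B\<in>D. J_L D r B \<subseteq> DL (lam B) \<and> (\<exists>s\<in>B - J_R D r B. good B s (lam B)))"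

lemma stairD:
  assumes "stair D r lam"
  shows "staircase D r" "lam \<in> extensional D" "\<And>B. B \<in> D \<Longrightarrow> J_L D r B \<subseteq> DL (lam B)"
    "\<And>B. B \<in> D \<Longrightarrow> \<exists>s\<in>B - J_R D r B. good B s (lam B)"
  using assms unfolding stair_def by blast+

text \<open>For the last claim, with \<open>P = J_R D r B\<close> and \<open>K = B - {s}\<close>,
  insert \<open>wo K\<close> twice: \<open>lam B wo P\<close> is the length additive product of
  \<open>lam B wo K\<close>, whose support is already \<open>B\<close>, and
  \<open>wo K wo P\<close>.\<close>

lemma good_label:
  assumes st: "stair D r lam" and B: "B \<in> D"
  shows "lam B \<in> carrier G" "sp (lam B) = B" "sph (J_R D r B)" "J_R D r B \<subseteq> DR (lam B)" "J_R D r B \<subseteq> B"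
    "sp (lam B \<otimes> wo (J_R D r B)) = B"
proof -
  let ?P = "J_R D r B"
  obtain s where s: "s \<in> B - ?P" "good B s (lam B)" using stairD(4)[OF st B] by blast
  note gd = goodD[OF s(2)]
  show P: "?P \<subseteq> B" unfolding J_R_def by blast
  then have PK: "?P \<subseteq> B - {s}" using s by blast
  show b: "lam B \<in> carrier G" "sp (lam B) = B" using gd by blast+
  show sP: "sph ?P" using sph_subset[OF gd(9) PK] .
  show "?P \<subseteq> DR (lam B)" using PK gd(5) by blast
  let ?K = "B - {s}"
  have KS: "?K \<subseteq> S" using gd(7) by blast
  have kW: "wo ?K \<otimes> wo ?P \<in> W ?K" using W_mult[OF wo_W[OF gd(9)] W_mono[OF PK wo_W[OF sP]]] .
  have "lam B \<otimes> wo ?P = (lam B \<otimes> wo ?K) \<otimes> (wo ?K \<otimes> wo ?P)"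
    using b gd(9) sP by (simp add: m_assoc wo_cancel)
  then have "sp (lam B \<otimes> wo ?P) = sp (lam B \<otimes> wo ?K) \<union> sp (wo ?K \<otimes> wo ?P)"
    using MR_sp[OF KS gd(10) kW] by simp
  then show "sp (lam B \<otimes> wo ?P) = B" using gd(6) W_spD[OF KS kW] by blast
qed

text \<open>For a maximal label, \<open>s\<close> is a generator at which \<open>B\<close> is the
  minimum; for a nearly maximal one it is the non-descent in \<open>B\<close>, which
  \<open>J_R\<close> has to avoid. Conversely, the left support condition is rigidity, as
  \<open>J_L\<close> misses a generator at which \<open>B\<close> is the maximum.\<close>

lemma stair_iff:
  assumes st: "staircase D r"
  shows "nearly_maximal_labelling G S D r lam \<longleftrightarrow> stair D r lam"
proof
  assume n: "nearly_maximal_labelling G S D r lam"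
  then have l: "lam \<in> D \<rightarrow>\<^sub>E carrier G" and
    L: "\<And>B. B \<in> D \<Longrightarrow> sph (J_R D r B) \<and> J_R D r B \<subseteq> DR (lam B) \<and> J_L D r B \<subseteq> DL (lam B) \<and>
       sp (lam B \<otimes> wo (J_R D r B)) = B"
    and M: "\<And>B. B \<in> D \<Longrightarrow> maximal_elt G S (lam B) \<or> nearly_maximal_elt G S (lam B)"
    unfolding nearly_maximal_labelling_def labelling_def by simp_all
  have "\<exists>s\<in>B - J_R D r B. good B s (lam B)" if B: "B \<in> D" for B
  proof -
    let ?P = "J_R D r B" and ?b = "lam B"
    have b: "?b \<in> carrier G" using l B by auto
    have PB: "?P \<subseteq> B" unfolding J_R_def by blast
    have c: "conn B" and BS: "B \<subseteq> S" using staircaseD[OF st] B by blast+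
    have P: "sph ?P" "?P \<subseteq> DR ?b" "sp (?b \<otimes> wo ?P) = B" using L[OF B] by blast+
    have "?b = (?b \<otimes> wo ?P) \<otimes> wo ?P" using b P by (simp add: wo_cancel_right)
    then have "sp ?b = sp (?b \<otimes> wo ?P) \<union> sp (wo ?P)"
      using MR_sp[OF _ DR_decomp(1)[OF b P(2)] wo_W[OF P(1)]] PB BS by (metis subset_trans)
    then have spb: "sp ?b = B" using P(3) wo_sp[OF P(1)] PB by blast
    from M[OF B] show ?thesis
    proof
      assume "maximal_elt G S ?b"
      then have m: "sph B" "?b = wo B" unfolding maximal_elt_def spb by blast+
      obtain s where s: "s \<in> B" "\<forall>X\<in>D. s \<in> X \<longrightarrow> (B, X) \<in> r" using staircaseD(9)[OF st B] by blast
      then have "s \<notin> ?P" using JR_iff[OF st B] by blast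
      then show ?thesis using good_maximal[OF c m(1) s(1)] m(2) s(1) by auto
    next
      assume "nearly_maximal_elt G S ?b"
      then obtain s where s: "good B s ?b" "s \<notin> DR ?b" using nearly_maximal_good[of ?b] spb by metis
      then show ?thesis using P(2) goodD(3)[OF s(1)] by blast
    qed
  qed
  then show "stair D r lam" unfolding stair_def using st l L by (auto simp: PiE_def)
next
  assume s: "stair D r lam"
  have "sph (J_L D r B) \<and> sp (wo (J_L D r B) \<otimes> lam B) = B" if B: "B \<in> D" for B
  proof -
    let ?J = "J_L D r B"
    obtain t where t: "good B t (lam B)" using stairD(4)[OF s B] by blast
    note gd = goodD[OF t]
    have J: "?J \<subseteq> DL (lam B)" using stairD(3)[OF s B] .
    have sJ: "sph ?J" using DL_spherical[OF gd(2) J] .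
    obtain q where q: "q \<in> B" "\<forall>X\<in>D. q \<in> X \<longrightarrow> (X, B) \<in> r" using staircaseD(10)[OF st B] by blast
    then have "q \<notin> ?J" using JL_iff[OF st B] by blast
    then have JB: "?J \<subset> B" using q(1) unfolding J_L_def by blast
    have "sp (wo ?J \<otimes> lam B) = B"
      by (rule good_left_factor_full[OF t JB wo_W[OF sJ] DL_decomp(1)[OF gd(2) J]])
        (use gd(2) sJ in \<open>simp add: wo_cancel\<close>)
    then show ?thesis using sJ by blast
  qed
  moreover have "maximal_elt G S (lam B) \<or> nearly_maximal_elt G S (lam B)" if "B \<in> D" for B
    using stairD(4)[OF s that] good_nearly_maximal by blast
  ultimately show "nearly_maximal_labelling G S D r lam"
    unfolding nearly_maximal_labelling_def labelling_def PiE_def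
    using good_label[OF s] stairD(2,3)[OF s] by auto
qed

lemma stair_remove:
  assumes st: "stair D r lam" and B: "topmost D r B"
  shows "stair (D - {B}) (rest r (D - {B})) (restrict lam (D - {B}))"
proof -
  let ?E = "D - {B}"
  have s: "staircase D r" using stairD(1)[OF st] .
  have "J_L ?E (rest r ?E) X \<subseteq> DL (restrict lam ?E X) \<and>
     (\<exists>s\<in>X - J_R ?E (rest r ?E) X. good X s (restrict lam ?E X))" if X: "X \<in> ?E" for X
    using JL_remove_sub(1)[OF s B X] JR_remove[OF s B X] stairD(3,4)[OF st, of X] X by auto
  then show ?thesis unfolding stair_def using staircase_remove[OF s B] by auto
qed

section \<open>The product of a labelled diagram\<close>

abbreviation bar where "bar D r lam B \<equiv> bar_label G S D r lam B"
abbreviation Lam where "Lam D r lam \<equiv> Lambda G S D r lam"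

lemma bar_W: "stair D r lam \<Longrightarrow> B \<in> D \<Longrightarrow> bar D r lam B \<in> W B"
  using good_label[of D r lam B] W_sp_sub[of "bar D r lam B" B] unfolding bar_label_def by simp

lemma bar_carrier: "stair D r lam \<Longrightarrow> B \<in> D \<Longrightarrow> bar D r lam B \<in> carrier G"
  using good_label[of D r lam B] unfolding bar_label_def by simp

text \<open>Incomparable blocks do not touch, so their factors commute; this gives the definite
  description in \<open>Lambda\<close> its meaning.\<close>

lemma Lam_eq:
  assumes st: "stair D r lam" and l: "linear_extension D r Bs"
  shows "Lam D r lam = dprod (map (bar D r lam) Bs)"
proof -
  have s: "staircase D r" using stairD(1)[OF st] .
  have *: "dprod (map (bar D r lam) Cs) = dprod (map (bar D r lam) Bs)"
    if "linear_extension D r Cs" for Cs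
  proof (rule desc_prod_linear_extension[OF _ _ that l])
    fix X Y assume X: "X \<in> D" and Y: "Y \<in> D" and "(X, Y) \<notin> r" "(Y, X) \<notin> r"
    then have "\<not> touch X Y" using staircaseD(7)[OF s] by blast
    then have n: "\<And>s t. s \<in> X \<Longrightarrow> t \<in> Y \<Longrightarrow> \<not> adj s t" unfolding touch_def by blast
    show "bar D r lam X \<otimes> bar D r lam Y = bar D r lam Y \<otimes> bar D r lam X"
      by (rule comm_WW[OF staircaseD(4)[OF s X] staircaseD(4)[OF s Y] bar_W[OF st X] bar_W[OF st Y] n])
  qed (rule bar_carrier[OF st])
  show ?thesis unfolding Lambda_def
    by (rule the_equality) (use * l in metis)+
qed

lemma Lam_empty: "stair {} r lam \<Longrightarrow> Lam {} r lam = \<one>"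
  using Lam_eq[of "{}" r lam "[]"] by (simp add: linear_extension_def)

lemma Lam_remove:
  assumes st: "stair D r lam" and B: "topmost D r B"
  shows "Lam D r lam = bar D r lam B \<otimes> Lam (D - {B}) (rest r (D - {B})) (restrict lam (D - {B}))"
proof -
  let ?E = "D - {B}"
  let ?q = "rest r ?E" and ?m = "restrict lam ?E"
  have s: "staircase D r" using stairD(1)[OF st] .
  have sE: "stair ?E ?q ?m" using stair_remove[OF st B] .
  obtain Bs where Bs: "linear_extension ?E ?q Bs"
    using linear_extension_exists staircaseD(1,2)[OF stairD(1)[OF sE]] by blast
  then have set: "set Bs = ?E" by (simp add: linear_extension_def)
  have "linear_extension ?E r Bs"
    using Bs unfolding linear_extension_def by (metis IntI SigmaI nth_mem)
  then have l: "linear_extension D r (Bs @ [B])" by (rule linear_extension_snoc[OF _ B])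
  have BD: "B \<in> D" using B unfolding topmost_def by blast
  have eq: "map (bar D r lam) Bs = map (bar ?E ?q ?m) Bs"
    using JR_remove[OF s B] set by (auto simp: bar_label_def)
  have "Lam D r lam = bar D r lam B \<otimes> dprod (map (bar D r lam) Bs)"
    unfolding Lam_eq[OF st l] using desc_prod_snoc[of "map (bar D r lam) Bs" "bar D r lam B"]
      bar_carrier[OF st] BD set by (auto simp: image_subset_iff)
  then show ?thesis unfolding eq Lam_eq[OF sE Bs] .
qed

subsection \<open>Left descents of a staircase product\<close>

definition max_at where
  "max_at D r t Y \<longleftrightarrow> Y \<in> D \<and> t \<in> Y \<and> (\<forall>X\<in>D. t \<in> X \<longrightarrow> (X, Y) \<in> r)"

text \<open>Combinatorial formula for the left descents of the product: no block with a neighbour of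
  \<open>t\<close> may block \<open>t\<close> from above, and the label of the highest block at
  \<open>t\<close> must have \<open>t\<close> as a descent.\<close>

definition exposed where
  "exposed D r lam t \<longleftrightarrow> t \<in> \<Union>D \<and> (\<forall>X\<in>D. \<forall>t'\<in>X. adj t t' \<longrightarrow> (\<exists>Y\<in>D. t \<in> Y \<and> (X, Y) \<in> r)) \<and>
     (\<forall>Y. max_at D r t Y \<longrightarrow> t \<in> DL (lam Y))"

lemma max_at_topmost:
  assumes st: "staircase D r" and A: "topmost D r A" and t: "t \<in> A"
  shows "max_at D r t Y \<longleftrightarrow> Y = A"
proof -
  have AD: "A \<in> D" using A by (simp add: topmost_def)
  have up: "(X, A) \<in> r" if "X \<in> D" "t \<in> X" for X
    by (rule below_topmost[OF st A that(1)]) (use that t in \<open>auto simp: touch_def\<close>)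
  show ?thesis
  proof
    assume "max_at D r t Y"
    then show "Y = A" using A AD t by (auto simp: max_at_def topmost_def)
  next
    assume "Y = A"
    then show "max_at D r t Y" using AD t up by (simp add: max_at_def)
  qed
qed

lemma max_at_remove:
  assumes "topmost D r A" "t \<notin> A"
  shows "max_at (D - {A}) (rest r (D - {A})) t Y \<longleftrightarrow> max_at D r t Y"
  using assms unfolding max_at_def topmost_def by auto

lemma not_covered_by_topmost:
  assumes st: "staircase D r" and A: "topmost D r A" and Y: "Y \<in> D - {A}"
  shows "\<not> Y \<subseteq> A"
proof
  assume YA: "Y \<subseteq> A"
  obtain t where t: "t \<in> Y" "\<forall>X\<in>D. t \<in> X \<longrightarrow> (X, Y) \<in> r" using staircaseD(10)[OF st, of Y] Y by auto
  then have "(A, Y) \<in> r" using YA A by (auto simp: topmost_def)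
  then show False using A Y by (auto simp: topmost_def)
qed

text \<open>A block with a neighbour of \<open>n\<close> that lies above the highest remaining block
  at \<open>n\<close> would lie between that block and \<open>A\<close>, so saturation puts
  \<open>n\<close> into it. The label condition holds because \<open>A\<close> also contains
  \<open>n\<close>, which places \<open>n\<close> in \<open>J_L\<close> of the lower block.\<close>

lemma exposed_below_topmost:
  assumes st: "stair D r lam" and A: "topmost D r A" and n: "n \<in> A" "n \<in> \<Union>(D - {A})"
  shows "exposed (D - {A}) (rest r (D - {A})) (restrict lam (D - {A})) n"
proof -
  let ?E = "D - {A}" and ?q = "rest r (D - {A})"
  have s: "staircase D r" and sE: "staircase ?E ?q"
    using stairD(1)[OF st] staircase_remove[OF stairD(1)[OF st] A] by simp_all
  have AD: "A \<in> D" using A by (simp add: topmost_def)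
  obtain Y where Y: "Y \<in> ?E" "n \<in> Y" "\<And>X. X \<in> ?E \<Longrightarrow> n \<in> X \<Longrightarrow> (X, Y) \<in> ?q"
    using obtain_max_at[OF sE n(2)] by metis
  have one: "\<exists>Y\<in>?E. n \<in> Y \<and> (X, Y) \<in> ?q" if X: "X \<in> ?E" "t' \<in> X" "adj n t'" for X t'
  proof -
    have "touch X Y" using X Y adj_sym unfolding touch_def by blast
    then consider "(X, Y) \<in> ?q" | "(Y, X) \<in> ?q" using staircaseD(7)[OF sE X(1) Y(1)] by blast
    then show ?thesis
    proof cases
      case 1
      then show ?thesis using Y by blast
    next
      case 2
      have "touch X A" using X n adj_sym unfolding touch_def by blast
      then have "(X, A) \<in> r" using below_topmost[OF s A, of X] X by simp
      then have "n \<in> X" using staircaseD(8)[OF s X(3), of Y A X] 2 X Y n AD by simp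
      then show ?thesis using Y X by blast
    qed
  qed
  have two: "n \<in> DL (restrict lam ?E X)" if X: "max_at ?E ?q n X" for X
  proof -
    have X': "X \<in> ?E" "n \<in> X" using X by (auto simp: max_at_def)
    then have "n \<in> J_L D r X" using JL_remove_sub(2)[OF s A X'(1)] n by blast
    then show ?thesis using stairD(3)[OF st, of X] X' by auto
  qed
  show ?thesis unfolding exposed_def using one two n(2) by blast
qed

lemma obtain_peel:
  assumes st: "stair D r lam" and n: "Suc n = card D"
  obtains A E q m z M N where "topmost D r A" "E = D - {A}" "q = rest r E" "m = restrict lam E"
    "z = Lam E q m" "M = \<Union>E" "N = A \<inter> M"
proof -
  have "D \<noteq> {}" using n by auto
  then obtain A where "topmost D r A" using obtain_top[OF stairD(1)[OF st]] by blast
  from that[OF this refl refl refl refl refl refl] show thesis .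
qed

text \<open>The facts about \<open>z\<close> are assumptions because the lemma also serves inside
  the induction that proves them. The product is split in two ways: \<open>(lam A wo N) z\<close>,
  with left factor minimal for \<open>W M\<close>, and \<open>lam A (wo N z)\<close>, with right
  factor minimal for \<open>W A\<close>.\<close>

lemma peel_step:
  assumes st: "stair D r lam" and A: "topmost D r A"
    and E_def: "E = D - {A}" and q_def: "q = rest r E" and m_def: "m = restrict lam E"
    and z_def: "z = Lam E q m" and M_def: "M = \<Union>E" and N_def: "N = A \<inter> M"
    and spz: "sp z = M" and zc: "z \<in> carrier G" and exz: "\<And>t. t \<in> DL z \<longleftrightarrow> exposed E q m t"
  shows "A \<subseteq> S" "M \<subseteq> S" "N \<subseteq> DL z" "sph N" "N \<subseteq> DR (lam A)" "z \<in> W M" "lam A \<otimes> wo N \<in> MR M"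
    "lam A \<otimes> wo N \<in> W A"
    "sp (lam A \<otimes> wo N) = A" "wo N \<otimes> z \<in> LM A" "Lam D r lam = (lam A \<otimes> wo N) \<otimes> z"
    "Lam D r lam = lam A \<otimes> (wo N \<otimes> z)" "sp (wo N \<otimes> z) \<subseteq> M" "lam A \<in> W A" "lam A \<in> carrier G"
    "sp (lam A) = A" "A \<in> D" "\<Union>D = A \<union> M" "J_R D r A = N"
proof -
  have s: "staircase D r" using stairD(1)[OF st] .
  show AD: "A \<in> D" using A by (simp add: topmost_def)
  show "\<Union>D = A \<union> M" using AD by (auto simp: M_def E_def)
  show NJ: "J_R D r A = N" using JR_top[OF s A] by (simp add: N_def M_def E_def)
  note g = good_label[OF st AD, unfolded NJ]
  show AS: "A \<subseteq> S" using staircaseD(4)[OF s AD] .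
  show MS: "M \<subseteq> S" unfolding M_def E_def using staircaseD(4)[OF s] by auto
  have NM: "N \<subseteq> M" by (auto simp: N_def)
  show Nz: "N \<subseteq> DL z"
  proof
    fix n assume "n \<in> N"
    then have "n \<in> A" "n \<in> \<Union>(D - {A})" by (simp_all add: N_def M_def E_def)
    from exposed_below_topmost[OF st A this] show "n \<in> DL z" unfolding exz m_def q_def E_def .
  qed
  show sN: "sph N" and "N \<subseteq> DR (lam A)" and al: "lam A \<in> carrier G" "sp (lam A) = A" using g by simp_all
  show zM: "z \<in> W M" using W_sp[OF zc] by (simp only: spz)
  show spa: "sp (lam A \<otimes> wo N) = A" using g(6) .
  have aN: "lam A \<otimes> wo N \<in> MR N" using DR_decomp(1)[OF al(1) g(4)] .
  have NS: "N \<subseteq> S" using NM MS by blast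
  show aM: "lam A \<otimes> wo N \<in> MR M"
    by (rule MR_sp_iff[OF MS _ _ NS aN]) (use al sN spa in \<open>auto simp: N_def\<close>)
  have yN: "wo N \<otimes> z \<in> LM N" using DL_decomp(1)[OF zc Nz] .
  have "wo N \<otimes> z \<in> W M" using W_mult[OF W_mono[OF NM wo_W[OF sN]] zM] .
  then show spy: "sp (wo N \<otimes> z) \<subseteq> M" using W_spD[OF MS] by simp
  have "sp (wo N \<otimes> z) \<inter> A \<subseteq> N" using spy by (auto simp: N_def)
  then show "wo N \<otimes> z \<in> LM A" using LM_sp_iff[OF AS _ _ NS yN] sN zc by simp
  show e: "Lam D r lam = (lam A \<otimes> wo N) \<otimes> z"
    using Lam_remove[OF st A] by (simp add: bar_label_def NJ z_def m_def q_def E_def)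
  then show "Lam D r lam = lam A \<otimes> (wo N \<otimes> z)" using al sN zc by (simp add: m_assoc)
  show "lam A \<in> W A" using W_sp[OF al(1)] by (simp only: al(2))
  show "lam A \<otimes> wo N \<in> W A" using W_sp_sub[of "lam A \<otimes> wo N" A] spa al sN by simp
qed

text \<open>Peel off a topmost block \<open>A\<close>. A generator outside \<open>A\<close> is a
  descent iff it commutes with all of \<open>A\<close> and is a descent of the rest; one inside
  \<open>A\<close> is a descent iff it is one of \<open>lam A\<close>.\<close>

lemma Lam_structure:
  assumes "stair D r lam"
  shows "Lam D r lam \<in> carrier G \<and> sp (Lam D r lam) = \<Union>D \<and>
    (\<forall>t. t \<in> DL (Lam D r lam) \<longleftrightarrow> exposed D r lam t)"
  using assms
proof (induction "card D" arbitrary: D r lam)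
  case 0
  then have "D = {}" using staircaseD(1)[OF stairD(1)] by simp
  then show ?case using Lam_empty[of r lam] 0 DL_sp[of \<one>] by (auto simp: exposed_def)
next
  case (Suc n)
  note st = Suc(3)
  have s: "staircase D r" using stairD(1)[OF st] .
  obtain A E q m z M N where A: "topmost D r A" and E_def: "E = D - {A}" and q_def: "q = rest r E"
    and m_def: "m = restrict lam E" and z_def: "z = Lam E q m" and M_def: "M = \<Union>E" and N_def: "N = A \<inter> M"
    using obtain_peel[OF st Suc(2)] .
  have AD: "A \<in> D" using A by (simp add: topmost_def)
  have sE: "stair E q m" unfolding m_def q_def E_def by (rule stair_remove[OF st A])
  have "n = card E" using Suc(2) AD staircaseD(1)[OF s] by (simp add: E_def)
  from Suc(1)[OF this sE] have IH: "z \<in> carrier G" "sp z = M" "\<And>t. t \<in> DL z \<longleftrightarrow> exposed E q m t"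
    by (simp_all add: z_def M_def)
  note p = peel_step[OF st A E_def q_def m_def z_def M_def N_def IH(2,1,3)]
  let ?a = "lam A \<otimes> wo N" and ?\<zeta> = "wo N \<otimes> z"
  have ac: "?a \<in> carrier G" "?\<zeta> \<in> carrier G" using p(4,15) IH(1) by simp_all
  have laz: "len (?a \<otimes> z) = len ?a + len z" using MR_len[OF p(2,7,6)] .
  note UD = p(18)
  have spL: "sp (Lam D r lam) = \<Union>D"
    unfolding p(11) using MR_sp[OF p(2,7,6)] p(9) IH(2) UD by simp
  have "t \<in> DL (Lam D r lam) \<longleftrightarrow> exposed D r lam t" for t
  proof (cases "t \<in> A")
    case False
    show ?thesis
    proof
      assume d: "t \<in> DL (Lam D r lam)"
      have ex: "exposed E q m t" and na: "\<And>x. x \<in> A \<Longrightarrow> \<not> adj t x"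
        using descent_below[OF p(2,7,6), of t] d False IH(3) unfolding p(9,11) by simp_all
      show "exposed D r lam t" unfolding exposed_def
      proof (intro conjI ballI impI allI)
        show "t \<in> \<Union>D" using ex by (auto simp: exposed_def E_def)
        show "\<exists>Y\<in>D. t \<in> Y \<and> (X, Y) \<in> r" if X: "X \<in> D" "t' \<in> X" "adj t t'" for X t'
        proof -
          have "X \<noteq> A" using na X by auto
          then have "X \<in> E" using X by (simp add: E_def)
          then obtain Y where "Y \<in> E" "t \<in> Y" "(X, Y) \<in> q"
            using ex X(2,3) unfolding exposed_def by meson
          then show ?thesis by (auto simp: E_def q_def)
        qed
        show "t \<in> DL (lam Y)" if Y: "max_at D r t Y" for Y
        proof -
          have Y': "max_at E q t Y" using max_at_remove[OF A False] Y by (simp add: E_def q_def)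
          then have "t \<in> DL (m Y)" using ex by (simp add: exposed_def)
          then show ?thesis using Y' by (simp add: m_def max_at_def)
        qed
      qed
    next
      assume ex: "exposed D r lam t"
      have na: "\<not> adj t x" if x: "x \<in> A" for x
      proof
        assume "adj t x"
        then obtain Y where "Y \<in> D" "t \<in> Y" "(A, Y) \<in> r" using ex AD x unfolding exposed_def by meson
        then show False using A False by (auto simp: topmost_def)
      qed
      have "exposed E q m t" unfolding exposed_def
      proof (intro conjI ballI impI allI)
        show "t \<in> \<Union>E" using ex False by (auto simp: exposed_def E_def)
        show "\<exists>Y\<in>E. t \<in> Y \<and> (X, Y) \<in> q" if X: "X \<in> E" "t' \<in> X" "adj t t'" for X t'
        proof -
          have "X \<in> D" using X by (simp add: E_def)
          then obtain Y where Y: "Y \<in> D" "t \<in> Y" "(X, Y) \<in> r"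
            using ex X(2,3) unfolding exposed_def by meson
          then have "Y \<in> E" using False by (auto simp: E_def)
          then show ?thesis using Y X by (auto simp: q_def)
        qed
        show "t \<in> DL (m Y)" if Y: "max_at E q t Y" for Y
        proof -
          have "max_at D r t Y" using max_at_remove[OF A False] Y by (simp add: E_def q_def)
          then have "t \<in> DL (lam Y)" using ex by (simp add: exposed_def)
          then show ?thesis using Y by (simp add: m_def max_at_def)
        qed
      qed
      then have tz: "t \<in> DL z" using IH(3) by simp
      then have tS: "t \<in> S" and tM: "t \<in> M" using DL_sp[OF IH(1)] IH(2) by (auto simp: DL_iff)
      have ta: "t \<otimes> ?a = ?a \<otimes> t" by (rule comm_W[OF tS p(1,8) na])
      have "t \<otimes> (?a \<otimes> z) = ?a \<otimes> (t \<otimes> z)"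
      proof -
        have "t \<otimes> (?a \<otimes> z) = (t \<otimes> ?a) \<otimes> z" using tS ac IH(1) m_assoc[of t ?a z] by simp
        then show ?thesis unfolding ta using tS ac IH(1) m_assoc[of ?a t z] by simp
      qed
      moreover have "len (?a \<otimes> (t \<otimes> z)) = len ?a + len (t \<otimes> z)"
        by (rule MR_len[OF p(2,7) W_mult[OF W_gen[OF tM] p(6)]])
      ultimately show "t \<in> DL (Lam D r lam)" unfolding p(11) using tz laz by (simp add: DL_iff)
    qed
  next
    case True
    have "exposed D r lam t \<longleftrightarrow> t \<in> DL (lam A)"
    proof -
      have "(X, A) \<in> r" if "X \<in> D" "t' \<in> X" "adj t t'" for X t'
        by (rule below_topmost[OF s A that(1)])
          (use that True adj_sym[OF that(3)] in \<open>auto simp: touch_def\<close>)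
      then show ?thesis unfolding exposed_def max_at_topmost[OF s A True] using True AD by blast
    qed
    moreover have "t \<in> DL (Lam D r lam) \<longleftrightarrow> t \<in> DL (lam A)"
    proof
      assume "t \<in> DL (lam A)"
      then show "t \<in> DL (Lam D r lam)"
        unfolding p(12) by (rule DL_prefix[OF p(15) ac(2) LM_len[OF p(1,10,14)]])
    next
      assume d: "t \<in> DL (Lam D r lam)"
      then have tS: "t \<in> S" by (simp add: DL_iff)
      have lal: "lam A = ?a \<otimes> wo N" using p(4,15) by (simp add: wo_cancel_right)
      have NW: "wo N \<in> W M" by (rule W_mono[OF _ wo_W[OF p(4)]]) (auto simp: N_def)
      have lena: "len (?a \<otimes> wo N) = len ?a + len (wo N)" by (rule MR_len[OF p(2,7) NW])
      show "t \<in> DL (lam A)"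
      proof (cases "t \<in> DL ?a")
        case True
        then have "t \<in> DL (?a \<otimes> wo N)" using DL_prefix[OF ac(1) wo_carrier[OF p(4)] lena] by simp
        then show ?thesis using lal by simp
      next
        case ta: False
        then obtain p' where p': "p' \<in> M" "t \<otimes> ?a = ?a \<otimes> p'" "p' \<in> DL z"
          using descent_shift_left[OF p(2,7,6)] d p(11) by metis
        have p'S: "p' \<in> S" using p'(1) p(2) by blast
        \<comment> \<open>As \<open>t\<close> lies in \<open>A\<close>, comparing supports in
          \<open>t a = a p'\<close> puts \<open>p'\<close> into \<open>A\<close>, hence into
          \<open>N\<close>. So \<open>p'\<close> is a descent of \<open>wo N\<close>, and
          \<open>t\<close> one of \<open>lam A = a wo N\<close>.\<close>
        have "sp (t \<otimes> ?a) = sp t \<union> sp ?a"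
          by (rule sp_mult_eq) (use tS ac DL_len[OF tS ac(1) ta] in simp_all)
        moreover have "sp (?a \<otimes> p') = sp ?a \<union> sp p'" by (rule MR_sp[OF p(2,7) W_gen[OF p'(1)]])
        ultimately have "{t} \<union> A = A \<union> {p'}" using p'(2) p(9) tS p'S by simp
        then have "p' \<in> N" using True p'(1) by (auto simp: N_def)
        then have pd: "p' \<in> DL (wo N)" using wo_DL[OF p(4)] by simp
        have "t \<otimes> lam A = t \<otimes> ?a \<otimes> wo N" by (subst lal) (use tS ac p(4) m_assoc[of t ?a "wo N"] in simp)
        also have "\<dots> = ?a \<otimes> (p' \<otimes> wo N)" unfolding p'(2) using p'S ac p(4) m_assoc[of ?a p' "wo N"] by simp
        finally have "len (t \<otimes> lam A) = len ?a + len (p' \<otimes> wo N)"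
          using MR_len[OF p(2,7) W_mult[OF W_gen[OF p'(1)] NW]] by simp
        also have "\<dots> < len ?a + len (wo N)" using pd by (simp add: DL_iff)
        also have "\<dots> = len (lam A)" using lena lal by simp
        finally show ?thesis using tS by (simp add: DL_iff)
      qed
    qed
    ultimately show ?thesis by simp
  qed
  moreover have "Lam D r lam \<in> carrier G" unfolding p(11) using ac(1) IH(1) by simp
  ultimately show ?case using spL by simp
qed

lemma Lam_carrier: "stair D r lam \<Longrightarrow> Lam D r lam \<in> carrier G"
  using Lam_structure by blast

lemma Lam_sp: "stair D r lam \<Longrightarrow> sp (Lam D r lam) = \<Union>D"
  using Lam_structure by blast

lemma Lam_DL: "stair D r lam \<Longrightarrow> t \<in> DL (Lam D r lam) \<longleftrightarrow> exposed D r lam t"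
  using Lam_structure by blast

lemma peel_rest:
  assumes st: "stair D r lam" and A: "topmost D r A"
    and E_def: "E = D - {A}" and q_def: "q = rest r E" and m_def: "m = restrict lam E"
    and z_def: "z = Lam E q m" and M_def: "M = \<Union>E"
  shows "sp z = M" "z \<in> carrier G" "t \<in> DL z \<longleftrightarrow> exposed E q m t" "stair E q m" "card D = Suc n \<Longrightarrow> n = card E"
proof -
  show sE: "stair E q m" unfolding m_def q_def E_def by (rule stair_remove[OF st A])
  show "sp z = M" "z \<in> carrier G" "t \<in> DL z \<longleftrightarrow> exposed E q m t"
    unfolding z_def M_def by (rule Lam_sp[OF sE], rule Lam_carrier[OF sE], rule Lam_DL[OF sE])
  show "card D = Suc n \<Longrightarrow> n = card E"
    using A staircaseD(1)[OF stairD(1)[OF st]] by (simp add: E_def topmost_def)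
qed

lemma peel_DL:
  assumes st: "stair D r lam" and A: "topmost D r A" and t: "t \<in> DL (Lam D r lam)" "t \<notin> A"
  shows "t \<in> DL (Lam (D - {A}) (rest r (D - {A})) (restrict lam (D - {A})))" "x \<in> A \<Longrightarrow> \<not> adj t x"
proof -
  note p = peel_step[OF st A refl refl refl refl refl refl peel_rest(1-3)[OF st A refl refl refl refl refl]]
  have d: "t \<in> DL ((lam A \<otimes> wo (A \<inter> \<Union>(D - {A}))) \<otimes> Lam (D - {A}) (rest r (D - {A})) (restrict lam (D - {A})))"
    using t(1) by (simp only: p(11))
  show "t \<in> DL (Lam (D - {A}) (rest r (D - {A})) (restrict lam (D - {A})))" "x \<in> A \<Longrightarrow> \<not> adj t x"
    using descent_below[OF p(2,7,6) d] t(2) p(9) by simp_all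
qed

text \<open>Split \<open>P\<close> along the topmost block \<open>A\<close>; the part
  \<open>P2\<close> outside \<open>A\<close> commutes with \<open>A\<close>. So \<open>wo P1\<close>
  strips only \<open>lam A\<close>, which keeps its support by rigidity because \<open>A\<close> is
  not inside \<open>P\<close>, and \<open>wo P2\<close> strips only the rest, where induction
  applies.\<close>

lemma Lam_sp_reduced:
  assumes "stair D r lam" "P \<subseteq> DL (Lam D r lam)" "\<And>Y. Y \<in> D \<Longrightarrow> \<not> Y \<subseteq> P"
  shows "sp (wo P \<otimes> Lam D r lam) = \<Union>D"
  using assms
proof (induction "card D" arbitrary: D r lam P)
  case 0
  then have "D = {}" using staircaseD(1)[OF stairD(1)] by simp
  moreover have "P = {}" using 0(3) DL_sp[OF Lam_carrier[OF 0(2)]] Lam_sp[OF 0(2)] calculation by blast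
  ultimately show ?case using Lam_sp[OF 0(2)] Lam_carrier[OF 0(2)] by simp
next
  case (Suc n)
  note st = Suc(3) and P = Suc(4)
  have s: "staircase D r" using stairD(1)[OF st] .
  obtain A E q m z M N where A: "topmost D r A" and E_def: "E = D - {A}" and q_def: "q = rest r E"
    and m_def: "m = restrict lam E" and z_def: "z = Lam E q m" and M_def: "M = \<Union>E" and N_def: "N = A \<inter> M"
    using obtain_peel[OF st Suc(2)] .
  note e = peel_rest[OF st A E_def q_def m_def z_def M_def]
  note p = peel_step[OF st A E_def q_def m_def z_def M_def N_def e(1-3)]
  note AD = p(17)
  note sE = e(4) and cE = e(5)[OF Suc(2)[symmetric]] and zc = e(2) and spz = e(1)
  note UD = p(18)
  define P1 where "P1 = P \<inter> A"
  define P2 where "P2 = P - A"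
  have PP: "P = P1 \<union> P2" "P1 \<inter> P2 = {}" by (auto simp: P1_def P2_def)
  have P2z: "P2 \<subseteq> DL z" and P2A: "\<And>t x. t \<in> P2 \<Longrightarrow> x \<in> A \<Longrightarrow> \<not> adj t x"
    using peel_DL[OF st A] P by (auto simp: P2_def z_def E_def q_def m_def)
  have P1a: "P1 \<subseteq> DL (lam A)"
  proof
    fix t assume "t \<in> P1"
    then have "exposed D r lam t" "t \<in> A" using P Lam_DL[OF st] by (auto simp: P1_def)
    then show "t \<in> DL (lam A)" using max_at_topmost[OF s A] by (simp add: exposed_def)
  qed
  have P1A: "P1 \<subset> A" using Suc(5)[OF AD] by (auto simp: P1_def)
  have IH: "sp (wo P2 \<otimes> z) = M"
    unfolding z_def M_def
  proof (rule Suc(1)[OF cE sE])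
    show "P2 \<subseteq> DL (Lam E q m)" using P2z by (simp add: z_def)
    show "\<not> Y \<subseteq> P2" if "Y \<in> E" for Y using Suc(5)[of Y] that by (auto simp: E_def P2_def)
  qed
  have sP: "sph P" using DL_spherical[OF Lam_carrier[OF st] P] .
  have sP1: "sph P1" and sP2: "sph P2" using sph_subset[OF sP] by (auto simp: P1_def P2_def)
  have NP2z: "N \<union> P2 \<subseteq> DL z" using p(3) P2z by simp
  have sNP: "sph (N \<union> P2)" using DL_spherical[OF zc NP2z] .
  have P2S: "P2 \<subseteq> S" and NS: "N \<subseteq> S" using sphD[OF sP2] sphD[OF p(4)] by simp_all
  have nN: "\<not> adj t x" if "t \<in> N" "x \<in> P2" for t x
    using P2A[OF that(2), of t] that(1) adj_sym[of t x] by (auto simp: N_def)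
  have wP: "wo P = wo P1 \<otimes> wo P2"
    using wo_union[of P1 P2] sP PP P2A adj_sym unfolding P1_def by (metis IntD2)
  have wNP: "wo (N \<union> P2) = wo N \<otimes> wo P2"
    by (rule wo_union[OF sNP _ nN]) (auto simp: N_def P2_def)
  \<comment> \<open>What remains of \<open>z\<close> after stripping \<open>N\<close> and
    \<open>P2\<close> together. These sets commute and are disjoint, so the longest element of their
    union is the product of the two in either order.\<close>
  define y where "y = wo (N \<union> P2) \<otimes> z"
  have yL: "y \<in> LM (N \<union> P2)" unfolding y_def using DL_decomp(1)[OF zc NP2z] .
  have yc: "y \<in> carrier G" using yL by simp
  have c: "wo N \<in> carrier G" "wo P2 \<in> carrier G" "wo P1 \<in> carrier G" "lam A \<in> carrier G"
    using p(4) sP1 sP2 p(15) by simp_all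
  have comm: "wo P2 \<otimes> lam A = lam A \<otimes> wo P2"
    by (rule comm_WW[OF P2S p(1) wo_W[OF sP2] p(14) P2A])
  have commN: "wo N \<otimes> wo P2 = wo P2 \<otimes> wo N"
    by (rule comm_WW[OF NS P2S wo_W[OF p(4)] wo_W[OF sP2] nN])
  have z: "z = wo N \<otimes> wo P2 \<otimes> y"
    using wo_cancel[OF sNP zc] by (simp only: y_def wNP)
  have \<zeta>: "wo N \<otimes> z = wo P2 \<otimes> y"
    unfolding z using c yc p(4) by (simp add: m_assoc wo_cancel)
  have z': "wo P2 \<otimes> z = wo N \<otimes> y"
    unfolding z commN using c yc sP2 by (simp add: m_assoc wo_cancel)
  have yA: "y \<in> LM A"
  proof (rule LM_sp_iff[OF p(1) yc _ NS])
    have "N \<union> P2 \<subseteq> M" using NP2z DL_sp[OF zc] spz by (meson subset_trans equalityD1)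
    then have "sp y \<subseteq> M" unfolding y_def using sp_mult[of "wo (N \<union> P2)" z] wo_sp[OF sNP] spz zc sNP
      by auto
    then show "sp y \<inter> A \<subseteq> N" by (auto simp: N_def)
    show "y \<in> LM N" using LM_mono[OF _ _ yL, of N] NS P2S by simp
  qed
  have "wo P \<otimes> Lam D r lam = wo P1 \<otimes> (wo P2 \<otimes> lam A) \<otimes> (wo P2 \<otimes> y)"
    unfolding wP p(12) \<zeta> using c yc by (simp add: m_assoc)
  also have "\<dots> = (wo P1 \<otimes> lam A) \<otimes> y"
    unfolding comm using c yc sP2 by (simp add: m_assoc wo_cancel)
  finally have e: "wo P \<otimes> Lam D r lam = (wo P1 \<otimes> lam A) \<otimes> y" .
  obtain sA where gA: "good A sA (lam A)" using stairD(4)[OF st AD] by blast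
  have full: "sp (wo P1 \<otimes> lam A) = A"
    by (rule good_left_factor_full[OF gA P1A wo_W[OF sP1] DL_decomp(1)[OF p(15) P1a]])
      (use c sP1 in \<open>simp add: wo_cancel\<close>)
  have "wo P1 \<otimes> lam A \<in> W A" using W_sp_sub[of "wo P1 \<otimes> lam A" A] full c by simp
  then have "sp (wo P \<otimes> Lam D r lam) = A \<union> sp y" unfolding e using LM_sp[OF p(1) yA] full by simp
  moreover have "M = N \<union> sp y"
    using IH LM_sp[OF NS LM_mono[OF _ _ yL] wo_W[OF p(4)]] wo_sp[OF p(4)] NS P2S by (simp add: z')
  ultimately show ?case using UD by (auto simp: N_def)
qed

text \<open>No other block lies inside \<open>A\<close>, each being the maximum at one of its
  generators, so the general statement applies to the overlap. This makes the union of the remaining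
  blocks readable from the second factor.\<close>

lemma peel_sp_reduced:
  assumes st: "stair D r lam" and A: "topmost D r A"
  shows "sp (wo (A \<inter> \<Union>(D - {A})) \<otimes> Lam (D - {A}) (rest r (D - {A})) (restrict lam (D - {A}))) = \<Union>(D - {A})"
  by (rule Lam_sp_reduced[OF stair_remove[OF st A] 
        peel_step(3)[OF st A refl refl refl refl refl refl peel_rest(1-3)[OF st A refl refl refl refl refl]]])
    (use not_covered_by_topmost[OF stairD(1)[OF st] A] in blast)

subsection \<open>Removable generators determine maximal blocks\<close>

text \<open>A left descent \<open>t\<close> of \<open>b\<close> is one of \<open>x z\<close> but not
  of \<open>x\<close>, so it passes through \<open>x\<close> to a letter of \<open>M\<close> that is
  a descent of \<open>z\<close>. Removing both and repeating reaches every letter of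
  \<open>b\<close>.\<close>

lemma shift_through:
  assumes B: "B \<subseteq> S" and M: "M \<subseteq> S" and x: "x \<in> LM B" "x \<in> MR M"
  shows "z \<in> W M \<Longrightarrow> x \<otimes> z = b \<otimes> y \<Longrightarrow> b \<in> W B \<Longrightarrow> y \<in> LM B \<Longrightarrow> p \<in> sp b \<Longrightarrow> \<exists>p'\<in>M. p \<otimes> x = x \<otimes> p'"
proof (induction "len b" arbitrary: b z p)
  case 0
  then have "b = \<one>" using len_zero[of b] B by simp
  then show ?case using 0 by simp
next
  case (Suc n)
  have bc: "b \<in> carrier G" and yc: "y \<in> carrier G" and zc: "z \<in> carrier G" and xc: "x \<in> carrier G"
    using Suc.prems x B M by simp_all
  have "inv b \<noteq> \<one>" using Suc(2) bc by (metis len_inv len_one nat.distinct(1))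
  then obtain t where "t \<in> DR (inv b)" using obtain_DR[of "inv b"] bc by blast
  then have t: "t \<in> DL b" using DR_inv[OF bc] by simp
  then have tS: "t \<in> S" by (simp add: DL_iff)
  have tB: "t \<in> B" using t DL_sp[OF bc] W_spD[OF B Suc(5)] by blast
  have "t \<in> DL (x \<otimes> z)" unfolding Suc(4) by (rule DL_prefix[OF bc yc LM_len[OF B Suc(6,5)] t])
  moreover have "t \<notin> DL x" using x(1) tB LM_iff[OF B] by blast
  ultimately obtain p' where p': "p' \<in> M" "t \<otimes> x = x \<otimes> p'" "p' \<in> DL z"
    using descent_shift_left[OF M x(2) Suc(3)] by blast
  have p'S: "p' \<in> S" using p'(1) M by blast
  define b1 where "b1 = t \<otimes> b"
  have b1: "b1 \<in> carrier G" "b = t \<otimes> b1" "n = len b1"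
    using tS bc gen_cancel[OF tS bc] DL_len'[OF bc t] Suc(2) by (simp_all add: b1_def)
  have spb: "sp b = {t} \<union> sp b1"
    using sp_mult_eq[of t b1] b1 tS Suc(2) by simp
  have b1W: "b1 \<in> W B" unfolding b1_def using W_mult[OF W_gen[OF tB] Suc(5)] .
  have p'z: "p' \<otimes> z \<in> W M" using W_mult[OF W_gen[OF p'(1)] Suc(3)] .
  have "x \<otimes> (p' \<otimes> z) = t \<otimes> x \<otimes> z" unfolding p'(2) using xc p'S zc by (simp add: m_assoc)
  also have "\<dots> = b1 \<otimes> y" using Suc(4) tS xc zc bc yc by (simp add: b1_def m_assoc)
  finally have "x \<otimes> (p' \<otimes> z) = b1 \<otimes> y" .
  from Suc(1)[OF b1(3) p'z this b1W Suc(6)] show ?case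
    using Suc(7) spb p' by auto
qed

text \<open>The topmost block \<open>A\<close> chosen for the induction need not be
  \<open>B\<close>. If \<open>s\<close> is in \<open>A\<close>, the two factorizations of the
  product give \<open>A = B\<close>. Otherwise \<open>A\<close> and \<open>B\<close> turn out not to
  touch, so \<open>b\<close> also splits off from the rest, where the induction hypothesis
  applies.\<close>

lemma removable_block:
  assumes "stair D r lam" and "good B s b" and "y \<in> LM B" and "s \<notin> sp y" and "Lam D r lam = b \<otimes> y"
  shows "topmost D r B \<and> lam B = b \<and> (\<forall>X\<in>D. s \<in> X \<longrightarrow> X = B)"
  using assms
proof (induction "card D" arbitrary: D r lam y)
  case 0
  then have "D = {}" using staircaseD(1)[OF stairD(1)] by simp
  then have "sp (b \<otimes> y) = {}" using Lam_sp[OF 0(2)] 0(6) by simp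
  moreover have "sp (b \<otimes> y) = sp b \<union> sp y"
    by (rule LM_sp[OF goodD(7)[OF 0(3)] 0(4)]) (use W_sp[OF goodD(2)[OF 0(3)]] goodD(4)[OF 0(3)] in simp)
  ultimately show ?case using goodD(3,4)[OF 0(3)] by auto
next
  case (Suc n)
  note st = Suc(3) and gB = Suc(4) and yB = Suc(5) and sy = Suc(6) and L = Suc(7)
  note gd = goodD[OF gB]
  have s: "staircase D r" using stairD(1)[OF st] .
  obtain A E q m z M N where A: "topmost D r A" and E_def: "E = D - {A}" and q_def: "q = rest r E"
    and m_def: "m = restrict lam E" and z_def: "z = Lam E q m" and M_def: "M = \<Union>E" and N_def: "N = A \<inter> M"
    using obtain_peel[OF st Suc(2)] .
  note e = peel_rest[OF st A E_def q_def m_def z_def M_def]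
  note p = peel_step[OF st A E_def q_def m_def z_def M_def N_def e(1-3)]
  note AD = p(17)
  note sE = e(4) and cE = e(5)[OF Suc(2)[symmetric]] and zc = e(2) and spz = e(1)
  have sp\<zeta>: "sp (wo N \<otimes> z) = M"
    using peel_sp_reduced[OF st A] by (simp add: E_def q_def m_def z_def M_def N_def)
  have yc: "y \<in> carrier G" using yB by simp
  have bW: "b \<in> W B" using W_sp[OF gd(2)] gd(4) by simp
  have lby: "len (b \<otimes> y) = len b + len y" using LM_len[OF gd(7) yB bW] .
  let ?\<zeta> = "wo N \<otimes> z"
  have \<zeta>W: "?\<zeta> \<in> W M" using W_sp_sub[of ?\<zeta> M] sp\<zeta> zc p(4) by simp
  have \<zeta>c: "?\<zeta> \<in> carrier G" using zc p(4) by simp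
  have by\<zeta>: "b \<otimes> y = lam A \<otimes> ?\<zeta>" using L p(12) by simp
  obtain sA where sA: "sA \<in> A - J_R D r A" "good A sA (lam A)" using stairD(4)[OF st AD] by blast
  have AM: "\<not> A \<subseteq> M" using sA unfolding p(19) N_def by blast
  have BAM: "B \<subseteq> A \<or> B \<subseteq> M"
    using good_prefix[OF gB p(1,2) yc lby by\<zeta> p(14) \<zeta>W] .
  show ?case
  proof (cases "s \<in> A")
    case True
    \<comment> \<open>The same splitting argument with the roles of \<open>A\<close> and
      \<open>B\<close> exchanged; \<open>s\<close> rules out the second alternative.\<close>
    have "A \<subseteq> B \<or> A \<subseteq> sp y"
      by (rule good_prefix[OF sA(2) gd(7) sp_subset[OF yc] \<zeta>c LM_len[OF p(1,10,14)] by\<zeta>[symmetric] bW W_sp[OF yc]])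
    then have AB: "A \<subseteq> B" using True sy by blast
    then have "A = B" using BAM AM by blast
    then have "lam A = b" "?\<zeta> = y"
      using LM_unique[OF p(1,10) _ p(14) _ by\<zeta>[symmetric]] yB bW by simp_all
    then have "s \<notin> M" using sp\<zeta> sy by simp
    then have "\<forall>X\<in>D. s \<in> X \<longrightarrow> X = B" using \<open>A = B\<close> by (auto simp: M_def E_def)
    then show ?thesis using A \<open>A = B\<close> \<open>lam A = b\<close> by simp
  next
    case False
    then have BM: "B \<subseteq> M" using BAM gd(3) by blast
    let ?J = "A \<inter> B" and ?a = "lam A \<otimes> wo N"
    have JS: "?J \<subseteq> S" using p(1) by blast
    have ac: "?a \<in> carrier G" using p(4,15) by simp
    \<comment> \<open>The part \<open>a1\<close> belongs to \<open>W B\<close>, while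
      \<open>a2\<close> is minimal for \<open>W B\<close> on the left and for \<open>W M\<close> on
      the right, as \<open>shift_through\<close> requires.\<close>
    obtain a1 a2 where a12: "a1 \<in> W ?J" "a2 \<in> LM ?J" "?a = a1 \<otimes> a2" using LM_decomp[OF JS ac] .
    have a1c: "a1 \<in> carrier G" and a2c: "a2 \<in> carrier G" using a12 JS by simp_all
    have la: "len (a1 \<otimes> a2) = len a1 + len a2" using LM_len[OF JS a12(2,1)] .
    have spa: "A = sp a1 \<union> sp a2" using LM_sp[OF JS a12(2,1)] a12(3) p(9) by simp
    have a2B: "a2 \<in> LM B" by (rule LM_sp_iff[OF gd(7) a2c _ JS a12(2)]) (use spa in blast)
    have a2M: "a2 \<in> MR M"
    proof -
      have "t \<notin> DR a2" if t: "t \<in> M" for t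
      proof
        assume "t \<in> DR a2"
        then have "t \<in> DR ?a" using DR_suffix[OF a1c a2c la] a12(3) by simp
        then show False using t p(7) MR_iff[OF p(2)] by blast
      qed
      then show ?thesis using MR_iff[OF p(2)] a2c by blast
    qed
    have "a2 \<otimes> z \<in> carrier G" using a2c zc by simp
    then obtain b' y' where b': "b' \<in> W B" "y' \<in> LM B" "a2 \<otimes> z = b' \<otimes> y'"
      using LM_decomp[OF gd(7)] by metis
    have b'c: "b' \<in> carrier G" "y' \<in> carrier G" using b' gd(7) by simp_all
    have a1B: "a1 \<in> W B" using W_mono[OF _ a12(1), of B] by simp
    have "b \<otimes> y = (a1 \<otimes> a2) \<otimes> z" using L p(11) a12(3) by simp
    also have "\<dots> = (a1 \<otimes> b') \<otimes> y'" using b'(3) a1c a2c zc b'c by (simp add: m_assoc)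
    finally have bb: "b = a1 \<otimes> b'"
      using LM_unique(1)[OF gd(7) yB b'(2) bW W_mult[OF a1B b'(1)]] by blast
    \<comment> \<open>Rigidity of \<open>b\<close> shows that \<open>b'\<close>, which is
      \<open>b\<close> without \<open>a1\<close>, still has support \<open>B\<close>; so every
      generator in \<open>B\<close> passes through \<open>a2\<close>.\<close>
    obtain c b2 where cb: "c \<in> W ?J" "b2 \<in> LM ?J" "b = c \<otimes> b2" using LM_decomp[OF JS gd(2)] .
    have JB: "?J \<subset> B" using False gd(3) by blast
    have full: "sp b2 = B" using good_left_factor_full[OF gB JB cb] .
    have cc: "c \<in> carrier G" "b2 \<in> carrier G" using cb JS by simp_all
    have "b' = inv a1 \<otimes> b" using bb a1c b'c by (simp add: inv_cancel)
    also have "\<dots> = (inv a1 \<otimes> c) \<otimes> b2" using cb(3) a1c cc by (simp add: m_assoc)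
    finally have "sp b' = sp (inv a1 \<otimes> c) \<union> sp b2"
      using LM_sp[OF JS cb(2) W_mult[OF W_inv[OF JS a12(1)] cb(1)]] by simp
    then have spb': "sp b' = B" using full W_spD[OF gd(7) b'(1)] by blast
    have noadj: "\<not> adj p' h" if p': "p' \<in> B" "p' \<notin> sp a2" and h: "h \<in> sp a2" for p' h
    proof -
      have "p' \<in> sp b'" using p' spb' by simp
      then obtain p1 where p1: "p1 \<in> M" "p' \<otimes> a2 = a2 \<otimes> p1"
        using shift_through[OF gd(7) p(2) a2B a2M p(6) b'(3,1,2)] by blast
      have "p' \<in> S" "p1 \<in> S" using p' p1 gd(7) p(2) by blast+
      then show ?thesis using swap_support(2)[OF a2c _ p'(2) _ p1(2) h] by blast
    qed
    have sa2: "s \<notin> sp a2" using False spa by blast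
    \<comment> \<open>Since \<open>s\<close> is not in the support of \<open>a2\<close>, an overlap
      would give an edge of \<open>B\<close> that \<open>noadj\<close> excludes. The same argument
      inside the connected set \<open>A\<close> then shows that \<open>A\<close> and
      \<open>B\<close> are disjoint.\<close>
    have dis: "B \<inter> sp a2 = {}"
    proof (rule ccontr)
      assume "B \<inter> sp a2 \<noteq> {}"
      then obtain x where x: "x \<in> B" "x \<in> sp a2" by blast
      obtain u v where "u \<in> B" "u \<in> sp a2" "v \<in> B" "v \<notin> sp a2" "adj u v"
        using conn_step[OF gd(1) x gd(3) sa2] .
      then show False using noadj[of v u] adj_sym by blast
    qed
    have nadj: "\<not> adj p' h" if "p' \<in> B" "h \<in> sp a2" for p' h
      using noadj that dis by blast
    have aJ: "sp a1 \<subseteq> ?J" using W_spD[OF JS a12(1)] .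
    obtain h where h: "h \<in> A" "h \<notin> B" using AM BM by blast
    have J0: "?J = {}"
    proof (rule ccontr)
      assume "?J \<noteq> {}"
      then obtain x where x: "x \<in> A" "x \<in> B" by blast
      obtain u v where "u \<in> A" "u \<in> B" "v \<in> A" "v \<notin> B" "adj u v"
        using conn_step[OF staircaseD(5)[OF s AD] x h] .
      then show False using nadj[of u v] spa aJ by blast
    qed
    then have Aa2: "A = sp a2" using spa aJ by blast
    have nt: "\<not> adj u v" if "u \<in> A" "v \<in> B" for u v
      using nadj[of v u] that Aa2 adj_sym by blast
    obtain \<beta> \<eta> where be: "\<beta> \<in> W B" "\<eta> \<in> LM B" "z = \<beta> \<otimes> \<eta>" using LM_decomp[OF gd(7) zc] .
    have bec: "\<beta> \<in> carrier G" "\<eta> \<in> carrier G" using be gd(7) by simp_all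
    \<comment> \<open>The factor of \<open>A\<close> commutes with \<open>W B\<close>, so the part
      \<open>\<beta>\<close> of \<open>z\<close> in \<open>W B\<close> can be moved to the front,
      where uniqueness identifies it with \<open>b\<close>.\<close>
    have comm: "?a \<otimes> x = x \<otimes> ?a" if "x \<in> W B" for x
      by (rule comm_WW[OF p(1) gd(7) p(8) that nt])
    have "\<eta> = inv \<beta> \<otimes> z" using be(3) bec by (simp add: inv_cancel)
    then have \<eta>M: "\<eta> \<in> W M" using W_mult[OF W_inv[OF p(2) W_mono[OF BM be(1)]] p(6)] by simp
    have a\<eta>: "?a \<otimes> \<eta> \<in> LM B"
    proof -
      have "t \<notin> DL (?a \<otimes> \<eta>)" if t: "t \<in> B" for t
      proof -
        have tS: "t \<in> S" using t gd(7) by blast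
        have tM: "t \<in> M" using t BM by blast
        have "t \<otimes> (?a \<otimes> \<eta>) = (t \<otimes> ?a) \<otimes> \<eta>" using tS ac bec m_assoc[of t ?a \<eta>] by simp
        also have "\<dots> = ?a \<otimes> (t \<otimes> \<eta>)" unfolding comm[OF W_gen[OF t], symmetric]
          using tS ac bec m_assoc[of ?a t \<eta>] by simp
        finally have "len (t \<otimes> (?a \<otimes> \<eta>)) = len ?a + len (t \<otimes> \<eta>)"
          using MR_len[OF p(2,7) W_mult[OF W_gen[OF tM] \<eta>M]] by simp
        moreover have "t \<notin> DL \<eta>" using be(2) LM_iff[OF gd(7)] t by blast
        ultimately show ?thesis using MR_len[OF p(2,7) \<eta>M] tS by (simp add: DL_iff)
      qed
      then show ?thesis using LM_iff[OF gd(7)] ac bec by blast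
    qed
    have "b \<otimes> y = (?a \<otimes> \<beta>) \<otimes> \<eta>" using L p(11) be(3) ac bec m_assoc[of ?a \<beta> \<eta>] by simp
    also have "\<dots> = \<beta> \<otimes> (?a \<otimes> \<eta>)" unfolding comm[OF be(1)] using ac bec m_assoc[of \<beta> ?a \<eta>] by simp
    finally have by': "b \<otimes> y = \<beta> \<otimes> (?a \<otimes> \<eta>)" .
    have b\<beta>: "b = \<beta>" and y\<eta>: "y = ?a \<otimes> \<eta>" using LM_unique[OF gd(7) yB a\<eta> bW be(1) by'] by simp_all
    have "sp y = A \<union> sp \<eta>" unfolding y\<eta> using MR_sp[OF p(2,7) \<eta>M] p(9) by simp
    then have s\<eta>: "s \<notin> sp \<eta>" using sy by simp
    have zb: "Lam E q m = b \<otimes> \<eta>" using be(3) b\<beta> by (simp add: z_def)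
    have IH: "topmost E q B" "m B = b" "\<forall>X\<in>E. s \<in> X \<longrightarrow> X = B"
      using Suc(1)[OF cE sE gB be(2) s\<eta> zb] by simp_all
    have BE: "B \<in> E" using IH(1) by (simp add: topmost_def)
    then have BD: "B \<in> D" "B \<noteq> A" by (simp_all add: E_def)
    \<comment> \<open>If the removed block \<open>A\<close> were above \<open>B\<close>, some block
      touching \<open>A\<close> would lie between them; it would have to be \<open>B\<close> itself,
      which does not touch \<open>A\<close>.\<close>
    have "X = B" if X: "X \<in> D" "(B, X) \<in> r" for X
    proof (cases "X = A")
      case True
      then obtain Y where Y: "Y \<in> D" "Y \<noteq> A" "(B, Y) \<in> r" "touch Y A"
        using below_top[OF s, of B A] X(2) BD(2) by metis
      then have "(B, Y) \<in> q" "Y \<in> E" using BE by (auto simp: q_def E_def)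
      then have "Y = B" using IH(1) by (simp add: topmost_def)
      then show ?thesis using Y(4) J0 nt adj_sym unfolding touch_def by blast
    next
      case False
      then have "(B, X) \<in> q" "X \<in> E" using X BE by (auto simp: q_def E_def)
      then show ?thesis using IH(1) by (simp add: topmost_def)
    qed
    then have "topmost D r B" using BD by (simp add: topmost_def)
    moreover have "lam B = b" using IH(2) BE by (simp add: m_def)
    moreover have "\<forall>X\<in>D. s \<in> X \<longrightarrow> X = B" using IH(3) False by (auto simp: E_def)
    ultimately show ?thesis by simp
  qed
qed

subsection \<open>Staircase products have complete BP decompositions\<close>

text \<open>Write \<open>z = wo N y\<close>. The generators of \<open>K - N\<close>, with
  \<open>K = A - {s}\<close>, are added one at a time to reach \<open>wo K y\<close>, and a last
  Grassmannian step adds \<open>s\<close>.\<close>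

lemma Lam_CB: "stair D r lam \<Longrightarrow> CB (Lam D r lam)"
proof (induction "card D" arbitrary: D r lam)
  case 0
  then have "D = {}" using staircaseD(1)[OF stairD(1)] by simp
  then show ?case using Lam_empty 0 CB_one by simp
next
  case (Suc n)
  note st = Suc(3)
  obtain A E q m z M N where A: "topmost D r A" and E_def: "E = D - {A}" and q_def: "q = rest r E"
    and m_def: "m = restrict lam E" and z_def: "z = Lam E q m" and M_def: "M = \<Union>E" and N_def: "N = A \<inter> M"
    using obtain_peel[OF st Suc(2)] .
  note e = peel_rest[OF st A E_def q_def m_def z_def M_def]
  note p = peel_step[OF st A E_def q_def m_def z_def M_def N_def e(1-3)]
  note AD = p(17)
  note sE = e(4) and cE = e(5)[OF Suc(2)[symmetric]] and zc = e(2) and NJ = p(19)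
  obtain s where s: "s \<in> A - N" "good A s (lam A)" using stairD(4)[OF st AD] NJ by blast
  note gd = goodD[OF s(2)]
  let ?K = "A - {s}" and ?y = "wo N \<otimes> z"
  have sy: "s \<notin> sp ?y" using s(1) p(13) by (auto simp: N_def)
  have "?y \<in> LM ?K" using LM_mono[OF _ p(1,10), of ?K] by blast
  moreover have "sp ?y \<inter> ?K \<subseteq> N" using p(13) by (auto simp: N_def)
  moreover have "N \<subseteq> ?K" using s(1) by (auto simp: N_def)
  moreover have "CB (wo N \<otimes> ?y)" using Suc(1)[OF cE sE] zc p(4) by (simp add: wo_cancel z_def)
  ultimately have "CB (wo ?K \<otimes> ?y)" by (rule CB_extend[OF gd(9)])
  then show ?case using CB_step[OF good_grassmannian[OF s(2) p(10) sy]] p(12) by simp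
qed

subsection \<open>Injectivity\<close>

text \<open>Once a topmost block and its label agree, the support of the second factor
  \<open>y\<close> returns the union of the other blocks, hence \<open>N\<close>, hence
  \<open>z = wo N y\<close>. The order is recovered from its restriction because the position of a
  topmost block is forced.\<close>

lemma Lam_inj:
  "stair D r lam \<Longrightarrow> stair D' r' lam' \<Longrightarrow> Lam D r lam = Lam D' r' lam' \<Longrightarrow> D = D' \<and> r = r' \<and> lam = lam'"
proof (induction "card D" arbitrary: D r lam D' r' lam')
  case 0
  have sd: "staircase D r" "staircase D' r'" using stairD(1) 0 by blast+
  have D: "D = {}" using staircaseD(1)[OF sd(1)] 0(1) by simp
  then have "\<Union>D' = {}" using Lam_sp[OF 0(2)] Lam_sp[OF 0(3)] 0(4) by simp
  then have D': "D' = {}" using staircaseD(3)[OF sd(2)] by auto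
  have "r = {}" "r' = {}" using orderD(4)[OF sd(1)] orderD(4)[OF sd(2)] D D' by auto
  moreover have "lam = lam'" using stairD(2)[OF 0(2)] stairD(2)[OF 0(3)] D D' by (auto simp: extensional_def)
  ultimately show ?case using D D' by simp
next
  case (Suc n)
  note st = Suc(3) and st' = Suc(4)
  have sd: "staircase D r" "staircase D' r'" using stairD(1) st st' by blast+
  obtain A E q m z M N where A: "topmost D r A" and E_def: "E = D - {A}" and q_def: "q = rest r E"
    and m_def: "m = restrict lam E" and z_def: "z = Lam E q m" and M_def: "M = \<Union>E" and N_def: "N = A \<inter> M"
    using obtain_peel[OF st Suc(2)] .
  note e = peel_rest[OF st A E_def q_def m_def z_def M_def]
  note p = peel_step[OF st A E_def q_def m_def z_def M_def N_def e(1-3)]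
  note AD = p(17)
  note sE = e(4) and cE = e(5)[OF Suc(2)[symmetric]] and zc = e(2) and NJ = p(19)
  obtain s where s: "s \<in> A - N" "good A s (lam A)" using stairD(4)[OF st AD] NJ by blast
  let ?y = "wo N \<otimes> z"
  have sy: "s \<notin> sp ?y" using s(1) p(13) by (auto simp: N_def)
  have "Lam D' r' lam' = lam A \<otimes> ?y" using Suc(5) p(12) by simp
  from removable_block[OF st' s(2) p(10) sy this]
  have A': "topmost D' r' A" and lA: "lam' A = lam A" by simp_all
  have AD': "A \<in> D'" using A' by (simp add: topmost_def)
  define E' where "E' = D' - {A}"
  define q' where "q' = rest r' E'"
  define m' where "m' = restrict lam' E'"
  define z' where "z' = Lam E' q' m'"
  define M' where "M' = \<Union>E'"
  define N' where "N' = A \<inter> M'"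
  note e' = peel_rest[OF st' A' E'_def q'_def m'_def z'_def M'_def]
  note p' = peel_step[OF st' A' E'_def q'_def m'_def z'_def M'_def N'_def e'(1-3)]
  note sE' = e'(4) and zc' = e'(2)
  have "lam A \<otimes> ?y = lam A \<otimes> (wo N' \<otimes> z')" using p(12) p'(12) Suc(5) lA by simp
  then have yy: "?y = wo N' \<otimes> z'" using p(4,15) p'(4) zc zc' by simp
  have "sp ?y = M" using peel_sp_reduced[OF st A] by (simp add: E_def q_def m_def z_def M_def N_def)
  moreover have "sp (wo N' \<otimes> z') = M'"
    using peel_sp_reduced[OF st' A'] by (simp add: E'_def q'_def m'_def z'_def M'_def N'_def)
  ultimately have "N = N'" using yy by (simp add: N_def N'_def)
  then have "z = z'" using yy zc zc' p(4) by simp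
  then have IH: "E = E'" "q = q'" "m = m'" using Suc(1)[OF cE sE sE'] by (simp_all add: z_def z'_def)
  have D: "D = D'" using IH(1) AD AD' unfolding E_def E'_def by (metis insert_Diff)
  have r1: "rest r (D - {A}) = rest r' (D' - {A})" using IH(2) unfolding q_def q'_def E_def E'_def .
  have "r \<subseteq> r'" by (rule top_order_determined[OF sd(1) A sd(2)[folded D] A'[folded D]]) (use r1 D in simp)
  moreover have "r' \<subseteq> r"
    by (rule top_order_determined[OF sd(2) A' sd(1)[unfolded D] A[unfolded D]]) (use r1 D in simp)
  moreover have "lam = lam'"
  proof (rule extensionalityI[OF stairD(2)[OF st]])
    show "lam' \<in> extensional D" using stairD(2)[OF st'] D by simp
    show "lam X = lam' X" if "X \<in> D" for X
    proof (cases "X = A")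
      case False
      then have "X \<in> E" using that by (simp add: E_def)
      then have "m X = lam X" "m' X = lam' X" using IH(1) by (simp_all add: m_def m'_def)
      then show ?thesis using IH(3) by simp
    qed (use lA in simp)
  qed
  ultimately show ?case using D by blast
qed

subsection \<open>Surjectivity\<close>

text \<open>The highest block at \<open>u\<close> lies below a block containing \<open>p\<close>,
  hence below \<open>Y\<close>, which itself contains \<open>u\<close>. With connectedness, being
  the maximum spreads over a whole block.\<close>

lemma exposed_max_spread:
  assumes sd: "staircase E r" and ex: "exposed E r lam p" and Y: "max_at E r p Y"
    and u: "u \<in> Y" "adj p u"
  shows "max_at E r u Y"
proof -
  have YE: "Y \<in> E" using Y by (simp add: max_at_def)
  then obtain X where X: "X \<in> E" "u \<in> X" "\<And>Z. Z \<in> E \<Longrightarrow> u \<in> Z \<Longrightarrow> (Z, X) \<in> r"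
    using obtain_max_at[OF sd, of u] u(1) by (metis UnionI)
  obtain Y1 where Y1: "Y1 \<in> E" "p \<in> Y1" "(X, Y1) \<in> r"
    using ex X(1,2) u(2) unfolding exposed_def by meson
  then have "(X, Y) \<in> r" using Y orderD(2)[OF sd] unfolding max_at_def by blast
  then have "X = Y" using orderD(3)[OF sd] X(3)[OF YE u(1)] by blast
  then show ?thesis using X by (simp add: max_at_def)
qed

text \<open>The order generated by \<open>r\<close> and by placing every block that touches
  \<open>B\<close> below it; by \<open>top_order_determined\<close> no other order with
  \<open>B\<close> on top can be a staircase.\<close>

definition glue where
  "glue E r B = r \<union> {(X, B) |X. \<exists>Y\<in>E. (X, Y) \<in> r \<and> touch Y B} \<union> {(B, B)}"

lemma glue_iff: "B \<notin> E \<Longrightarrow> r \<subseteq> E \<times> E \<Longrightarrow>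
   (X, Y) \<in> glue E r B \<longleftrightarrow> (if Y = B then X = B \<or> (\<exists>Z\<in>E. (X, Z) \<in> r \<and> touch Z B) else (X, Y) \<in> r)"
  unfolding glue_def by auto

text \<open>Exposedness of the overlap of \<open>B\<close> with \<open>E\<close> supplies the two
  delicate conditions: saturation below the new block, and that each old block remains the maximum
  at some generator.\<close>

lemma glue_staircase:
  assumes st: "stair E r lam" and g: "good B s b" and sE: "s \<notin> \<Union>E"
    and P: "B \<inter> \<Union>E \<subseteq> DL (Lam E r lam)" and ns: "\<And>C. C \<in> E \<Longrightarrow> \<not> C \<subseteq> B"
  shows "staircase (insert B E) (glue E r B)"
proof -
  have sd: "staircase E r" using stairD(1)[OF st] .
  note gd = goodD[OF g] and d = staircaseD[OF sd] and o = orderD[OF sd]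
  have BE: "B \<notin> E" using gd(3) sE by blast
  have rE: "r \<subseteq> E \<times> E" using o(4) by auto
  note gi = glue_iff[OF BE rE]
  have ex: "exposed E r lam t" if "t \<in> B" "t \<in> \<Union>E" for t using P that Lam_DL[OF st] by blast
  \<comment> \<open>If all generators at which \<open>Y\<close> is the maximum were in
    \<open>B\<close>, they would be exposed, so the property would spread over the connected
    \<open>Y\<close> and force \<open>Y\<close> into \<open>B\<close>.\<close>
  have own: "\<exists>t\<in>Y. t \<notin> B \<and> max_at E r t Y" if Y: "Y \<in> E" for Y
  proof (rule ccontr)
    assume n: "\<not> ?thesis"
    obtain t where t: "t \<in> Y" "max_at E r t Y" using d(10)[OF Y] Y unfolding max_at_def by blast
    obtain y where y: "y \<in> Y" "y \<notin> B" using ns[OF Y] by blast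
    let ?T = "{u \<in> Y. max_at E r u Y}"
    have yT: "y \<notin> ?T" using n y by blast
    obtain u v where uv: "u \<in> Y" "u \<in> ?T" "v \<in> Y" "v \<notin> ?T" "adj u v"
      using conn_step[OF d(5)[OF Y] t(1) _ y(1) yT] t by blast
    then have "u \<in> B" using n by blast
    then have "exposed E r lam u" using ex uv(1) Y by blast
    then show False using exposed_max_spread[OF sd _ _ uv(3,5)] uv by blast
  qed
  have sat: "t \<in> Z" if t: "adj t t'" "t \<in> B" "X \<in> E" "t \<in> X" "Z \<in> E" "t' \<in> Z" "(X, Z) \<in> r" for t t' X Z
  proof -
    have "exposed E r lam t" using ex t by blast
    then obtain Y1 where "Y1 \<in> E" "t \<in> Y1" "(Z, Y1) \<in> r" using t(1,5,6) unfolding exposed_def by meson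
    then show ?thesis using d(8)[OF t(1) t(3), of Y1 Z] t by blast
  qed
  show ?thesis
  proof (rule staircaseI)
    show "finite (insert B E)" using d(1) by simp
    show "partial_order_on (insert B E) (glue E r B)"
      unfolding partial_order_on_def preorder_on_def
    proof (intro conjI)
      show "glue E r B \<subseteq> insert B E \<times> insert B E" unfolding glue_def using rE by auto
      show "refl_on (insert B E) (glue E r B)" unfolding refl_on_def glue_def using o(1) by auto
      show "antisym (glue E r B)"
        unfolding antisym_def gi using o(3,4) BE by (metis (no_types, lifting))
      show "trans (glue E r B)"
      proof (rule transI)
        fix X Y Z assume XY: "(X, Y) \<in> glue E r B" and YZ: "(Y, Z) \<in> glue E r B"
        show "(X, Z) \<in> glue E r B"
        proof (cases "Y = B")
          case True
          then have "Z = B" using YZ gi[of Y Z] o(4) BE by (auto split: if_splits)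
          then show ?thesis using XY True by simp
        next
          case False
          then have "(X, Y) \<in> r" using XY gi by simp
          show ?thesis
          proof (cases "Z = B")
            case True
            then obtain U where "U \<in> E" "(Y, U) \<in> r" "touch U B" using YZ gi \<open>Y \<noteq> B\<close> by auto
            then show ?thesis using o(2)[OF \<open>(X, Y) \<in> r\<close>] True gi by auto
          next
            case False
            then have "(Y, Z) \<in> r" using YZ gi by simp
            then show ?thesis using o(2)[OF \<open>(X, Y) \<in> r\<close>] False gi by simp
          qed
        qed
      qed
    qed
    show "X \<noteq> {}" if "X \<in> insert B E" for X using that gd(3) d(3) by blast
    show "X \<subseteq> S" if "X \<in> insert B E" for X using that gd(7) d(4) by blast
    show "conn X" if "X \<in> insert B E" for X using that gd(1) d(5) by blast
    show "conn (X \<union> Y)" if c: "covers (insert B E) (glue E r B) X Y" for X Y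
    proof (cases "X = B")
      case True
      have YX: "(Y, B) \<in> glue E r B" "Y \<noteq> B" using c True by (auto simp: covers_def)
      then obtain Z where Z: "Z \<in> E" "(Y, Z) \<in> r" "touch Z B" using gi by auto
      have "(Y, Z) \<in> glue E r B" "(Z, B) \<in> glue E r B" "Z \<noteq> B"
        using Z BE o(1) gi by auto
      then have "Z = Y" using c True Z(1) unfolding covers_def by blast
      then show ?thesis using conn_union[OF gd(1) d(5)[OF Z(1)]] touch_sym[OF Z(3)] True by simp
    next
      case False
      have YX: "(Y, X) \<in> r" using c False gi by (auto simp: covers_def)
      have "\<not> (\<exists>C\<in>E. C \<noteq> Y \<and> C \<noteq> X \<and> (Y, C) \<in> r \<and> (C, X) \<in> r)"
        using c unfolding covers_def glue_def by blast
      moreover have "X \<in> E" "Y \<in> E" using o(4)[OF YX] by simp_all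
      moreover have "Y \<noteq> X" using c by (simp add: covers_def)
      ultimately have "covers E r X Y" using YX by (simp add: covers_def)
      then show ?thesis by (rule d(6))
    qed
    have up: "(X, B) \<in> glue E r B" if "X \<in> E" "touch X B" for X using that o(1) gi by auto
    show "(X, Y) \<in> glue E r B \<or> (Y, X) \<in> glue E r B" if XY: "X \<in> insert B E" "Y \<in> insert B E" "touch X Y" for X Y
    proof (cases "X = B \<or> Y = B")
      case True
      then show ?thesis using XY up touch_sym by (auto simp: glue_def)
    next
      case False
      then have "(X, Y) \<in> r \<or> (Y, X) \<in> r" using d(7)[of X Y] XY by simp
      then show ?thesis by (auto simp: glue_def)
    qed
    show "u \<in> Z" if h: "adj u t" "X \<in> insert B E" "Y \<in> insert B E" "Z \<in> insert B E" "u \<in> X" "u \<in> Y" "t \<in> Z"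
      "(X, Z) \<in> glue E r B" "(Z, Y) \<in> glue E r B" for u t X Y Z
    proof (cases "Z = B")
      case True
      then have "Y = B" using h(9) gi[of Z Y] o(4) BE by (auto split: if_splits)
      then show ?thesis using True h by simp
    next
      case False
      then have XZ: "(X, Z) \<in> r" using h(8) gi by simp
      then have XE: "X \<in> E" "Z \<in> E" using o(4) by blast+
      show ?thesis
      proof (cases "Y = B")
        case True
        then show ?thesis using sat[OF h(1) _ XE(1) h(5) XE(2) h(7) XZ] h(6) by simp
      next
        case False
        then have "(Z, Y) \<in> r" using h(9) gi by simp
        then show ?thesis using d(8)[OF h(1) XE(1) _ XE(2) h(5,6,7) XZ] o(4) by blast
      qed
    qed
    show "\<exists>u\<in>X. \<forall>Y\<in>insert B E. u \<in> Y \<longrightarrow> (X, Y) \<in> glue E r B" if X: "X \<in> insert B E" for X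
    proof (cases "X = B")
      case True
      then show ?thesis using gd(3) sE by (auto simp: glue_def)
    next
      case False
      then have XE: "X \<in> E" using X by simp
      obtain u where u: "u \<in> X" "\<forall>Y\<in>E. u \<in> Y \<longrightarrow> (X, Y) \<in> r" using d(9)[OF XE] by blast
      have "(X, B) \<in> glue E r B" if "u \<in> B" by (rule up[OF XE]) (use u that in \<open>auto simp: touch_def\<close>)
      then show ?thesis using u by (auto simp: glue_def)
    qed
    show "\<exists>u\<in>X. \<forall>Y\<in>insert B E. u \<in> Y \<longrightarrow> (Y, X) \<in> glue E r B" if X: "X \<in> insert B E" for X
    proof (cases "X = B")
      case True
      then show ?thesis using gd(3) sE by (auto simp: glue_def)
    next
      case False
      then obtain u where "u \<in> X" "u \<notin> B" "max_at E r u X" using own X by blast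
      then show ?thesis by (auto simp: glue_def max_at_def)
    qed
  qed
qed

text \<open>Placing \<open>B\<close> on top enlarges \<open>J_L\<close> of an old block
  \<open>X\<close> only by generators of \<open>B\<close> at which \<open>X\<close> was the maximum;
  being exposed, these are already left descents of \<open>lam X\<close>.\<close>

lemma glue_stair:
  assumes st: "stair E r lam" and g: "good B s b" and sE: "s \<notin> \<Union>E"
    and P: "B \<inter> \<Union>E \<subseteq> DL (Lam E r lam)" and ns: "\<And>C. C \<in> E \<Longrightarrow> \<not> C \<subseteq> B"
  shows "stair (insert B E) (glue E r B) (lam(B := b))"
    "Lam (insert B E) (glue E r B) (lam(B := b)) = b \<otimes> (wo (B \<inter> \<Union>E) \<otimes> Lam E r lam)"
proof -
  let ?D = "insert B E" and ?q = "glue E r B" and ?l = "lam(B := b)"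
  have sd: "staircase E r" using stairD(1)[OF st] .
  have sD: "staircase ?D ?q" by (rule glue_staircase[OF assms])
  note gd = goodD[OF g] and o = orderD[OF sd]
  have BE: "B \<notin> E" using gd(3) sE by blast
  have rE: "r \<subseteq> E \<times> E" using o(4) by auto
  note gi = glue_iff[OF BE rE]
  have top: "topmost ?D ?q B" unfolding topmost_def gi using o(4) BE by auto
  have DE: "?D - {B} = E" using BE by simp
  have qE: "rest ?q E = r" using rE BE by (auto simp: glue_def)
  have lE: "restrict ?l E = lam"
    using stairD(2)[OF st] BE by (auto simp: fun_eq_iff extensional_def)
  have "J_L ?D ?q X \<subseteq> DL (?l X) \<and> (\<exists>s\<in>X - J_R ?D ?q X. good X s (?l X))" if X: "X \<in> ?D" for X
  proof (cases "X = B")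
    case True
    have "s \<notin> J_R ?D ?q B" using JR_top[OF sD top] sE DE by auto
    then show ?thesis using True JL_top[OF sD top] g gd(3) by auto
  next
    case False
    then have XE: "X \<in> E" using X by simp
    have XD: "X \<in> ?D - {B}" using XE DE by simp
    have JR: "J_R ?D ?q X = J_R E r X" using JR_remove[OF sD top XD] unfolding DE qE by simp
    have "J_L ?D ?q X \<subseteq> DL (lam X)"
    proof
      fix t assume "t \<in> J_L ?D ?q X"
      then obtain Y where t: "t \<in> X" "Y \<in> ?D" "t \<in> Y" "(Y, X) \<notin> ?q" using JL_iff[OF sD X] by blast
      show "t \<in> DL (lam X)"
      proof (cases "max_at E r t X")
        case True
        have "Y = B" using t True by (auto simp: max_at_def glue_def)
        then have "exposed E r lam t" using P Lam_DL[OF st] t XE by blast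
        then show ?thesis using True by (simp add: exposed_def)
      next
        case False
        then have "t \<in> J_L E r X" using JL_iff[OF sd XE] t(1) XE unfolding max_at_def by blast
        then show ?thesis using stairD(3)[OF st XE] by blast
      qed
    qed
    then show ?thesis using False JR stairD(4)[OF st XE] by simp
  qed
  moreover have "?l \<in> extensional ?D" using stairD(2)[OF st] by (auto simp: extensional_def)
  ultimately show stD: "stair ?D ?q ?l" unfolding stair_def using sD by blast
  show "Lam ?D ?q ?l = b \<otimes> (wo (B \<inter> \<Union>E) \<otimes> Lam E r lam)"
    using peel_step(12)[OF stD top refl refl refl refl refl refl peel_rest(1-3)[OF stD top refl refl refl refl refl]]
    unfolding DE qE lE by simp
qed

text \<open>By spreading, \<open>C\<close> is the maximum at all its generators, so all of them are
  left descents of its label. A cover of \<open>C\<close> would touch \<open>C\<close>, and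
  exposedness would place it below \<open>C\<close> as well.\<close>

lemma exposed_block:
  assumes st: "stair E r lam" and C: "C \<in> E" "C \<subseteq> DL (Lam E r lam)"
  shows "topmost E r C" "lam C = wo C"
proof -
  have sd: "staircase E r" using stairD(1)[OF st] .
  note d = staircaseD[OF sd] and o = orderD[OF sd]
  have ex: "exposed E r lam t" if "t \<in> C" for t using C that Lam_DL[OF st] by blast
  obtain t where t: "t \<in> C" "max_at E r t C" using d(10)[OF C(1)] C(1) unfolding max_at_def by blast
  have all: "max_at E r u C" if u: "u \<in> C" for u
  proof (rule ccontr)
    let ?T = "{u \<in> C. max_at E r u C}"
    assume "\<not> max_at E r u C"
    then have uT: "u \<notin> ?T" by simp
    obtain p v where pv: "p \<in> C" "p \<in> ?T" "v \<in> C" "v \<notin> ?T" "adj p v"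
      using conn_step[OF d(5)[OF C(1)] t(1) _ u uT] t by blast
    then show False using exposed_max_spread[OF sd ex[OF pv(1)] _ pv(3,5)] by blast
  qed
  have "C \<subseteq> DL (lam C)" using ex all unfolding exposed_def by blast
  then show "lam C = wo C"
    using wo_unique[of "lam C" C] good_label(1,2)[OF st C(1)] W_sp_sub[of "lam C" C] by simp
  show "topmost E r C" unfolding topmost_def
  proof (intro conjI ballI impI, rule C(1), rule ccontr)
    fix X assume X: "X \<in> E" "(C, X) \<in> r" "X \<noteq> C"
    define Q where "Q = {Z \<in> E. (C, Z) \<in> r \<and> Z \<noteq> C}"
    \<comment> \<open>In the converse order, a maximal element of \<open>Q\<close> is a minimal
      block strictly above \<open>C\<close>, that is, a cover.\<close>
    define q where "q = r\<inverse>"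
    have po: "partial_order_on E q" using d(2) by (simp add: q_def)
    have XQ: "X \<in> Q" and QE: "Q \<subseteq> E" using X by (simp_all add: Q_def)
    obtain Z where Z: "Z \<in> Q" "\<And>Y. Y \<in> Q \<Longrightarrow> (Z, Y) \<in> q \<Longrightarrow> Y = Z"
      using finite_maximal_above[OF d(1) po QE XQ] by metis
    have "Y = Z" if Y: "Y \<in> E" "Y \<noteq> C" "(C, Y) \<in> r" "(Y, Z) \<in> r" for Y
      using Z(2)[of Y] Y by (simp add: Q_def q_def)
    moreover have ZQ: "Z \<in> E" "(C, Z) \<in> r" "Z \<noteq> C" using Z(1) by (simp_all add: Q_def)
    ultimately have "covers E r Z C" using C(1) unfolding covers_def by metis
    then have "touch Z C" using conn_union_touch[OF d(6)] d(3) ZQ(1) C(1) by blast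
    moreover have ZC: "(Z, C) \<notin> r" using ZQ o(3) by blast
    moreover have "(Z, C) \<in> r" if uv: "v \<in> Z" "u \<in> C" "adj v u" for u v
    proof -
      have a: "adj u v" using adj_sym uv by simp
      then obtain Y where Y: "Y \<in> E" "u \<in> Y" "(Z, Y) \<in> r"
        using ex[OF uv(2)] uv(1) ZQ(1) unfolding exposed_def by meson
      then have "(Y, C) \<in> r" using all[OF uv(2)] by (simp add: max_at_def)
      then show ?thesis using o(2)[OF Y(3)] by simp
    qed
    moreover have "(Z, C) \<in> r" if "v \<in> Z" "v \<in> C" for v
      using all[OF that(2)] that(1) ZQ(1) by (simp add: max_at_def)
    ultimately show False unfolding touch_def by blast
  qed
qed

text \<open>Removing a block \<open>C\<close> inside \<open>B\<close> does not change
  \<open>wo (B \<inter> \<Union>E) \<otimes> Lam E r lam\<close>: the label \<open>wo C\<close>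
  cancels against part of the longest element, and the rest of the overlap commutes with
  \<open>C\<close>. When no such block is left, \<open>B\<close> is glued on top.\<close>

lemma extend_stair:
  "stair E r lam \<Longrightarrow> good B s b \<Longrightarrow> s \<notin> \<Union>E \<Longrightarrow> B \<inter> \<Union>E \<subseteq> DL (Lam E r lam) \<Longrightarrow>
   \<exists>D q l. stair D q l \<and> Lam D q l = b \<otimes> (wo (B \<inter> \<Union>E) \<otimes> Lam E r lam)"
proof (induction "card E" arbitrary: E r lam)
  case 0
  then have "E = {}" using staircaseD(1)[OF stairD(1)] by simp
  then show ?case using glue_stair[OF 0(2-5)] by blast
next
  case (Suc n)
  note st = Suc(3) and g = Suc(4) and sE = Suc(5) and P = Suc(6)
  show ?case
  proof (cases "\<exists>C\<in>E. C \<subseteq> B")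
    case False
    then show ?thesis using glue_stair[OF Suc(3-6)] by blast
  next
    case True
    then obtain C where C: "C \<in> E" "C \<subseteq> B" by blast
    let ?P = "B \<inter> \<Union>E"
    have CP: "C \<subseteq> ?P" using C by blast
    have CD: "C \<subseteq> DL (Lam E r lam)" using CP P by blast
    have top: "topmost E r C" and lC: "lam C = wo C" using exposed_block[OF st C(1) CD] by simp_all
    define E' where "E' = E - {C}"
    define q where "q = rest r E'"
    define m where "m = restrict lam E'"
    define z where "z = Lam E' q m"
    define M where "M = \<Union>E'"
    define N where "N = C \<inter> M"
    note e = peel_rest[OF st top E'_def q_def m_def z_def M_def]
    note p = peel_step[OF st top E'_def q_def m_def z_def M_def N_def e(1-3)]
    note stE' = e(4) and cE = e(5)[OF Suc(2)[symmetric]] and zc = e(2)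
    let ?Q = "?P - C"
    have Qz: "?Q \<subseteq> DL z" and QC: "\<And>t x. t \<in> ?Q \<Longrightarrow> x \<in> C \<Longrightarrow> \<not> adj t x"
      using peel_DL[OF st top] P by (auto simp: z_def E'_def q_def m_def)
    have P': "B \<inter> M = ?Q \<union> N" using C by (auto simp: M_def N_def E'_def)
    have P'z: "B \<inter> M \<subseteq> DL z" unfolding P' using Qz p(3) by simp
    have s': "s \<notin> \<Union>E'" using sE by (auto simp: E'_def)
    obtain D' q' l' where D': "stair D' q' l'" "Lam D' q' l' = b \<otimes> (wo (B \<inter> M) \<otimes> z)"
      using Suc(1)[OF cE stE' g s'] P'z by (auto simp: M_def z_def)
    have sP: "sph ?P" using DL_spherical[OF Lam_carrier[OF st] P] .
    have sP': "sph (?Q \<union> N)" using DL_spherical[OF zc P'z] P' by simp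
    have sQ: "sph ?Q" and sC: "sph C" using sph_subset[OF sP CP] sph_subset[OF sP Diff_subset] by simp_all
    have PQ: "?Q \<union> C = ?P" using CP by blast
    have sQC: "sph (?Q \<union> C)" using sP by (simp only: PQ)
    have "wo (?Q \<union> C) = wo ?Q \<otimes> wo C" by (rule wo_union[OF sQC _ QC]) auto
    then have wP: "wo ?P = wo ?Q \<otimes> wo C" by (simp only: PQ)
    have wP': "wo (B \<inter> M) = wo ?Q \<otimes> wo N"
      unfolding P' by (rule wo_union[OF sP']) (use QC in \<open>auto simp: N_def\<close>)
    have "wo ?P \<otimes> Lam E r lam = wo ?Q \<otimes> (wo N \<otimes> z)"
      unfolding wP p(12) lC using sQ sC p(4) zc by (simp add: m_assoc wo_cancel)
    also have "\<dots> = wo (B \<inter> M) \<otimes> z" unfolding wP' using sQ p(4) zc by (simp add: m_assoc)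
    finally show ?thesis using D' by metis
  qed
qed

lemma stair_empty: "stair {} {} (\<lambda>_. undefined)"
  unfolding stair_def by (auto intro!: staircaseI simp: covers_def extensional_def)

lemma CB_Lam: "CB w \<Longrightarrow> \<exists>D r lam. stair D r lam \<and> Lam D r lam = w"
proof (induction rule: CB.induct)
  case CB_one
  then show ?case using stair_empty Lam_empty[OF stair_empty] by blast
next
  case (CB_step w v u)
  then obtain E r lam where E: "stair E r lam" "Lam E r lam = u" by blast
  obtain s where s: "good (sp v) s (v \<otimes> wo (sp v - {s}))"
    "w = (v \<otimes> wo (sp v - {s})) \<otimes> (wo (sp v - {s}) \<otimes> u)" "sp u = sp w - {s}" "sp v - {s} \<subseteq> DL u"
    "u \<in> carrier G"
    using grassmannian_good[OF CB_step(1)] by metis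
  have UE: "\<Union>E = sp u" using Lam_sp[OF E(1)] E(2) by simp
  have sE: "s \<notin> \<Union>E" using UE s(3) by simp
  \<comment> \<open>The overlap is exactly \<open>K = sp v - {s}\<close>, so the extended diagram
    has product \<open>b (wo K u)\<close>, which is \<open>w\<close>.\<close>
  have PE: "sp v \<inter> \<Union>E = sp v - {s}" using UE s(3,4) DL_sp[OF s(5)] by blast
  from extend_stair[OF E(1) s(1) sE] s(2,4) show ?case unfolding PE E(2) by metis
qed

end

theorem theorem5p1:
  fixes G :: "('a, 'b) monoid_scheme" and S :: "'a set"
  assumes "coxeter_system G S"
  shows "bij_betw (\<lambda>(D, r, lam). Lambda G S D r lam)
    {(D, r, lam). staircase_diagram G S D r \<and> nearly_maximal_labelling G S D r lam}
    {w \<in> carrier G. \<exists>vs. complete_BP_decomp G S w vs}"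
proof -
  interpret coxeter_system G S by fact
  have dom: "staircase_diagram G S D r \<and> nearly_maximal_labelling G S D r lam \<longleftrightarrow> stair D r lam" for D r lam
    using stair_iff stairD(1) by blast
  have cod: "w \<in> carrier G \<and> (\<exists>vs. complete_BP_decomp G S w vs) \<longleftrightarrow> CB w" for w
    using CB_iff by blast
  show ?thesis unfolding dom cod
  proof (rule bij_betw_imageI)
    show "inj_on (\<lambda>(D, r, lam). Lam D r lam) {(D, r, lam). stair D r lam}"
      using Lam_inj by (auto simp: inj_on_def)
    show "(\<lambda>(D, r, lam). Lam D r lam) ` {(D, r, lam). stair D r lam} = {w. CB w}"
      using Lam_CB CB_Lam by (auto simp: image_iff) metis
  qed
qed

end
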